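(* Let $\mathcal C$ be a closed symmetric monoidal category and $\mathcal M$ a subcanonical left $\mathcal C$-actegory satisfying the standing assumptions in the context. In $Sh(Aff_{\mathcal C})_{\mathcal M}$, Zariski open immersions relative to $\mathcal M$ are stable under base change and closed under composition.
   Context: $(\mathcal C,\otimes,1)$ is a closed symmetric monoidal category which is complete and cocomplete. A left $\mathcal C$-actegory $(\mathcal M,\boxtimes,\lambda,l)$ is a category $\mathcal M$ with a bifunctor $\boxtimes:\mathcal C\times\mathcal M\to\mathcal M$ and natural isomorphisms $\lambda_{a,b,m}:a\boxtimes(b\boxtimes m)\to(a\otimes b)\boxtimes m$ and $l_m:1\boxtimes m\to m$ satisfying the usual pentagon and unit coherence axioms. $\mathcal M$ is a fixed left $\mathcal C$-actegory whose underlying category is complete and cocomplete and such that all functors $a\boxtimes -$ ($a\in\mathcal C$) and $-\boxtimes m$ ($m\in\mathcal M$) preserve colimits. $Comm(\mathcal C)$ is the category of commutative monoid objects in $\mathcal C$. For $a=(a,\mu_a,\iota_a)\in Comm(\mathcal C)$, $\mathbf{Mod}_{\mathcal M}(a)$ is the category of pairs $(m,\rho)$ with $m\in\mathcal M$, $\rho:a\boxtimes m\to m$ satisfying $\rho\circ(\mu_a\boxtimes 1_m)\circ\lambda_{a,a,m}=\rho\circ(1_a\boxtimes\rho)$ and $\rho\circ(\iota_a\boxtimes 1_m)=l_m$; morphisms are morphisms in $\mathcal M$ commuting with the actions. For $\alpha:a\to b$ in $Comm(\mathcal C)$, $\alpha_*:\mathbf{Mod}_{\mathcal M}(b)\to\mathbf{Mod}_{\mathcal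 M}(a)$, $(n,\tau)\mapsto(n,\tau\circ(\alpha\boxtimes1_n))$, is restriction of scalars and $\alpha^*=b\boxtimes_a-$ denotes its left adjoint (extension of scalars). $Aff_{\mathcal C}:=Comm(\mathcal C)^{op}$; the object corresponding to $a$ is $Spec(a)$ and the morphism corresponding to $\alpha:a\to b$ is $\alpha^{op}:Spec(b)\to Spec(a)$. A morphism $\alpha:a\to b$ is $\mathcal M$-flat if $\alpha^*$ preserves finite limits. It is of finite type if for every filtered diagram $\mathbb D:\mathcal I\to a/Comm(\mathcal C)$ the canonical map $\mathrm{colim}_{i}\,a/Comm(\mathcal C)(b,\mathbb D(i))\to a/Comm(\mathcal C)(b,\mathrm{colim}_i\,\mathbb D(i))$ is an isomorphism, where $a/Comm(\mathcal C)$ is the coslice category. A family $\{\alpha_i^{op}:Spec(a_i)\to Spec(a)\}_{i\in I}$ is an fpqc $\mathcal M$-cover if each $\alpha_i$ is $\mathcal M$-flat and there is a finite $J\subseteq I$ such that the family $\{\alpha_j^*\}_{j\in J}$ is conservative (jointly reflects isomorphisms). $\alpha^{op}$ is a spectral immersion relative to $\mathcal M$ if $\alpha$ is $\mathcal M$-flat and an epimorphism of finite type in $Comm(\mathcal C)$. A spectral $\mathcal M$-cover is an fpqc $\mathcal M$-cover all of whose members are spectral immersions relative to $\mathcal M$. These covers are bases of Grothendieck topologies on $Aff_{\mathcal C}$, the fpqc $\mathcal M$-topology and the spectral $\mathcal M$-topology. $Sh(Aff_{\mathcal C})_{\mathcal M}$ is the category of sheaves of sets for the spectral $\mathcal M$-topology.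 $\mathcal M$ is subcanonical if every representable presheaf $Aff_{\mathcal C}(-,Spec(a))$ is a sheaf for the fpqc $\mathcal M$-topology (hence for the spectral one); then $Spec(a)$ is identified with the sheaf it represents, and called an affine scheme. A subsheaf $F\subseteq X$ of an affine scheme $X=Spec(a)$ is Zariski open relative to $\mathcal M$ if there is a family $\{Spec(a_i)\to Spec(a)\}_{i\in I}$ of spectral immersions relative to $\mathcal M$ such that $F$ is the image in $Sh(Aff_{\mathcal C})_{\mathcal M}$ of the induced morphism $\coprod_{i}Spec(a_i)\to X$. A morphism $F\to G$ in $Sh(Aff_{\mathcal C})_{\mathcal M}$ is a Zariski open immersion relative to $\mathcal M$ if for every affine $X$ and every morphism $X\to G$, the morphism $F\times_G X\to X$ is a monomorphism whose image is Zariski open relative to $\mathcal M$ in $X$. *)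

theory Defs
  imports "HOL-Library.FuncSet" "HOL-Library.Equipollence"
begin

section \<open>Categories and functors\<close>

text \<open>
  Domain and codomain are functions of the arrow, so in derived categories (monoids, modules,
  coslices, functors) an arrow is a triple (source, underlying arrow, target).
\<close>

record ('o, 'm) cat =
  Obj :: "'o set"
  Arr :: "'m set"
  Dom :: "'m \<Rightarrow> 'o"
  Cod :: "'m \<Rightarrow> 'o"
  Ident :: "'o \<Rightarrow> 'm"
  Comp :: "'m \<Rightarrow> 'm \<Rightarrow> 'm"  (infixr "\<cdot>\<index>" 70)

definition hom :: "('o, 'm, 'z) cat_scheme \<Rightarrow> 'o \<Rightarrow> 'o \<Rightarrow> 'm set" where
  "hom A x y = {f \<in> Arr A. Dom A f = x \<and> Cod A f = y}"

locale category =
  fixes A :: "('o, 'm, 'z) cat_scheme" (structure)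
  assumes Dom_Obj: "f \<in> Arr A \<Longrightarrow> Dom A f \<in> Obj A"
    and Cod_Obj: "f \<in> Arr A \<Longrightarrow> Cod A f \<in> Obj A"
    and Ident_hom: "x \<in> Obj A \<Longrightarrow> Ident A x \<in> hom A x x"
    and Comp_hom: "f \<in> hom A x y \<Longrightarrow> g \<in> hom A y z \<Longrightarrow> g \<cdot> f \<in> hom A x z"
    and Ident_left: "f \<in> hom A x y \<Longrightarrow> Ident A y \<cdot> f = f"
    and Ident_right: "f \<in> hom A x y \<Longrightarrow> f \<cdot> Ident A x = f"
    and Comp_assoc: "f \<in> hom A w x \<Longrightarrow> g \<in> hom A x y \<Longrightarrow> h \<in> hom A y z
                       \<Longrightarrow> h \<cdot> (g \<cdot> f) = (h \<cdot> g) \<cdot> f"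

definition op_cat :: "('o, 'm, 'z) cat_scheme \<Rightarrow> ('o, 'm) cat" where
  "op_cat A = \<lparr>Obj = Obj A, Arr = Arr A, Dom = Cod A, Cod = Dom A, Ident = Ident A,
               Comp = (\<lambda>g f. Comp A f g)\<rparr>"

definition prod_cat :: "('o, 'm, 'z) cat_scheme \<Rightarrow> ('p, 'n, 'y) cat_scheme \<Rightarrow> ('o \<times> 'p, 'm \<times> 'n) cat" where
  "prod_cat A B = \<lparr>Obj = Obj A \<times> Obj B, Arr = Arr A \<times> Arr B,
     Dom = map_prod (Dom A) (Dom B), Cod = map_prod (Cod A) (Cod B),
     Ident = map_prod (Ident A) (Ident B),
     Comp = (\<lambda>(g, g') (f, f'). (Comp A g f, Comp B g' f'))\<rparr>"

definition full_subcat :: "('o, 'm, 'z) cat_scheme \<Rightarrow> 'o set \<Rightarrow> ('o, 'm) cat" where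
  "full_subcat A S = \<lparr>Obj = S, Arr = {f \<in> Arr A. Dom A f \<in> S \<and> Cod A f \<in> S},
     Dom = Dom A, Cod = Cod A, Ident = Ident A, Comp = Comp A\<rparr>"

definition und :: "'p \<times> 'm \<times> 'p \<Rightarrow> 'm" where
  "und f = fst (snd f)"

text \<open>
  Objects of \<open>S\<close>, each with an underlying object \<open>U x\<close> of \<open>A\<close>; the arrows from \<open>x\<close> to \<open>y\<close> are the
  arrows \<open>U x \<rightarrow> U y\<close> of \<open>A\<close> that satisfy \<open>P x f y\<close>.
\<close>

definition structured_cat ::
  "('o, 'm, 'z) cat_scheme \<Rightarrow> 'p set \<Rightarrow> ('p \<Rightarrow> 'o) \<Rightarrow> ('p \<Rightarrow> 'm \<Rightarrow> 'p \<Rightarrow> bool) \<Rightarrow> ('p, 'p \<times> 'm \<times> 'p) cat" where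
  "structured_cat A S U P = \<lparr>Obj = S,
     Arr = {(x, f, y). x \<in> S \<and> y \<in> S \<and> f \<in> hom A (U x) (U y) \<and> P x f y},
     Dom = fst, Cod = (\<lambda>f. snd (snd f)),
     Ident = (\<lambda>x. (x, Ident A (U x), x)),
     Comp = (\<lambda>g f. (fst f, Comp A (und g) (und f), snd (snd g)))\<rparr>"

record ('o, 'm, 'p, 'n) fctr =
  FO :: "'o \<Rightarrow> 'p"
  FM :: "'m \<Rightarrow> 'n"

definition is_functor ::
  "('o, 'm, 'z) cat_scheme \<Rightarrow> ('p, 'n, 'y) cat_scheme \<Rightarrow> ('o, 'm, 'p, 'n) fctr \<Rightarrow> bool" where
  "is_functor A B F \<longleftrightarrow>
     (\<forall>x\<in>Obj A. FO F x \<in> Obj B) \<and>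
     (\<forall>f\<in>Arr A. FM F f \<in> hom B (FO F (Dom A f)) (FO F (Cod A f))) \<and>
     (\<forall>x\<in>Obj A. FM F (Ident A x) = Ident B (FO F x)) \<and>
     (\<forall>f\<in>Arr A. \<forall>g\<in>Arr A. Cod A f = Dom A g \<longrightarrow> FM F (Comp A g f) = Comp B (FM F g) (FM F f))"

definition fcomp :: "('p, 'n, 'q, 'r) fctr \<Rightarrow> ('o, 'm, 'p, 'n) fctr \<Rightarrow> ('o, 'm, 'q, 'r) fctr" where
  "fcomp G F = \<lparr>FO = FO G \<circ> FO F, FM = FM G \<circ> FM F\<rparr>"

definition is_iso :: "('o, 'm, 'z) cat_scheme \<Rightarrow> 'm \<Rightarrow> bool" where
  "is_iso A f \<longleftrightarrow> f \<in> Arr A \<and>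
     (\<exists>g \<in> hom A (Cod A f) (Dom A f).
        Comp A g f = Ident A (Dom A f) \<and> Comp A f g = Ident A (Cod A f))"

definition is_mono :: "('o, 'm, 'z) cat_scheme \<Rightarrow> 'm \<Rightarrow> bool" where
  "is_mono A f \<longleftrightarrow> f \<in> Arr A \<and>
     (\<forall>z\<in>Obj A. \<forall>g \<in> hom A z (Dom A f). \<forall>h \<in> hom A z (Dom A f). Comp A f g = Comp A f h \<longrightarrow> g = h)"

definition is_epi :: "('o, 'm, 'z) cat_scheme \<Rightarrow> 'm \<Rightarrow> bool" where
  "is_epi A f \<longleftrightarrow> is_mono (op_cat A) f"

text \<open>\<open>L\<close> is left adjoint to \<open>R\<close>, expressed by the universal property of the unit \<open>\<eta>\<close>.\<close>

definition left_adjoint ::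
  "('o, 'm, 'z) cat_scheme \<Rightarrow> ('p, 'n, 'y) cat_scheme \<Rightarrow>
   ('o, 'm, 'p, 'n) fctr \<Rightarrow> ('p, 'n, 'o, 'm) fctr \<Rightarrow> bool" where
  "left_adjoint A B L R \<longleftrightarrow> is_functor A B L \<and> is_functor B A R \<and>
     (\<exists>\<eta>. (\<forall>x\<in>Obj A. \<eta> x \<in> hom A x (FO R (FO L x))) \<and>
          (\<forall>f\<in>Arr A. Comp A (FM R (FM L f)) (\<eta> (Dom A f)) = Comp A (\<eta> (Cod A f)) f) \<and>
          (\<forall>x\<in>Obj A. \<forall>y\<in>Obj B. \<forall>f \<in> hom A x (FO R y).
             \<exists>!g. g \<in> hom B (FO L x) y \<and> Comp A (FM R g) (\<eta> x) = f))"


section \<open>Limits and colimits\<close>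

definition is_cone ::
  "('o, 'm, 'z) cat_scheme \<Rightarrow> ('i, 'j) cat \<Rightarrow> ('i, 'j, 'o, 'm) fctr \<Rightarrow> 'o \<Rightarrow> ('i \<Rightarrow> 'm) \<Rightarrow> bool" where
  "is_cone A J D x \<pi> \<longleftrightarrow> x \<in> Obj A \<and> (\<forall>i\<in>Obj J. \<pi> i \<in> hom A x (FO D i)) \<and>
     (\<forall>u\<in>Arr J. Comp A (FM D u) (\<pi> (Dom J u)) = \<pi> (Cod J u))"

definition is_limit ::
  "('o, 'm, 'z) cat_scheme \<Rightarrow> ('i, 'j) cat \<Rightarrow> ('i, 'j, 'o, 'm) fctr \<Rightarrow> 'o \<Rightarrow> ('i \<Rightarrow> 'm) \<Rightarrow> bool" where
  "is_limit A J D x \<pi> \<longleftrightarrow> is_cone A J D x \<pi> \<and>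
     (\<forall>y \<rho>. is_cone A J D y \<rho> \<longrightarrow>
        (\<exists>!h. h \<in> hom A y x \<and> (\<forall>i\<in>Obj J. Comp A (\<pi> i) h = \<rho> i)))"

definition is_colimit ::
  "('o, 'm, 'z) cat_scheme \<Rightarrow> ('i, 'j) cat \<Rightarrow> ('i, 'j, 'o, 'm) fctr \<Rightarrow> 'o \<Rightarrow> ('i \<Rightarrow> 'm) \<Rightarrow> bool" where
  "is_colimit A J D x \<iota> \<longleftrightarrow> is_limit (op_cat A) (op_cat J) D x \<iota>"

text \<open>
  Smallness is relative to a universe represented by a type \<open>'s\<close>: a set is small if its cardinality
  is strictly below that of \<open>'s\<close>.  Every category with a small set of arrows is isomorphic to one
  whose objects and arrows have type \<open>'s\<close>, so diagrams of these shapes are all small diagrams.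
\<close>

definition small_shape :: "('s, 's) cat \<Rightarrow> bool" where
  "small_shape J \<longleftrightarrow> category J \<and> Arr J \<prec> (UNIV :: 's set)"

definition complete :: "'s itself \<Rightarrow> ('o, 'm, 'z) cat_scheme \<Rightarrow> bool" where
  "complete S A \<longleftrightarrow>
     (\<forall>J :: ('s, 's) cat. \<forall>D. small_shape J \<and> is_functor J A D \<longrightarrow> (\<exists>x \<pi>. is_limit A J D x \<pi>))"

definition cocomplete :: "'s itself \<Rightarrow> ('o, 'm, 'z) cat_scheme \<Rightarrow> bool" where
  "cocomplete S A \<longleftrightarrow>
     (\<forall>J :: ('s, 's) cat. \<forall>D. small_shape J \<and> is_functor J A D \<longrightarrow> (\<exists>x \<iota>. is_colimit A J D x \<iota>))"

definition preserves_colimits ::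
  "'s itself \<Rightarrow> ('o, 'm, 'z) cat_scheme \<Rightarrow> ('p, 'n, 'y) cat_scheme \<Rightarrow> ('o, 'm, 'p, 'n) fctr \<Rightarrow> bool" where
  "preserves_colimits S A B F \<longleftrightarrow>
     (\<forall>J :: ('s, 's) cat. \<forall>D x \<iota>. small_shape J \<and> is_functor J A D \<and> is_colimit A J D x \<iota>
        \<longrightarrow> is_colimit B J (fcomp F D) (FO F x) (FM F \<circ> \<iota>))"

definition preserves_finite_limits ::
  "('o, 'm, 'z) cat_scheme \<Rightarrow> ('p, 'n, 'y) cat_scheme \<Rightarrow> ('o, 'm, 'p, 'n) fctr \<Rightarrow> bool" where
  "preserves_finite_limits A B F \<longleftrightarrow>
     (\<forall>J :: (nat, nat) cat. \<forall>D x \<pi>.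
        category J \<and> finite (Arr J) \<and> is_functor J A D \<and> is_limit A J D x \<pi>
        \<longrightarrow> is_limit B J (fcomp F D) (FO F x) (FM F \<circ> \<pi>))"

definition filtered :: "('i, 'j) cat \<Rightarrow> bool" where
  "filtered J \<longleftrightarrow> Obj J \<noteq> {} \<and>
     (\<forall>i\<in>Obj J. \<forall>j\<in>Obj J. \<exists>k\<in>Obj J. hom J i k \<noteq> {} \<and> hom J j k \<noteq> {}) \<and>
     (\<forall>u\<in>Arr J. \<forall>v\<in>Arr J. Dom J u = Dom J v \<and> Cod J u = Cod J v \<longrightarrow>
        (\<exists>w\<in>Arr J. Dom J w = Cod J u \<and> Comp J w u = Comp J w v))"

definition is_pullback :: "('o, 'm, 'z) cat_scheme \<Rightarrow> 'm \<Rightarrow> 'm \<Rightarrow> 'm \<Rightarrow> 'm \<Rightarrow> bool" where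
  "is_pullback A f g p q \<longleftrightarrow>
     f \<in> Arr A \<and> g \<in> Arr A \<and> p \<in> Arr A \<and> q \<in> Arr A \<and>
     Cod A f = Cod A g \<and> Dom A p = Dom A q \<and> Cod A p = Dom A f \<and> Cod A q = Dom A g \<and>
     Comp A f p = Comp A g q \<and>
     (\<forall>z\<in>Obj A. \<forall>s \<in> hom A z (Dom A f). \<forall>t \<in> hom A z (Dom A g). Comp A f s = Comp A g t \<longrightarrow>
        (\<exists>!h. h \<in> hom A z (Dom A p) \<and> Comp A p h = s \<and> Comp A q h = t))"

definition is_coproduct ::
  "('o, 'm, 'z) cat_scheme \<Rightarrow> 'i set \<Rightarrow> ('i \<Rightarrow> 'o) \<Rightarrow> 'o \<Rightarrow> ('i \<Rightarrow> 'm) \<Rightarrow> bool" where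
  "is_coproduct A I x q \<iota> \<longleftrightarrow> q \<in> Obj A \<and> (\<forall>i\<in>I. \<iota> i \<in> hom A (x i) q) \<and>
     (\<forall>y\<in>Obj A. \<forall>f. (\<forall>i\<in>I. f i \<in> hom A (x i) y) \<longrightarrow>
        (\<exists>!h. h \<in> hom A q y \<and> (\<forall>i\<in>I. Comp A h (\<iota> i) = f i)))"

definition factors_through :: "('o, 'm, 'z) cat_scheme \<Rightarrow> 'm \<Rightarrow> 'm \<Rightarrow> bool" where
  "factors_through A f n \<longleftrightarrow> (\<exists>g \<in> hom A (Dom A f) (Dom A n). f = Comp A n g)"

text \<open>The image of \<open>f\<close> is the smallest subobject of its codomain through which \<open>f\<close> factors.\<close>

definition is_image :: "('o, 'm, 'z) cat_scheme \<Rightarrow> 'm \<Rightarrow> 'm \<Rightarrow> bool" where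
  "is_image A f n \<longleftrightarrow> f \<in> Arr A \<and> is_mono A n \<and> Cod A n = Cod A f \<and> factors_through A f n \<and>
     (\<forall>n'. is_mono A n' \<and> Cod A n' = Cod A f \<and> factors_through A f n' \<longrightarrow> factors_through A n n')"

definition SET :: "('u set, 'u set \<times> ('u \<Rightarrow> 'u) \<times> 'u set) cat" where
  "SET = \<lparr>Obj = UNIV, Arr = {(X, f, Y). f \<in> X \<rightarrow>\<^sub>E Y},
     Dom = fst, Cod = (\<lambda>f. snd (snd f)), Ident = (\<lambda>X. (X, restrict id X, X)),
     Comp = (\<lambda>g f. (fst f, compose (fst f) (und g) (und f), snd (snd g)))\<rparr>"

definition corep :: "('o, 'm, 'z) cat_scheme \<Rightarrow> 'o \<Rightarrow> ('o, 'm, 'm set, 'm set \<times> ('m \<Rightarrow> 'm) \<times> 'm set) fctr" where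
  "corep A x = \<lparr>FO = hom A x,
     FM = (\<lambda>f. (hom A x (Dom A f), (\<lambda>g \<in> hom A x (Dom A f). Comp A f g), hom A x (Cod A f)))\<rparr>"

definition set_colimit_rel ::
  "('i, 'j) cat \<Rightarrow> ('i, 'j, 'u set, 'u set \<times> ('u \<Rightarrow> 'u) \<times> 'u set) fctr \<Rightarrow> (('i \<times> 'u) \<times> ('i \<times> 'u)) set" where
  "set_colimit_rel J X =
     (let T = (SIGMA i : Obj J. FO X i);
          E = {((Dom J u, s), (Cod J u, und (FM X u) s)) | u s. u \<in> Arr J \<and> s \<in> FO X (Dom J u)}
      in {(p, q). p \<in> T \<and> q \<in> T \<and> (p, q) \<in> (E \<union> E\<inverse>)\<^sup>*})"

definition set_colimit ::
  "('i, 'j) cat \<Rightarrow> ('i, 'j, 'u set, 'u set \<times> ('u \<Rightarrow> 'u) \<times> 'u set) fctr \<Rightarrow> ('i \<times> 'u) set set" where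
  "set_colimit J X = (SIGMA i : Obj J. FO X i) // set_colimit_rel J X"

text \<open>
  For a cocone \<open>\<iota>\<close> under \<open>D\<close>, the canonical map from \<open>colim\<^sub>i A(x, D i)\<close> to \<open>A(x, y)\<close>
  sends the class of \<open>(i, g)\<close> to \<open>\<iota> i \<cdot> g\<close>.
\<close>

definition colimit_comparison :: "('o, 'm, 'z) cat_scheme \<Rightarrow> ('i \<Rightarrow> 'm) \<Rightarrow> ('i \<times> 'm) set \<Rightarrow> 'm" where
  "colimit_comparison A \<iota> c = the_elem ((\<lambda>(i, g). Comp A (\<iota> i) g) ` c)"


section \<open>Symmetric monoidal categories and actegories\<close>

record ('o, 'm) smc = "('o, 'm) cat" +
  tensor :: "('o \<times> 'o, 'm \<times> 'm, 'o, 'm) fctr"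
  munit :: 'o
  assoc :: "'o \<Rightarrow> 'o \<Rightarrow> 'o \<Rightarrow> 'm"
  lunit :: "'o \<Rightarrow> 'm"
  runit :: "'o \<Rightarrow> 'm"
  braid :: "'o \<Rightarrow> 'o \<Rightarrow> 'm"

abbreviation tensorO :: "('o, 'm, 'z) smc_scheme \<Rightarrow> 'o \<Rightarrow> 'o \<Rightarrow> 'o"  (infixr "\<otimes>\<index>" 75)
  where "a \<otimes>\<^bsub>C\<^esub> b \<equiv> FO (tensor C) (a, b)"

abbreviation tensorM :: "('o, 'm, 'z) smc_scheme \<Rightarrow> 'm \<Rightarrow> 'm \<Rightarrow> 'm"  (infixr "\<otimes>\<^sup>m\<index>" 75)
  where "f \<otimes>\<^sup>m\<^bsub>C\<^esub> g \<equiv> FM (tensor C) (f, g)"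

text \<open>The associator is oriented \<open>a \<otimes> (b \<otimes> c) \<rightarrow> (a \<otimes> b) \<otimes> c\<close>, as for actegories below.\<close>

definition symmetric_monoidal :: "('o, 'm) smc \<Rightarrow> bool" where
  "symmetric_monoidal C \<longleftrightarrow>
     category C \<and> is_functor (prod_cat C C) C (tensor C) \<and> munit C \<in> Obj C \<and>
     (\<forall>a\<in>Obj C. \<forall>b\<in>Obj C. \<forall>c\<in>Obj C.
        is_iso C (assoc C a b c) \<and>
        assoc C a b c \<in> hom C (a \<otimes>\<^bsub>C\<^esub> (b \<otimes>\<^bsub>C\<^esub> c)) ((a \<otimes>\<^bsub>C\<^esub> b) \<otimes>\<^bsub>C\<^esub> c)) \<and>
     (\<forall>a\<in>Obj C. is_iso C (lunit C a) \<and> lunit C a \<in> hom C (munit C \<otimes>\<^bsub>C\<^esub> a) a) \<and>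
     (\<forall>a\<in>Obj C. is_iso C (runit C a) \<and> runit C a \<in> hom C (a \<otimes>\<^bsub>C\<^esub> munit C) a) \<and>
     (\<forall>a\<in>Obj C. \<forall>b\<in>Obj C. braid C a b \<in> hom C (a \<otimes>\<^bsub>C\<^esub> b) (b \<otimes>\<^bsub>C\<^esub> a)) \<and>
     (\<forall>f\<in>Arr C. \<forall>g\<in>Arr C. \<forall>h\<in>Arr C.
        assoc C (Cod C f) (Cod C g) (Cod C h) \<cdot>\<^bsub>C\<^esub> (f \<otimes>\<^sup>m\<^bsub>C\<^esub> (g \<otimes>\<^sup>m\<^bsub>C\<^esub> h))
        = ((f \<otimes>\<^sup>m\<^bsub>C\<^esub> g) \<otimes>\<^sup>m\<^bsub>C\<^esub> h) \<cdot>\<^bsub>C\<^esub> assoc C (Dom C f) (Dom C g) (Dom C h)) \<and>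
     (\<forall>f\<in>Arr C. lunit C (Cod C f) \<cdot>\<^bsub>C\<^esub> (Ident C (munit C) \<otimes>\<^sup>m\<^bsub>C\<^esub> f) = f \<cdot>\<^bsub>C\<^esub> lunit C (Dom C f)) \<and>
     (\<forall>f\<in>Arr C. runit C (Cod C f) \<cdot>\<^bsub>C\<^esub> (f \<otimes>\<^sup>m\<^bsub>C\<^esub> Ident C (munit C)) = f \<cdot>\<^bsub>C\<^esub> runit C (Dom C f)) \<and>
     (\<forall>f\<in>Arr C. \<forall>g\<in>Arr C.
        braid C (Cod C f) (Cod C g) \<cdot>\<^bsub>C\<^esub> (f \<otimes>\<^sup>m\<^bsub>C\<^esub> g) = (g \<otimes>\<^sup>m\<^bsub>C\<^esub> f) \<cdot>\<^bsub>C\<^esub> braid C (Dom C f) (Dom C g)) \<and>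
     (\<forall>a\<in>Obj C. \<forall>b\<in>Obj C. \<forall>c\<in>Obj C. \<forall>d\<in>Obj C.
        assoc C (a \<otimes>\<^bsub>C\<^esub> b) c d \<cdot>\<^bsub>C\<^esub> assoc C a b (c \<otimes>\<^bsub>C\<^esub> d)
        = (assoc C a b c \<otimes>\<^sup>m\<^bsub>C\<^esub> Ident C d) \<cdot>\<^bsub>C\<^esub> assoc C a (b \<otimes>\<^bsub>C\<^esub> c) d
            \<cdot>\<^bsub>C\<^esub> (Ident C a \<otimes>\<^sup>m\<^bsub>C\<^esub> assoc C b c d)) \<and>
     (\<forall>a\<in>Obj C. \<forall>b\<in>Obj C.
        (runit C a \<otimes>\<^sup>m\<^bsub>C\<^esub> Ident C b) \<cdot>\<^bsub>C\<^esub> assoc C a (munit C) b = Ident C a \<otimes>\<^sup>m\<^bsub>C\<^esub> lunit C b) \<and>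
     (\<forall>a\<in>Obj C. \<forall>b\<in>Obj C. braid C b a \<cdot>\<^bsub>C\<^esub> braid C a b = Ident C (a \<otimes>\<^bsub>C\<^esub> b)) \<and>
     (\<forall>a\<in>Obj C. \<forall>b\<in>Obj C. \<forall>c\<in>Obj C.
        assoc C c a b \<cdot>\<^bsub>C\<^esub> braid C (a \<otimes>\<^bsub>C\<^esub> b) c \<cdot>\<^bsub>C\<^esub> assoc C a b c
        = (braid C a c \<otimes>\<^sup>m\<^bsub>C\<^esub> Ident C b) \<cdot>\<^bsub>C\<^esub> assoc C a c b \<cdot>\<^bsub>C\<^esub> (Ident C a \<otimes>\<^sup>m\<^bsub>C\<^esub> braid C b c))"

definition closed_symmetric_monoidal :: "('o, 'm) smc \<Rightarrow> bool" where
  "closed_symmetric_monoidal C \<longleftrightarrow> symmetric_monoidal C \<and>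
     (\<forall>a\<in>Obj C. \<exists>R. left_adjoint C C \<lparr>FO = (\<lambda>b. a \<otimes>\<^bsub>C\<^esub> b), FM = (\<lambda>f. Ident C a \<otimes>\<^sup>m\<^bsub>C\<^esub> f)\<rparr> R)"

record ('o, 'm, 'n, 'k) actegory = "('n, 'k) cat" +
  action :: "('o \<times> 'n, 'm \<times> 'k, 'n, 'k) fctr"
  aassoc :: "'o \<Rightarrow> 'o \<Rightarrow> 'n \<Rightarrow> 'k"
  aunit :: "'n \<Rightarrow> 'k"

abbreviation actO :: "('o, 'm, 'n, 'k, 'z) actegory_scheme \<Rightarrow> 'o \<Rightarrow> 'n \<Rightarrow> 'n"  (infixr "\<odot>\<index>" 75)
  where "a \<odot>\<^bsub>M\<^esub> m \<equiv> FO (action M) (a, m)"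

abbreviation actM :: "('o, 'm, 'n, 'k, 'z) actegory_scheme \<Rightarrow> 'm \<Rightarrow> 'k \<Rightarrow> 'k"  (infixr "\<odot>\<^sup>m\<index>" 75)
  where "f \<odot>\<^sup>m\<^bsub>M\<^esub> g \<equiv> FM (action M) (f, g)"

definition left_actegory :: "('o, 'm) smc \<Rightarrow> ('o, 'm, 'n, 'k) actegory \<Rightarrow> bool" where
  "left_actegory C M \<longleftrightarrow>
     category M \<and> is_functor (prod_cat C M) M (action M) \<and>
     (\<forall>a\<in>Obj C. \<forall>b\<in>Obj C. \<forall>m\<in>Obj M.
        is_iso M (aassoc M a b m) \<and>
        aassoc M a b m \<in> hom M (a \<odot>\<^bsub>M\<^esub> (b \<odot>\<^bsub>M\<^esub> m)) ((a \<otimes>\<^bsub>C\<^esub> b) \<odot>\<^bsub>M\<^esub> m)) \<and>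
     (\<forall>m\<in>Obj M. is_iso M (aunit M m) \<and> aunit M m \<in> hom M (munit C \<odot>\<^bsub>M\<^esub> m) m) \<and>
     (\<forall>f\<in>Arr C. \<forall>g\<in>Arr C. \<forall>h\<in>Arr M.
        aassoc M (Cod C f) (Cod C g) (Cod M h) \<cdot>\<^bsub>M\<^esub> (f \<odot>\<^sup>m\<^bsub>M\<^esub> (g \<odot>\<^sup>m\<^bsub>M\<^esub> h))
        = ((f \<otimes>\<^sup>m\<^bsub>C\<^esub> g) \<odot>\<^sup>m\<^bsub>M\<^esub> h) \<cdot>\<^bsub>M\<^esub> aassoc M (Dom C f) (Dom C g) (Dom M h)) \<and>
     (\<forall>f\<in>Arr M. aunit M (Cod M f) \<cdot>\<^bsub>M\<^esub> (Ident C (munit C) \<odot>\<^sup>m\<^bsub>M\<^esub> f) = f \<cdot>\<^bsub>M\<^esub> aunit M (Dom M f)) \<and>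
     (\<forall>a\<in>Obj C. \<forall>b\<in>Obj C. \<forall>c\<in>Obj C. \<forall>m\<in>Obj M.
        aassoc M (a \<otimes>\<^bsub>C\<^esub> b) c m \<cdot>\<^bsub>M\<^esub> aassoc M a b (c \<odot>\<^bsub>M\<^esub> m)
        = (assoc C a b c \<odot>\<^sup>m\<^bsub>M\<^esub> Ident M m) \<cdot>\<^bsub>M\<^esub> aassoc M a (b \<otimes>\<^bsub>C\<^esub> c) m
            \<cdot>\<^bsub>M\<^esub> (Ident C a \<odot>\<^sup>m\<^bsub>M\<^esub> aassoc M b c m)) \<and>
     (\<forall>a\<in>Obj C. \<forall>m\<in>Obj M.
        (runit C a \<odot>\<^sup>m\<^bsub>M\<^esub> Ident M m) \<cdot>\<^bsub>M\<^esub> aassoc M a (munit C) m = Ident C a \<odot>\<^sup>m\<^bsub>M\<^esub> aunit M m) \<and>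
     (\<forall>a\<in>Obj C. \<forall>m\<in>Obj M.
        (lunit C a \<odot>\<^sup>m\<^bsub>M\<^esub> Ident M m) \<cdot>\<^bsub>M\<^esub> aassoc M (munit C) a m = aunit M (a \<odot>\<^bsub>M\<^esub> m))"

definition act_by :: "('o, 'm) smc \<Rightarrow> ('o, 'm, 'n, 'k) actegory \<Rightarrow> 'o \<Rightarrow> ('n, 'k, 'n, 'k) fctr" where
  "act_by C M a = \<lparr>FO = (\<lambda>m. a \<odot>\<^bsub>M\<^esub> m), FM = (\<lambda>f. Ident C a \<odot>\<^sup>m\<^bsub>M\<^esub> f)\<rparr>"

definition act_on :: "('o, 'm, 'n, 'k) actegory \<Rightarrow> 'n \<Rightarrow> ('o, 'm, 'n, 'k) fctr" where
  "act_on M m = \<lparr>FO = (\<lambda>a. a \<odot>\<^bsub>M\<^esub> m), FM = (\<lambda>f. f \<odot>\<^sup>m\<^bsub>M\<^esub> Ident M m)\<rparr>"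


section \<open>Commutative monoids and modules\<close>

type_synonym ('o, 'm) mon = "'o \<times> 'm \<times> 'm"
type_synonym ('o, 'm) mon_arr = "('o, 'm) mon \<times> 'm \<times> ('o, 'm) mon"

definition is_comm_monoid :: "('o, 'm) smc \<Rightarrow> ('o, 'm) mon \<Rightarrow> bool" where
  "is_comm_monoid C = (\<lambda>(a, \<mu>, \<iota>). a \<in> Obj C \<and> \<mu> \<in> hom C (a \<otimes>\<^bsub>C\<^esub> a) a \<and> \<iota> \<in> hom C (munit C) a \<and>
     \<mu> \<cdot>\<^bsub>C\<^esub> (\<mu> \<otimes>\<^sup>m\<^bsub>C\<^esub> Ident C a) \<cdot>\<^bsub>C\<^esub> assoc C a a a = \<mu> \<cdot>\<^bsub>C\<^esub> (Ident C a \<otimes>\<^sup>m\<^bsub>C\<^esub> \<mu>) \<and>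
     \<mu> \<cdot>\<^bsub>C\<^esub> (\<iota> \<otimes>\<^sup>m\<^bsub>C\<^esub> Ident C a) = lunit C a \<and>
     \<mu> \<cdot>\<^bsub>C\<^esub> (Ident C a \<otimes>\<^sup>m\<^bsub>C\<^esub> \<iota>) = runit C a \<and>
     \<mu> \<cdot>\<^bsub>C\<^esub> braid C a a = \<mu>)"

definition Comm :: "('o, 'm) smc \<Rightarrow> (('o, 'm) mon, ('o, 'm) mon_arr) cat" where
  "Comm C = structured_cat C {A. is_comm_monoid C A} fst
     (\<lambda>(a, \<mu>, \<iota>) f (b, \<mu>', \<iota>'). f \<cdot>\<^bsub>C\<^esub> \<mu> = \<mu>' \<cdot>\<^bsub>C\<^esub> (f \<otimes>\<^sup>m\<^bsub>C\<^esub> f) \<and> f \<cdot>\<^bsub>C\<^esub> \<iota> = \<iota>')"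

definition is_module ::
  "('o, 'm) smc \<Rightarrow> ('o, 'm, 'n, 'k) actegory \<Rightarrow> ('o, 'm) mon \<Rightarrow> 'n \<times> 'k \<Rightarrow> bool" where
  "is_module C M = (\<lambda>(a, \<mu>, \<iota>) (m, \<rho>). m \<in> Obj M \<and> \<rho> \<in> hom M (a \<odot>\<^bsub>M\<^esub> m) m \<and>
     \<rho> \<cdot>\<^bsub>M\<^esub> (\<mu> \<odot>\<^sup>m\<^bsub>M\<^esub> Ident M m) \<cdot>\<^bsub>M\<^esub> aassoc M a a m = \<rho> \<cdot>\<^bsub>M\<^esub> (Ident C a \<odot>\<^sup>m\<^bsub>M\<^esub> \<rho>) \<and>
     \<rho> \<cdot>\<^bsub>M\<^esub> (\<iota> \<odot>\<^sup>m\<^bsub>M\<^esub> Ident M m) = aunit M m)"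

definition Mod ::
  "('o, 'm) smc \<Rightarrow> ('o, 'm, 'n, 'k) actegory \<Rightarrow> ('o, 'm) mon \<Rightarrow>
   ('n \<times> 'k, ('n \<times> 'k) \<times> 'k \<times> ('n \<times> 'k)) cat" where
  "Mod C M A = structured_cat M {x. is_module C M A x} fst
     (\<lambda>(m, \<rho>) f (n, \<tau>). f \<cdot>\<^bsub>M\<^esub> \<rho> = \<tau> \<cdot>\<^bsub>M\<^esub> (Ident C (fst A) \<odot>\<^sup>m\<^bsub>M\<^esub> f))"

definition restriction ::
  "('o, 'm, 'n, 'k) actegory \<Rightarrow> ('o, 'm) mon_arr \<Rightarrow>
   ('n \<times> 'k, ('n \<times> 'k) \<times> 'k \<times> ('n \<times> 'k), 'n \<times> 'k, ('n \<times> 'k) \<times> 'k \<times> ('n \<times> 'k)) fctr" where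
  "restriction M \<alpha> =
     (let R = (\<lambda>(n, \<tau>). (n, \<tau> \<cdot>\<^bsub>M\<^esub> (und \<alpha> \<odot>\<^sup>m\<^bsub>M\<^esub> Ident M n)))
      in \<lparr>FO = R, FM = (\<lambda>(x, f, y). (R x, f, R y))\<rparr>)"

text \<open>
  Extension of scalars is determined only up to isomorphism; flatness and conservativity do not
  depend on the choice of the left adjoint.
\<close>

definition is_extension ::
  "('o, 'm) smc \<Rightarrow> ('o, 'm, 'n, 'k) actegory \<Rightarrow> ('o, 'm) mon_arr \<Rightarrow>
   ('n \<times> 'k, ('n \<times> 'k) \<times> 'k \<times> ('n \<times> 'k), 'n \<times> 'k, ('n \<times> 'k) \<times> 'k \<times> ('n \<times> 'k)) fctr \<Rightarrow> bool" where
  "is_extension C M \<alpha> L \<longleftrightarrow>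
     left_adjoint (Mod C M (Dom (Comm C) \<alpha>)) (Mod C M (Cod (Comm C) \<alpha>)) L (restriction M \<alpha>)"

definition flat :: "('o, 'm) smc \<Rightarrow> ('o, 'm, 'n, 'k) actegory \<Rightarrow> ('o, 'm) mon_arr \<Rightarrow> bool" where
  "flat C M \<alpha> \<longleftrightarrow> \<alpha> \<in> Arr (Comm C) \<and>
     (\<exists>L. is_extension C M \<alpha> L \<and>
          preserves_finite_limits (Mod C M (Dom (Comm C) \<alpha>)) (Mod C M (Cod (Comm C) \<alpha>)) L)"

definition coslice :: "('o, 'm, 'z) cat_scheme \<Rightarrow> 'o \<Rightarrow> ('m, 'm \<times> 'm \<times> 'm) cat" where
  "coslice A a = structured_cat A {f \<in> Arr A. Dom A f = a} (Cod A) (\<lambda>f h g. Comp A h f = g)"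

definition finite_type :: "'s itself \<Rightarrow> ('o, 'm) smc \<Rightarrow> ('o, 'm) mon_arr \<Rightarrow> bool" where
  "finite_type S C \<alpha> \<longleftrightarrow> \<alpha> \<in> Arr (Comm C) \<and>
     (let K = coslice (Comm C) (Dom (Comm C) \<alpha>) in
      \<forall>J :: ('s, 's) cat. \<forall>D x \<iota>.
        small_shape J \<and> filtered J \<and> is_functor J K D \<and> is_colimit K J D x \<iota> \<longrightarrow>
        bij_betw (colimit_comparison K \<iota>) (set_colimit J (fcomp (corep K \<alpha>) D)) (hom K \<alpha> x))"


section \<open>Grothendieck topologies and sheaves\<close>

definition sieve :: "('o, 'm, 'z) cat_scheme \<Rightarrow> 'o \<Rightarrow> 'm set \<Rightarrow> bool" where
  "sieve A x S \<longleftrightarrow> S \<subseteq> {f \<in> Arr A. Cod A f = x} \<and>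
     (\<forall>f\<in>S. \<forall>g\<in>Arr A. Cod A g = Dom A f \<longrightarrow> Comp A f g \<in> S)"

definition pullback_sieve :: "('o, 'm, 'z) cat_scheme \<Rightarrow> 'm \<Rightarrow> 'm set \<Rightarrow> 'm set" where
  "pullback_sieve A h S = {g \<in> Arr A. Cod A g = Dom A h \<and> Comp A h g \<in> S}"

definition generated_sieve :: "('o, 'm, 'z) cat_scheme \<Rightarrow> 'm set \<Rightarrow> 'm set" where
  "generated_sieve A \<Phi> = {Comp A f g | f g. f \<in> \<Phi> \<and> g \<in> Arr A \<and> Cod A g = Dom A f}"

definition grothendieck_topology :: "('o, 'm, 'z) cat_scheme \<Rightarrow> ('o \<Rightarrow> 'm set set) \<Rightarrow> bool" where
  "grothendieck_topology A T \<longleftrightarrow>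
     (\<forall>x\<in>Obj A. \<forall>S\<in>T x. sieve A x S) \<and>
     (\<forall>x\<in>Obj A. {f \<in> Arr A. Cod A f = x} \<in> T x) \<and>
     (\<forall>h\<in>Arr A. \<forall>S \<in> T (Cod A h). pullback_sieve A h S \<in> T (Dom A h)) \<and>
     (\<forall>x\<in>Obj A. \<forall>S\<in>T x. \<forall>R. sieve A x R \<and> (\<forall>h\<in>S. pullback_sieve A h R \<in> T (Dom A h)) \<longrightarrow> R \<in> T x)"

text \<open>
  The smallest Grothendieck topology for which every family in \<open>cov x\<close> covers \<open>x\<close>.  If the families
  form a basis, its covering sieves are exactly those that contain a family of the basis.
\<close>

definition generated_topology ::
  "('o, 'm, 'z) cat_scheme \<Rightarrow> ('o \<Rightarrow> 'm set \<Rightarrow> bool) \<Rightarrow> 'o \<Rightarrow> 'm set set" where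
  "generated_topology A cov x =
     {S. sieve A x S \<and>
         (\<forall>T. grothendieck_topology A T \<and> (\<forall>y\<in>Obj A. \<forall>\<Phi>. cov y \<Phi> \<longrightarrow> generated_sieve A \<Phi> \<in> T y)
              \<longrightarrow> S \<in> T x)}"

type_synonym ('o, 'm, 'u) presheaf = "('o, 'm, 'u set, 'u set \<times> ('u \<Rightarrow> 'u) \<times> 'u set) fctr"
type_synonym ('o, 'm, 'u) presheaf_arr =
  "('o, 'm, 'u) presheaf \<times> ('o \<Rightarrow> 'u set \<times> ('u \<Rightarrow> 'u) \<times> 'u set) \<times> ('o, 'm, 'u) presheaf"

definition is_sheaf ::
  "('o, 'm, 'z) cat_scheme \<Rightarrow> ('o \<Rightarrow> 'm set set) \<Rightarrow> ('o, 'm, 'u) presheaf \<Rightarrow> bool" where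
  "is_sheaf A T F \<longleftrightarrow> is_functor (op_cat A) SET F \<and>
     (\<forall>x\<in>Obj A. \<forall>S\<in>T x. \<forall>s.
        (\<forall>f\<in>S. s f \<in> FO F (Dom A f)) \<and>
        (\<forall>f\<in>S. \<forall>g\<in>Arr A. Cod A g = Dom A f \<longrightarrow> und (FM F g) (s f) = s (Comp A f g))
        \<longrightarrow> (\<exists>!t. t \<in> FO F x \<and> (\<forall>f\<in>S. und (FM F f) t = s f)))"

definition natural_trans ::
  "('o, 'm, 'z) cat_scheme \<Rightarrow> ('p, 'n, 'y) cat_scheme \<Rightarrow> ('o, 'm, 'p, 'n) fctr \<Rightarrow> ('o \<Rightarrow> 'n) \<Rightarrow>
   ('o, 'm, 'p, 'n) fctr \<Rightarrow> bool" where
  "natural_trans A B F \<eta> G \<longleftrightarrow> \<eta> \<in> extensional (Obj A) \<and>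
     (\<forall>x\<in>Obj A. \<eta> x \<in> hom B (FO F x) (FO G x)) \<and>
     (\<forall>f\<in>Arr A. Comp B (FM G f) (\<eta> (Dom A f)) = Comp B (\<eta> (Cod A f)) (FM F f))"

definition functor_cat ::
  "('o, 'm, 'z) cat_scheme \<Rightarrow> ('p, 'n, 'y) cat_scheme \<Rightarrow>
   (('o, 'm, 'p, 'n) fctr, ('o, 'm, 'p, 'n) fctr \<times> ('o \<Rightarrow> 'n) \<times> ('o, 'm, 'p, 'n) fctr) cat" where
  "functor_cat A B = \<lparr>Obj = {F. is_functor A B F},
     Arr = {(F, \<eta>, G). is_functor A B F \<and> is_functor A B G \<and> natural_trans A B F \<eta> G},
     Dom = fst, Cod = (\<lambda>\<eta>. snd (snd \<eta>)),
     Ident = (\<lambda>F. (F, \<lambda>x\<in>Obj A. Ident B (FO F x), F)),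
     Comp = (\<lambda>\<theta> \<eta>. (fst \<eta>, \<lambda>x\<in>Obj A. Comp B (und \<theta> x) (und \<eta> x), snd (snd \<theta>)))\<rparr>"

definition sheaf_cat ::
  "('o, 'm, 'z) cat_scheme \<Rightarrow> ('o \<Rightarrow> 'm set set) \<Rightarrow> (('o, 'm, 'u) presheaf, ('o, 'm, 'u) presheaf_arr) cat" where
  "sheaf_cat A T = full_subcat (functor_cat (op_cat A) SET) {F. is_sheaf A T F}"

text \<open>
  The sets in which presheaves take their values are the subsets of a type \<open>'u\<close>, so the values of
  representable presheaves have to be encoded in \<open>'u\<close>.  Whenever \<open>Arr A \<lesssim> (UNIV :: 'u set)\<close>, the
  encoding is injective, and its choice affects representables only up to isomorphism.
\<close>

definition encode :: "('o, 'm, 'z) cat_scheme \<Rightarrow> 'm \<Rightarrow> 'u" where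
  "encode A = (SOME e. inj_on e (Arr A))"

definition decode :: "('o, 'm, 'z) cat_scheme \<Rightarrow> 'u \<Rightarrow> 'm" where
  "decode A = inv_into (Arr A) (encode A)"

definition representable :: "('o, 'm, 'z) cat_scheme \<Rightarrow> 'o \<Rightarrow> ('o, 'm, 'u) presheaf" where
  "representable A x = \<lparr>FO = (\<lambda>z. encode A ` hom A z x),
     FM = (\<lambda>f. (encode A ` hom A (Cod A f) x,
                (\<lambda>s \<in> encode A ` hom A (Cod A f) x. encode A (Comp A (decode A s) f)),
                encode A ` hom A (Dom A f) x))\<rparr>"

definition representable_map :: "('o, 'm, 'z) cat_scheme \<Rightarrow> 'm \<Rightarrow> ('o, 'm, 'u) presheaf_arr" where
  "representable_map A f =
     (representable A (Dom A f),
      (\<lambda>z\<in>Obj A. (encode A ` hom A z (Dom A f),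
                   (\<lambda>s \<in> encode A ` hom A z (Dom A f). encode A (Comp A f (decode A s))),
                   encode A ` hom A z (Cod A f))),
      representable A (Cod A f))"

definition inclusion ::
  "('o, 'm, 'z) cat_scheme \<Rightarrow> ('o, 'm, 'u) presheaf \<Rightarrow> ('o, 'm, 'u) presheaf \<Rightarrow> ('o, 'm, 'u) presheaf_arr" where
  "inclusion A F X = (F, (\<lambda>z\<in>Obj A. (FO F z, restrict id (FO F z), FO X z)), X)"


section \<open>Relative schemes: spectral topology and Zariski open immersions\<close>

definition Aff :: "('o, 'm) smc \<Rightarrow> (('o, 'm) mon, ('o, 'm) mon_arr) cat" where
  "Aff C = op_cat (Comm C)"

text \<open>
  Families of arrows of \<open>Aff C\<close> with a common codomain are sets of arrows, indexed by themselves.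
  An arrow \<open>\<alpha> : a \<rightarrow> b\<close> of \<open>Comm C\<close> is literally the arrow \<open>Spec b \<rightarrow> Spec a\<close> of \<open>Aff C\<close>.
\<close>

definition fpqc_cover ::
  "('o, 'm) smc \<Rightarrow> ('o, 'm, 'n, 'k) actegory \<Rightarrow> ('o, 'm) mon \<Rightarrow> ('o, 'm) mon_arr set \<Rightarrow> bool" where
  "fpqc_cover C M a \<Phi> \<longleftrightarrow> a \<in> Obj (Aff C) \<and> \<Phi> \<subseteq> {\<alpha> \<in> Arr (Aff C). Cod (Aff C) \<alpha> = a} \<and>
     (\<forall>\<alpha>\<in>\<Phi>. flat C M \<alpha>) \<and>
     (\<exists>\<Psi> \<subseteq> \<Phi>. finite \<Psi> \<and>
        (\<exists>L. (\<forall>\<alpha>\<in>\<Psi>. is_extension C M \<alpha> (L \<alpha>)) \<and>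
             (\<forall>f \<in> Arr (Mod C M a).
                (\<forall>\<alpha>\<in>\<Psi>. is_iso (Mod C M (Dom (Aff C) \<alpha>)) (FM (L \<alpha>) f)) \<longrightarrow> is_iso (Mod C M a) f)))"

definition spectral_immersion ::
  "'s itself \<Rightarrow> ('o, 'm) smc \<Rightarrow> ('o, 'm, 'n, 'k) actegory \<Rightarrow> ('o, 'm) mon_arr \<Rightarrow> bool" where
  "spectral_immersion S C M \<alpha> \<longleftrightarrow> flat C M \<alpha> \<and> is_epi (Comm C) \<alpha> \<and> finite_type S C \<alpha>"

definition spectral_cover ::
  "'s itself \<Rightarrow> ('o, 'm) smc \<Rightarrow> ('o, 'm, 'n, 'k) actegory \<Rightarrow> ('o, 'm) mon \<Rightarrow> ('o, 'm) mon_arr set \<Rightarrow> bool" where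
  "spectral_cover S C M a \<Phi> \<longleftrightarrow> fpqc_cover C M a \<Phi> \<and> (\<forall>\<alpha>\<in>\<Phi>. spectral_immersion S C M \<alpha>)"

definition fpqc_topology ::
  "('o, 'm) smc \<Rightarrow> ('o, 'm, 'n, 'k) actegory \<Rightarrow> ('o, 'm) mon \<Rightarrow> ('o, 'm) mon_arr set set" where
  "fpqc_topology C M = generated_topology (Aff C) (fpqc_cover C M)"

definition spectral_topology ::
  "'s itself \<Rightarrow> ('o, 'm) smc \<Rightarrow> ('o, 'm, 'n, 'k) actegory \<Rightarrow> ('o, 'm) mon \<Rightarrow> ('o, 'm) mon_arr set set" where
  "spectral_topology S C M = generated_topology (Aff C) (spectral_cover S C M)"

definition subcanonical :: "'u itself \<Rightarrow> ('o, 'm) smc \<Rightarrow> ('o, 'm, 'n, 'k) actegory \<Rightarrow> bool" where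
  "subcanonical U C M \<longleftrightarrow>
     (\<forall>a \<in> Obj (Aff C).
        is_sheaf (Aff C) (fpqc_topology C M) (representable (Aff C) a :: (('o, 'm) mon, ('o, 'm) mon_arr, 'u) presheaf))"

type_synonym ('o, 'm, 'u) aff_sheaf = "(('o, 'm) mon, ('o, 'm) mon_arr, 'u) presheaf"
type_synonym ('o, 'm, 'u) aff_sheaf_arr = "(('o, 'm) mon, ('o, 'm) mon_arr, 'u) presheaf_arr"

text \<open>
  \<open>Aff C\<close> need not be small relative to the universe \<open>'s\<close>, so sheaves take values in a possibly larger
  universe of sets \<open>'u\<close>.  If \<open>'u\<close> is infinite and \<open>Pow (Arr (Aff C)) \<lesssim> (UNIV :: 'u set)\<close>, then the
  coproducts of representables used below exist in \<open>Sh\<close>.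
\<close>

definition Sh ::
  "'s itself \<Rightarrow> ('o, 'm) smc \<Rightarrow> ('o, 'm, 'n, 'k) actegory \<Rightarrow>
   (('o, 'm, 'u) aff_sheaf, ('o, 'm, 'u) aff_sheaf_arr) cat" where
  "Sh S C M = sheaf_cat (Aff C) (spectral_topology S C M)"

definition zariski_open ::
  "'s itself \<Rightarrow> ('o, 'm) smc \<Rightarrow> ('o, 'm, 'n, 'k) actegory \<Rightarrow> ('o, 'm) mon \<Rightarrow> ('o, 'm, 'u) aff_sheaf \<Rightarrow> bool" where
  "zariski_open S C M a F \<longleftrightarrow>
     (let X = representable (Aff C) a in
      inclusion (Aff C) F X \<in> hom (Sh S C M) F X \<and>
      (\<exists>\<Phi> \<subseteq> {\<alpha> \<in> Arr (Aff C). Cod (Aff C) \<alpha> = a}.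
         (\<forall>\<alpha>\<in>\<Phi>. spectral_immersion S C M \<alpha>) \<and>
         (\<exists>Q j u. is_coproduct (Sh S C M) \<Phi> (\<lambda>\<alpha>. representable (Aff C) (Dom (Aff C) \<alpha>)) Q j \<and>
            u \<in> hom (Sh S C M) Q X \<and>
            (\<forall>\<alpha>\<in>\<Phi>. u \<cdot>\<^bsub>Sh S C M\<^esub> j \<alpha> = representable_map (Aff C) \<alpha>) \<and>
            is_image (Sh S C M) u (inclusion (Aff C) F X))))"

definition zariski_open_immersion ::
  "'s itself \<Rightarrow> ('o, 'm) smc \<Rightarrow> ('o, 'm, 'n, 'k) actegory \<Rightarrow> ('o, 'm, 'u) aff_sheaf_arr \<Rightarrow> bool" where
  "zariski_open_immersion S C M f \<longleftrightarrow> f \<in> Arr (Sh S C M) \<and>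
     (\<forall>a \<in> Obj (Aff C). \<forall>g \<in> hom (Sh S C M) (representable (Aff C) a) (Cod (Sh S C M) f).
        \<forall>p q. is_pullback (Sh S C M) f g p q \<longrightarrow>
          is_mono (Sh S C M) q \<and>
          (\<exists>F. is_image (Sh S C M) q (inclusion (Aff C) F (representable (Aff C) a)) \<and>
               zariski_open S C M a F))"

end

theory Submission
  imports Defs
begin

text \<open>
  A sheaf map \<open>f : F \<rightarrow> G\<close> is a Zariski open immersion if and only if it is injective on sections and,
  for every section \<open>r\<close> of \<open>G\<close> over an affine \<open>a\<close>, the sieve of the arrows \<open>s\<close> into \<open>a\<close> for which the
  restriction of \<open>r\<close> along \<open>s\<close> lies in the image of \<open>f\<close> is open: there is a set \<open>\<Phi>\<close> of spectral
  immersions into \<open>a\<close> such that the sieve consists of the arrows that factor locally through members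
  of \<open>\<Phi>\<close> (\<open>open_immersion_iff\<close>).  Both halves of the theorem are short once this is known.

  Stability under base change: for a pullback \<open>q\<close> of \<open>f\<close> along \<open>g\<close>, the sieve that belongs to \<open>q\<close> and
  a section \<open>r\<close> is the sieve that belongs to \<open>f\<close> and the section \<open>g r\<close>.

  Composition of \<open>f : F \<rightarrow> G\<close> and \<open>g : G \<rightarrow> H\<close>: let \<open>\<Phi>\<close> generate the sieve of a section \<open>r\<close> of \<open>H\<close>.
  Each \<open>\<alpha> \<in> \<Phi>\<close> lies in this sieve, so the restriction of \<open>r\<close> along \<open>\<alpha>\<close> is the image of a unique section
  \<open>t \<alpha>\<close> of \<open>G\<close>, whose sieve for \<open>f\<close> is generated by some \<open>\<Psi> \<alpha>\<close>.  The composites \<open>\<alpha> \<cdot> \<beta>\<close> with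
  \<open>\<beta> \<in> \<Psi> \<alpha>\<close> generate the sieve of \<open>r\<close> for \<open>g \<cdot> f\<close>, because local factorizations can be composed.

  The characterization rests on three facts about sheaves on a subcanonical site.  Sections are arrows
  out of representables, so monomorphisms are the maps that are injective on sections and pullbacks
  are computed on sections.  Pullbacks exist, which is what makes the definition of an open immersion
  informative.  Coproducts of representables exist; they are constructed by sheafification, and the
  image of a map out of such a coproduct is the subsheaf of the sections that factor locally through
  one of its components (\<open>open_subsheaf_iff\<close>).

  Finally spectral immersions compose (\<open>spectral_immersion_Comp\<close>).  Adjunctions, functors that
  preserve finite limits, and epimorphisms compose.  For the finiteness condition, let \<open>\<alpha> : a \<rightarrow> b\<close> and
  \<open>\<beta> : b \<rightarrow> c\<close> be epimorphisms.  Factorizations through an epimorphism are unique, so \<open>\<alpha>\<close> is of finite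
  type precisely when every filtered diagram under \<open>a\<close> whose colimit receives a map from \<open>b\<close> has a
  member that receives one.  If the colimit receives a map from \<open>c\<close>, then from some index onwards the diagram
  lies under \<open>b\<close>, where finite type of \<open>\<beta>\<close> applies to it.
\<close>

section \<open>Categories\<close>

lemma op_cat_simps [simp]:
  "Obj (op_cat B) = Obj B" "Arr (op_cat B) = Arr B" "Dom (op_cat B) = Cod B"
  "Cod (op_cat B) = Dom B" "Ident (op_cat B) = Ident B" "Comp (op_cat B) g f = Comp B f g"
  by (simp_all add: op_cat_def)

context category
begin

lemma Comp_Arr [simp]:
  assumes "f \<in> Arr A" "g \<in> Arr A" "Cod A f = Dom A g"
  shows "g \<cdot> f \<in> Arr A" "Dom A (g \<cdot> f) = Dom A f" "Cod A (g \<cdot> f) = Cod A g"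
  using Comp_hom[of f "Dom A f" "Dom A g" g "Cod A g"] assms by (auto simp: hom_def)

lemma Ident_Arr [simp]:
  assumes "x \<in> Obj A"
  shows "Ident A x \<in> Arr A" "Dom A (Ident A x) = x" "Cod A (Ident A x) = x"
  using Ident_hom[OF assms] by (auto simp: hom_def)

lemma Ident_Comp [simp]: "f \<in> Arr A \<Longrightarrow> Cod A f = x \<Longrightarrow> Ident A x \<cdot> f = f"
  by (rule Ident_left) (auto simp: hom_def)

lemma Comp_Ident [simp]: "f \<in> Arr A \<Longrightarrow> Dom A f = x \<Longrightarrow> f \<cdot> Ident A x = f"
  by (rule Ident_right) (auto simp: hom_def)

lemma Comp_Comp [simp]:
  assumes "f \<in> Arr A" "g \<in> Arr A" "h \<in> Arr A" "Cod A f = Dom A g" "Cod A g = Dom A h"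
  shows "(h \<cdot> g) \<cdot> f = h \<cdot> (g \<cdot> f)"
  using Comp_assoc[of f "Dom A f" "Cod A f" g "Cod A g" h "Cod A h"] assms
  by (simp add: hom_def)

lemma Dom_Cod_Obj [simp]: "f \<in> Arr A \<Longrightarrow> Dom A f \<in> Obj A" "f \<in> Arr A \<Longrightarrow> Cod A f \<in> Obj A"
  using Dom_Obj Cod_Obj by auto

end


section \<open>Categories of structured objects\<close>

lemma hom_op_cat [simp]: "hom (op_cat A) x y = hom A y x"
  by (auto simp: hom_def)

lemma category_op_cat:
  assumes "category A"
  shows "category (op_cat A)"
proof -
  interpret category A by fact
  show ?thesis
    by unfold_locales (auto simp: hom_def)
qed

lemma structured_cat_simps [simp]:
  "Obj (structured_cat A S U P) = S"
  "Dom (structured_cat A S U P) t = fst t" "Cod (structured_cat A S U P) t = snd (snd t)"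
  "Ident (structured_cat A S U P) x = (x, Ident A (U x), x)"
  "Comp (structured_cat A S U P) t s = (fst s, Comp A (und t) (und s), snd (snd t))"
  by (simp_all add: structured_cat_def)

lemma Arr_structured_cat:
  "t \<in> Arr (structured_cat A S U P) \<longleftrightarrow> fst t \<in> S \<and> snd (snd t) \<in> S \<and>
     und t \<in> hom A (U (fst t)) (U (snd (snd t))) \<and> P (fst t) (und t) (snd (snd t))"
  by (cases t) (auto simp: structured_cat_def und_def)

lemma hom_structured_cat:
  "t \<in> hom (structured_cat A S U P) x y \<longleftrightarrow> t = (x, und t, y) \<and> x \<in> S \<and> y \<in> S \<and>
     und t \<in> hom A (U x) (U y) \<and> P x (und t) y"
  by (cases t) (auto simp: structured_cat_def und_def hom_def)

lemma und_triple [simp]: "und (a, b, c) = b"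
  by (simp add: und_def)

lemma triple_eqI: "fst t = fst s \<Longrightarrow> und t = und s \<Longrightarrow> snd (snd t) = snd (snd s) \<Longrightarrow> t = s"
  by (cases t; cases s) simp

lemma category_structured_cat:
  assumes "category A" and U: "\<And>x. x \<in> S \<Longrightarrow> U x \<in> Obj A"
    and I: "\<And>x. x \<in> S \<Longrightarrow> P x (Ident A (U x)) x"
    and C: "\<And>x y z f g. x \<in> S \<Longrightarrow> y \<in> S \<Longrightarrow> z \<in> S \<Longrightarrow> f \<in> hom A (U x) (U y) \<Longrightarrow> g \<in> hom A (U y) (U z) \<Longrightarrow>
      P x f y \<Longrightarrow> P y g z \<Longrightarrow> P x (Comp A g f) z"
  shows "category (structured_cat A S U P)"
proof -
  interpret category A by fact
  let ?B = "structured_cat A S U P"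
  show ?thesis
  proof
    fix f assume "f \<in> Arr ?B"
    then show "Dom ?B f \<in> Obj ?B" "Cod ?B f \<in> Obj ?B" by (simp_all add: Arr_structured_cat)
  next
    fix x assume "x \<in> Obj ?B"
    then show "Ident ?B x \<in> hom ?B x x" by (simp add: hom_structured_cat U I Ident_hom)
  next
    fix f g x y z assume "f \<in> hom ?B x y" "g \<in> hom ?B y z"
    then show "Comp ?B g f \<in> hom ?B x z"
      unfolding hom_structured_cat using C by (auto intro: Comp_hom) (metis fst_conv snd_conv)+
  next
    fix f x y assume "f \<in> hom ?B x y"
    then have f: "f = (x, und f, y)" "und f \<in> hom A (U x) (U y)" by (simp_all add: hom_structured_cat)
    have fs: "fst f = x" "snd (snd f) = y" by (subst f(1), simp)+
    show "Comp ?B (Ident ?B y) f = f" "Comp ?B f (Ident ?B x) = f"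
      by (rule triple_eqI; simp add: fs Ident_left[OF f(2)] Ident_right[OF f(2)])+
  next
    fix f g h w x y z assume "f \<in> hom ?B w x" "g \<in> hom ?B x y" "h \<in> hom ?B y z"
    then have "und f \<in> hom A (U w) (U x)" "und g \<in> hom A (U x) (U y)" "und h \<in> hom A (U y) (U z)"
      by (simp_all add: hom_structured_cat)
    then show "Comp ?B h (Comp ?B g f) = Comp ?B (Comp ?B h g) f" by (simp add: Comp_assoc)
  qed
qed

lemma is_functorD:
  assumes "is_functor A B F"
  shows "x \<in> Obj A \<Longrightarrow> FO F x \<in> Obj B"
    "f \<in> hom A x y \<Longrightarrow> FM F f \<in> hom B (FO F x) (FO F y)"
    "x \<in> Obj A \<Longrightarrow> FM F (Ident A x) = Ident B (FO F x)"
    "f \<in> hom A x y \<Longrightarrow> g \<in> hom A y z \<Longrightarrow> FM F (Comp A g f) = Comp B (FM F g) (FM F f)"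
proof -
  note F = assms[unfolded is_functor_def]
  show "x \<in> Obj A \<Longrightarrow> FO F x \<in> Obj B" using F[THEN conjunct1] by blast
  show "f \<in> hom A x y \<Longrightarrow> FM F f \<in> hom B (FO F x) (FO F y)"
    using F[THEN conjunct2, THEN conjunct1] by (auto simp: hom_def)
  show "x \<in> Obj A \<Longrightarrow> FM F (Ident A x) = Ident B (FO F x)"
    using F[THEN conjunct2, THEN conjunct2, THEN conjunct1] by blast
  show "f \<in> hom A x y \<Longrightarrow> g \<in> hom A y z \<Longrightarrow> FM F (Comp A g f) = Comp B (FM F g) (FM F f)"
    using F[THEN conjunct2, THEN conjunct2, THEN conjunct2, rule_format, of f g] by (simp add: hom_def)
qed

lemma bifunctorD:
  assumes "is_functor (prod_cat A B) D F"
  shows "x \<in> Obj A \<Longrightarrow> x' \<in> Obj B \<Longrightarrow> FM F (Ident A x, Ident B x') = Ident D (FO F (x, x'))"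
    "f \<in> hom A x y \<Longrightarrow> f' \<in> hom B x' y' \<Longrightarrow> FM F (f, f') \<in> hom D (FO F (x, x')) (FO F (y, y'))"
    "f \<in> hom A x y \<Longrightarrow> g \<in> hom A y z \<Longrightarrow> f' \<in> hom B x' y' \<Longrightarrow> g' \<in> hom B y' z' \<Longrightarrow>
       FM F (Comp A g f, Comp B g' f') = Comp D (FM F (g, g')) (FM F (f, f'))"
  using is_functorD(3)[OF assms, of "(x, x')"] is_functorD(2)[OF assms, of "(f, f')" "(x, x')" "(y, y')"]
    is_functorD(4)[OF assms, of "(f, f')" "(x, x')" "(y, y')" "(g, g')" "(z, z')"]
  by (simp_all add: prod_cat_def hom_def)

text \<open>
  Composition of monoid maps uses that the tensor product is functorial in both variables at once.
\<close>

lemma category_Comm: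
  assumes C: "symmetric_monoidal C"
  shows "category (Comm C)"
proof -
  interpret category C using C by (simp add: symmetric_monoidal_def)
  have t: "is_functor (prod_cat C C) C (tensor C)" using C by (simp add: symmetric_monoidal_def)
  note tI = bifunctorD(1)[OF t] and tH = bifunctorD(2)[OF t] and tC = bifunctorD(3)[OF t]
  show ?thesis
    unfolding Comm_def
  proof (rule category_structured_cat)
    show "category C" by unfold_locales
    fix X assume "X \<in> {X. is_comm_monoid C X}"
    then obtain x \<mu> \<iota> where X: "X = (x, \<mu>, \<iota>)" "x \<in> Obj C" "\<mu> \<in> hom C (FO (tensor C) (x, x)) x"
      "\<iota> \<in> hom C (munit C) x" by (cases X) (auto simp: is_comm_monoid_def)
    show "fst X \<in> Obj C" using X by simp
    show "(case X of (a, \<mu>, \<iota>) \<Rightarrow> \<lambda>f (b, \<mu>', \<iota>'). f \<cdot>\<^bsub>C\<^esub> \<mu> = \<mu>' \<cdot>\<^bsub>C\<^esub> (f \<otimes>\<^sup>m\<^bsub>C\<^esub> f) \<and> f \<cdot>\<^bsub>C\<^esub> \<iota> = \<iota>')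
        (Ident C (fst X)) X"
      using X by (simp add: tI Ident_left[OF X(3)] Ident_right[OF X(3)] Ident_left[OF X(4)])
  next
    fix X Y Z f g
    assume XYZ: "X \<in> {X. is_comm_monoid C X}" "Y \<in> {X. is_comm_monoid C X}" "Z \<in> {X. is_comm_monoid C X}"
      and f: "f \<in> hom C (fst X) (fst Y)" and g: "g \<in> hom C (fst Y) (fst Z)"
      and Pf: "(case X of (a, \<mu>, \<iota>) \<Rightarrow> \<lambda>f (b, \<mu>', \<iota>'). f \<cdot>\<^bsub>C\<^esub> \<mu> = \<mu>' \<cdot>\<^bsub>C\<^esub> (f \<otimes>\<^sup>m\<^bsub>C\<^esub> f) \<and> f \<cdot>\<^bsub>C\<^esub> \<iota> = \<iota>') f Y"
      and Pg: "(case Y of (a, \<mu>, \<iota>) \<Rightarrow> \<lambda>f (b, \<mu>', \<iota>'). f \<cdot>\<^bsub>C\<^esub> \<mu> = \<mu>' \<cdot>\<^bsub>C\<^esub> (f \<otimes>\<^sup>m\<^bsub>C\<^esub> f) \<and> f \<cdot>\<^bsub>C\<^esub> \<iota> = \<iota>') g Z"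
    obtain x m i where X: "X = (x, m, i)" by (cases X)
    obtain y m' i' where Y: "Y = (y, m', i')" by (cases Y)
    obtain z m'' i'' where Z: "Z = (z, m'', i'')" by (cases Z)
    have m: "m \<in> hom C (FO (tensor C) (x, x)) x" "m' \<in> hom C (FO (tensor C) (y, y)) y"
      "m'' \<in> hom C (FO (tensor C) (z, z)) z" "i \<in> hom C (munit C) x"
      using XYZ by (auto simp: is_comm_monoid_def X Y Z)
    have f: "f \<in> hom C x y" and g: "g \<in> hom C y z" using f g X Y Z by simp_all
    have eq: "f \<cdot>\<^bsub>C\<^esub> m = m' \<cdot>\<^bsub>C\<^esub> (f \<otimes>\<^sup>m\<^bsub>C\<^esub> f)" "f \<cdot>\<^bsub>C\<^esub> i = i'"
      "g \<cdot>\<^bsub>C\<^esub> m' = m'' \<cdot>\<^bsub>C\<^esub> (g \<otimes>\<^sup>m\<^bsub>C\<^esub> g)" "g \<cdot>\<^bsub>C\<^esub> i' = i''" using Pf Pg X Y Z by auto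
    have "(g \<cdot>\<^bsub>C\<^esub> f) \<cdot>\<^bsub>C\<^esub> m = g \<cdot>\<^bsub>C\<^esub> (m' \<cdot>\<^bsub>C\<^esub> (f \<otimes>\<^sup>m\<^bsub>C\<^esub> f))"
      using Comp_assoc[OF m(1) f g] eq by simp
    also have "\<dots> = (m'' \<cdot>\<^bsub>C\<^esub> (g \<otimes>\<^sup>m\<^bsub>C\<^esub> g)) \<cdot>\<^bsub>C\<^esub> (f \<otimes>\<^sup>m\<^bsub>C\<^esub> f)"
      using Comp_assoc[OF tH[OF f f] m(2) g] eq by simp
    also have "\<dots> = m'' \<cdot>\<^bsub>C\<^esub> ((g \<cdot>\<^bsub>C\<^esub> f) \<otimes>\<^sup>m\<^bsub>C\<^esub> (g \<cdot>\<^bsub>C\<^esub> f))"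
      using Comp_assoc[OF tH[OF f f] tH[OF g g] m(3)] tC[OF f g f g] by simp
    finally show "(case X of (a, \<mu>, \<iota>) \<Rightarrow> \<lambda>f (b, \<mu>', \<iota>'). f \<cdot>\<^bsub>C\<^esub> \<mu> = \<mu>' \<cdot>\<^bsub>C\<^esub> (f \<otimes>\<^sup>m\<^bsub>C\<^esub> f) \<and> f \<cdot>\<^bsub>C\<^esub> \<iota> = \<iota>')
        (g \<cdot>\<^bsub>C\<^esub> f) Z"
      using Comp_assoc[OF m(4) f g] eq by (simp add: X Z)
  qed
qed

lemma category_Mod:
  assumes C: "symmetric_monoidal C" and M: "left_actegory C M" and a: "is_comm_monoid C a"
  shows "category (Mod C M a)"
proof -
  interpret C: category C using C by (simp add: symmetric_monoidal_def)
  interpret category M using M by (simp add: left_actegory_def)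
  have t: "is_functor (prod_cat C M) M (action M)" using M by (simp add: left_actegory_def)
  define c where "c = fst a"
  have c: "c \<in> Obj C" using a by (auto simp: is_comm_monoid_def c_def)
  have Ic: "Ident C c \<in> hom C c c" by (rule C.Ident_hom[OF c])
  have tI: "FM (action M) (Ident C c, Ident M y) = Ident M (FO (action M) (c, y))" if "y \<in> Obj M" for y
    by (rule bifunctorD(1)[OF t]) (use c that in auto)
  have tH: "FM (action M) (Ident C c, g) \<in> hom M (FO (action M) (c, x)) (FO (action M) (c, y))"
    if "g \<in> hom M x y" for g x y
    by (rule bifunctorD(2)[OF t]) (use Ic that in auto)
  have tC: "FM (action M) (Ident C c, Comp M g' f') =
      Comp M (FM (action M) (Ident C c, g')) (FM (action M) (Ident C c, f'))"
    if "f' \<in> hom M x' y'" "g' \<in> hom M y' z'" for f' g' x' y' z'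
    using bifunctorD(3)[OF t Ic Ic that] by (simp add: c)
  show ?thesis
    unfolding Mod_def c_def[symmetric]
  proof (rule category_structured_cat)
    show "category M" by unfold_locales
    fix X assume "X \<in> {X. is_module C M a X}"
    then obtain x \<rho> where X: "X = (x, \<rho>)" "x \<in> Obj M" "\<rho> \<in> hom M (FO (action M) (c, x)) x"
      by (cases X; cases a) (auto simp: is_module_def c_def)
    show "fst X \<in> Obj M" using X by simp
    show "(case X of (m, \<rho>) \<Rightarrow> \<lambda>f (n, \<tau>). f \<cdot>\<^bsub>M\<^esub> \<rho> = \<tau> \<cdot>\<^bsub>M\<^esub> (Ident C c \<odot>\<^sup>m\<^bsub>M\<^esub> f)) (Ident M (fst X)) X"
      using X by (simp add: tI Ident_left[OF X(3)] Ident_right[OF X(3)])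
  next
    fix X Y Z f g
    assume XYZ: "X \<in> {X. is_module C M a X}" "Y \<in> {X. is_module C M a X}" "Z \<in> {X. is_module C M a X}"
      and f: "f \<in> hom M (fst X) (fst Y)" and g: "g \<in> hom M (fst Y) (fst Z)"
      and Pf: "(case X of (m, \<rho>) \<Rightarrow> \<lambda>f (n, \<tau>). f \<cdot>\<^bsub>M\<^esub> \<rho> = \<tau> \<cdot>\<^bsub>M\<^esub> (Ident C c \<odot>\<^sup>m\<^bsub>M\<^esub> f)) f Y"
      and Pg: "(case Y of (m, \<rho>) \<Rightarrow> \<lambda>f (n, \<tau>). f \<cdot>\<^bsub>M\<^esub> \<rho> = \<tau> \<cdot>\<^bsub>M\<^esub> (Ident C c \<odot>\<^sup>m\<^bsub>M\<^esub> f)) g Z"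
    obtain x m where X: "X = (x, m)" by (cases X)
    obtain y m' where Y: "Y = (y, m')" by (cases Y)
    obtain z m'' where Z: "Z = (z, m'')" by (cases Z)
    have m: "m \<in> hom M (FO (action M) (c, x)) x" "m' \<in> hom M (FO (action M) (c, y)) y"
      "m'' \<in> hom M (FO (action M) (c, z)) z"
      using XYZ by (cases a; auto simp: is_module_def X Y Z c_def)+
    have f: "f \<in> hom M x y" and g: "g \<in> hom M y z" using f g X Y Z by simp_all
    let ?a = "\<lambda>f. Ident C c \<odot>\<^sup>m\<^bsub>M\<^esub> f"
    have eq: "f \<cdot>\<^bsub>M\<^esub> m = m' \<cdot>\<^bsub>M\<^esub> ?a f" "g \<cdot>\<^bsub>M\<^esub> m' = m'' \<cdot>\<^bsub>M\<^esub> ?a g" using Pf Pg X Y Z by auto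
    have "(g \<cdot>\<^bsub>M\<^esub> f) \<cdot>\<^bsub>M\<^esub> m = g \<cdot>\<^bsub>M\<^esub> (m' \<cdot>\<^bsub>M\<^esub> ?a f)"
      using Comp_assoc[OF m(1) f g] eq by simp
    also have "\<dots> = (m'' \<cdot>\<^bsub>M\<^esub> ?a g) \<cdot>\<^bsub>M\<^esub> ?a f"
      using Comp_assoc[OF tH[OF f] m(2) g] eq by simp
    also have "\<dots> = m'' \<cdot>\<^bsub>M\<^esub> ?a (g \<cdot>\<^bsub>M\<^esub> f)"
      using Comp_assoc[OF tH[OF f] tH[OF g] m(3)] tC[OF f g] by simp
    finally show "(case X of (m, \<rho>) \<Rightarrow> \<lambda>f (n, \<tau>). f \<cdot>\<^bsub>M\<^esub> \<rho> = \<tau> \<cdot>\<^bsub>M\<^esub> (Ident C c \<odot>\<^sup>m\<^bsub>M\<^esub> f)) (g \<cdot>\<^bsub>M\<^esub> f) Z"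
      by (simp add: X Z)
  qed
qed

section \<open>Composing adjunctions and flat morphisms\<close>

lemma is_functor_fcomp: "is_functor A B F \<Longrightarrow> is_functor B D G \<Longrightarrow> is_functor A D (fcomp G F)"
  unfolding is_functor_def fcomp_def by (auto simp: hom_def)

lemma left_adjointE:
  assumes "left_adjoint A B L R"
  obtains \<eta> where "is_functor A B L" "is_functor B A R"
    "\<And>x. x \<in> Obj A \<Longrightarrow> \<eta> x \<in> hom A x (FO R (FO L x))"
    "\<And>f. f \<in> Arr A \<Longrightarrow> Comp A (FM R (FM L f)) (\<eta> (Dom A f)) = Comp A (\<eta> (Cod A f)) f"
    "\<And>x y f. x \<in> Obj A \<Longrightarrow> y \<in> Obj B \<Longrightarrow> f \<in> hom A x (FO R y) \<Longrightarrow>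
       \<exists>!g. g \<in> hom B (FO L x) y \<and> Comp A (FM R g) (\<eta> x) = f"
proof -
  note L = assms[unfolded left_adjoint_def]
  from L[THEN conjunct2, THEN conjunct2] obtain \<eta> where
    \<eta>: "(\<forall>x\<in>Obj A. \<eta> x \<in> hom A x (FO R (FO L x))) \<and>
     (\<forall>f\<in>Arr A. Comp A (FM R (FM L f)) (\<eta> (Dom A f)) = Comp A (\<eta> (Cod A f)) f) \<and>
     (\<forall>x\<in>Obj A. \<forall>y\<in>Obj B. \<forall>f \<in> hom A x (FO R y). \<exists>!g. g \<in> hom B (FO L x) y \<and> Comp A (FM R g) (\<eta> x) = f)"
    by (rule exE)
  show thesis
    by (rule that[OF L[THEN conjunct1] L[THEN conjunct2, THEN conjunct1]
        \<eta>[THEN conjunct1, rule_format] \<eta>[THEN conjunct2, THEN conjunct1, rule_format]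
        \<eta>[THEN conjunct2, THEN conjunct2, rule_format]])
qed

text \<open>
  Functors are pairs of functions on whole types, so that two descriptions of a functor, such as
  restriction along a composite and the composite of two restrictions, agree on objects and arrows only.
\<close>

lemma left_adjoint_cong:
  assumes L: "left_adjoint A B L R"
    and O: "\<And>y. y \<in> Obj B \<Longrightarrow> FO R' y = FO R y" and Mo: "\<And>g. g \<in> Arr B \<Longrightarrow> FM R' g = FM R g"
    and B: "category B"
  shows "left_adjoint A B L R'"
proof -
  interpret category B by fact
  obtain \<eta> where F: "is_functor A B L" and R: "is_functor B A R"
    and \<eta>: "\<And>x. x \<in> Obj A \<Longrightarrow> \<eta> x \<in> hom A x (FO R (FO L x))"
      "\<And>f. f \<in> Arr A \<Longrightarrow> Comp A (FM R (FM L f)) (\<eta> (Dom A f)) = Comp A (\<eta> (Cod A f)) f"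
      "\<And>x y f. x \<in> Obj A \<Longrightarrow> y \<in> Obj B \<Longrightarrow> f \<in> hom A x (FO R y) \<Longrightarrow>
             \<exists>!g. g \<in> hom B (FO L x) y \<and> Comp A (FM R g) (\<eta> x) = f"
    by (rule left_adjointE[OF L]) blast
  have LO: "FO L x \<in> Obj B" if "x \<in> Obj A" for x using F that by (simp add: is_functor_def)
  have LA: "FM L f \<in> Arr B" if "f \<in> Arr A" for f using F that by (simp add: is_functor_def hom_def)
  have "is_functor B A R'"
    using R unfolding is_functor_def by (simp add: O Mo)
  moreover have "\<exists>!g. g \<in> hom B (FO L x) y \<and> Comp A (FM R' g) (\<eta> x) = f"
    if "x \<in> Obj A" "y \<in> Obj B" "f \<in> hom A x (FO R' y)" for x y f
  proof -
    have "Comp A (FM R' g) (\<eta> x) = Comp A (FM R g) (\<eta> x)" if "g \<in> hom B (FO L x) y" for g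
      using that by (simp add: Mo hom_def)
    then show ?thesis using \<eta>(3)[of x y f] that O by metis
  qed
  ultimately show ?thesis
    unfolding left_adjoint_def using F \<eta>(1,2) LO LA
    by (intro conjI exI[of _ \<eta>]) (simp_all add: O Mo)
qed

text \<open>
  The universal arrow of the composite is a universal arrow for \<open>L\<close> followed by the image under \<open>R\<close> of
  one for \<open>L'\<close>; factoring through it means factoring twice.
\<close>

lemma left_adjoint_fcomp:
  assumes A: "category A" and B: "category B" and D: "category D"
    and L: "left_adjoint A B L R" and L': "left_adjoint B D L' R'"
  shows "left_adjoint A D (fcomp L' L) (fcomp R R')"
proof -
  interpret A: category A by fact
  interpret B: category B by fact
  interpret D: category D by fact
  obtain \<eta> where F: "is_functor A B L" and R: "is_functor B A R"
    and \<eta>: "\<And>x. x \<in> Obj A \<Longrightarrow> \<eta> x \<in> hom A x (FO R (FO L x))"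
      "\<And>f. f \<in> Arr A \<Longrightarrow> Comp A (FM R (FM L f)) (\<eta> (Dom A f)) = Comp A (\<eta> (Cod A f)) f"
      "\<And>x y f. x \<in> Obj A \<Longrightarrow> y \<in> Obj B \<Longrightarrow> f \<in> hom A x (FO R y) \<Longrightarrow>
             \<exists>!g. g \<in> hom B (FO L x) y \<and> Comp A (FM R g) (\<eta> x) = f"
    by (rule left_adjointE[OF L]) blast
  obtain \<theta> where F': "is_functor B D L'" and R': "is_functor D B R'"
    and \<theta>: "\<And>x. x \<in> Obj B \<Longrightarrow> \<theta> x \<in> hom B x (FO R' (FO L' x))"
      "\<And>f. f \<in> Arr B \<Longrightarrow> Comp B (FM R' (FM L' f)) (\<theta> (Dom B f)) = Comp B (\<theta> (Cod B f)) f"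
      "\<And>x y f. x \<in> Obj B \<Longrightarrow> y \<in> Obj D \<Longrightarrow> f \<in> hom B x (FO R' y) \<Longrightarrow>
             \<exists>!g. g \<in> hom D (FO L' x) y \<and> Comp B (FM R' g) (\<theta> x) = f"
    by (rule left_adjointE[OF L']) blast
  note LO = is_functorD(1)[OF F] and LA = is_functorD(2)[OF F]
  note LO' = is_functorD(1)[OF F'] and LA' = is_functorD(2)[OF F']
  note RO' = is_functorD(1)[OF R'] and RH = is_functorD(2)[OF R] and RH' = is_functorD(2)[OF R']
    and RC = is_functorD(4)[OF R]
  define \<zeta> where "\<zeta> x = Comp A (FM R (\<theta> (FO L x))) (\<eta> x)" for x
  have R\<theta>: "FM R (\<theta> (FO L x)) \<in> hom A (FO R (FO L x)) (FO R (FO R' (FO L' (FO L x))))" if "x \<in> Obj A" for x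
    using RH[OF \<theta>(1)[OF LO[OF that]]] .
  have \<zeta>: "\<zeta> x \<in> hom A x (FO R (FO R' (FO L' (FO L x))))" if "x \<in> Obj A" for x
    unfolding \<zeta>_def by (rule A.Comp_hom[OF \<eta>(1)[OF that] R\<theta>[OF that]])
  have nat: "Comp A (FM R (FM R' (FM L' (FM L f)))) (\<zeta> (Dom A f)) = Comp A (\<zeta> (Cod A f)) f" if f: "f \<in> Arr A" for f
  proof -
    let ?x = "Dom A f" and ?y = "Cod A f" and ?h = "FM R' (FM L' (FM L f))"
    have fh: "f \<in> hom A ?x ?y" using f by (simp add: hom_def)
    have xy: "?x \<in> Obj A" "?y \<in> Obj A" using f by auto
    have Lf: "FM L f \<in> hom B (FO L ?x) (FO L ?y)" using LA[OF fh] .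
    have h: "?h \<in> hom B (FO R' (FO L' (FO L ?x))) (FO R' (FO L' (FO L ?y)))"
      using RH'[OF LA'[OF Lf]] .
    have "Comp A (FM R ?h) (\<zeta> ?x) = Comp A (Comp A (FM R ?h) (FM R (\<theta> (FO L ?x)))) (\<eta> ?x)"
      unfolding \<zeta>_def by (rule A.Comp_assoc[OF \<eta>(1)[OF xy(1)] R\<theta>[OF xy(1)] RH[OF h]])
    also have "Comp A (FM R ?h) (FM R (\<theta> (FO L ?x))) = FM R (Comp B ?h (\<theta> (FO L ?x)))"
      by (rule RC[symmetric, OF \<theta>(1)[OF LO[OF xy(1)]] h])
    also have "Comp B ?h (\<theta> (FO L ?x)) = Comp B (\<theta> (FO L ?y)) (FM L f)"
      using \<theta>(2)[of "FM L f"] Lf by (simp add: hom_def)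
    also have "FM R \<dots> = Comp A (FM R (\<theta> (FO L ?y))) (FM R (FM L f))"
      by (rule RC[OF Lf \<theta>(1)[OF LO[OF xy(2)]]])
    also have "Comp A \<dots> (\<eta> ?x) = Comp A (FM R (\<theta> (FO L ?y))) (Comp A (FM R (FM L f)) (\<eta> ?x))"
      by (rule A.Comp_assoc[symmetric, OF \<eta>(1)[OF xy(1)] RH[OF Lf] R\<theta>[OF xy(2)]])
    also have "\<dots> = Comp A (FM R (\<theta> (FO L ?y))) (Comp A (\<eta> ?y) f)" using \<eta>(2)[OF f] by simp
    also have "\<dots> = Comp A (\<zeta> ?y) f"
      unfolding \<zeta>_def by (rule A.Comp_assoc[OF fh \<eta>(1)[OF xy(2)] R\<theta>[OF xy(2)]])
    finally show ?thesis .
  qed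
  have univ: "\<exists>!g. g \<in> hom D (FO L' (FO L x)) y \<and> Comp A (FM R (FM R' g)) (\<zeta> x) = f"
    if x: "x \<in> Obj A" and y: "y \<in> Obj D" and f: "f \<in> hom A x (FO R (FO R' y))" for x y f
  proof -
    have val: "Comp A (FM R (FM R' g)) (\<zeta> x) = Comp A (FM R (Comp B (FM R' g) (\<theta> (FO L x)))) (\<eta> x)"
      "Comp B (FM R' g) (\<theta> (FO L x)) \<in> hom B (FO L x) (FO R' y)"
      if g: "g \<in> hom D (FO L' (FO L x)) y" for g
    proof -
      note g' = RH'[OF g]
      have "Comp A (FM R (FM R' g)) (\<zeta> x) = Comp A (Comp A (FM R (FM R' g)) (FM R (\<theta> (FO L x)))) (\<eta> x)"
        unfolding \<zeta>_def by (rule A.Comp_assoc[OF \<eta>(1)[OF x] R\<theta>[OF x] RH[OF g']])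
      then show "Comp A (FM R (FM R' g)) (\<zeta> x) = Comp A (FM R (Comp B (FM R' g) (\<theta> (FO L x)))) (\<eta> x)"
        using RC[OF \<theta>(1)[OF LO[OF x]] g'] by simp
      show "Comp B (FM R' g) (\<theta> (FO L x)) \<in> hom B (FO L x) (FO R' y)"
        by (rule B.Comp_hom[OF \<theta>(1)[OF LO[OF x]] g'])
    qed
    obtain k where k: "k \<in> hom B (FO L x) (FO R' y)" "Comp A (FM R k) (\<eta> x) = f"
      using \<eta>(3)[OF x RO'[OF y] f] by blast
    have ku: "k' = k" if "k' \<in> hom B (FO L x) (FO R' y)" "Comp A (FM R k') (\<eta> x) = f" for k'
      using \<eta>(3)[OF x RO'[OF y] f] k that by blast
    obtain g where g: "g \<in> hom D (FO L' (FO L x)) y" "Comp B (FM R' g) (\<theta> (FO L x)) = k"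
      using \<theta>(3)[OF LO[OF x] y k(1)] by blast
    show ?thesis
    proof (rule ex1I[of _ g])
      show "g \<in> hom D (FO L' (FO L x)) y \<and> Comp A (FM R (FM R' g)) (\<zeta> x) = f"
        using g val(1)[OF g(1)] k by simp
      fix g' assume g': "g' \<in> hom D (FO L' (FO L x)) y \<and> Comp A (FM R (FM R' g')) (\<zeta> x) = f"
      then have "Comp B (FM R' g') (\<theta> (FO L x)) = k" using val[of g'] ku by simp
      then show "g' = g" using \<theta>(3)[OF LO[OF x] y k(1)] g g' by blast
    qed
  qed
  show ?thesis
    unfolding left_adjoint_def
  proof (intro conjI exI[of _ \<zeta>] ballI)
    show "is_functor A D (fcomp L' L)" "is_functor D A (fcomp R R')"
      using F F' R R' by (auto intro: is_functor_fcomp)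
  qed (use \<zeta> nat univ in \<open>auto simp: fcomp_def\<close>)
qed

lemma preserves_finite_limits_fcomp:
  assumes F: "is_functor A B F" and "preserves_finite_limits A B F" "preserves_finite_limits B D G"
  shows "preserves_finite_limits A D (fcomp G F)"
  unfolding preserves_finite_limits_def
proof (intro allI impI)
  fix J :: "(nat, nat) cat" and Di x \<pi>
  assume J: "category J \<and> finite (Arr J) \<and> is_functor J A Di \<and> is_limit A J Di x \<pi>"
  then have "is_limit B J (fcomp F Di) (FO F x) (FM F \<circ> \<pi>)" using assms unfolding preserves_finite_limits_def by blast
  moreover have "is_functor J B (fcomp F Di)" using J F is_functor_fcomp by blast
  ultimately have "is_limit D J (fcomp G (fcomp F Di)) (FO G (FO F x)) (FM G \<circ> (FM F \<circ> \<pi>))"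
    using assms J unfolding preserves_finite_limits_def by blast
  then show "is_limit D J (fcomp (fcomp G F) Di) (FO (fcomp G F) x) (FM (fcomp G F) \<circ> \<pi>)"
    by (simp add: fcomp_def comp_assoc)
qed

text \<open>
  Restriction of scalars is strictly functorial on modules, so extension along \<open>\<beta> \<cdot> \<alpha>\<close> may be taken to
  be extension along \<open>\<alpha>\<close> followed by extension along \<open>\<beta>\<close>.
\<close>

lemma flat_Comp:
  assumes C: "symmetric_monoidal C" and M: "left_actegory C M"
    and \<alpha>: "flat C M \<alpha>" and \<beta>: "flat C M \<beta>" and \<alpha>\<beta>: "Cod (Comm C) \<alpha> = Dom (Comm C) \<beta>"
  shows "flat C M (Comp (Comm C) \<beta> \<alpha>)"
proof -
  interpret Comm: category "Comm C" by (rule category_Comm[OF C])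
  interpret C: category C using C by (simp add: symmetric_monoidal_def)
  interpret M: category M using M by (simp add: left_actegory_def)
  have act: "is_functor (prod_cat C M) M (action M)" using M by (simp add: left_actegory_def)
  define a b c where "a = Dom (Comm C) \<alpha>" and "b = Cod (Comm C) \<alpha>" and "c = Cod (Comm C) \<beta>"
  have Arr: "\<alpha> \<in> Arr (Comm C)" "\<beta> \<in> Arr (Comm C)" using \<alpha> \<beta> by (simp_all add: flat_def)
  have "a \<in> Obj (Comm C)" "b \<in> Obj (Comm C)" "c \<in> Obj (Comm C)" using Arr by (simp_all add: a_def b_def c_def)
  then have abc: "is_comm_monoid C a" "is_comm_monoid C b" "is_comm_monoid C c" by (simp_all add: Comm_def)
  note cats = category_Mod[OF C M abc(1)] category_Mod[OF C M abc(2)] category_Mod[OF C M abc(3)]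
  obtain L where L: "left_adjoint (Mod C M a) (Mod C M b) L (restriction M \<alpha>)"
    "preserves_finite_limits (Mod C M a) (Mod C M b) L"
    using \<alpha> by (auto simp: flat_def is_extension_def a_def b_def)
  obtain L' where L': "left_adjoint (Mod C M b) (Mod C M c) L' (restriction M \<beta>)"
    "preserves_finite_limits (Mod C M b) (Mod C M c) L'"
    using \<beta> by (auto simp: flat_def is_extension_def \<alpha>\<beta>[symmetric] b_def c_def)
  have u: "und \<alpha> \<in> hom C (fst a) (fst b)" "und \<beta> \<in> hom C (fst b) (fst c)"
    "und (Comp (Comm C) \<beta> \<alpha>) = Comp C (und \<beta>) (und \<alpha>)"
    using Arr \<alpha>\<beta> by (simp_all add: Comm_def Arr_structured_cat a_def b_def c_def)
  have r: "FO (restriction M (Comp (Comm C) \<beta> \<alpha>)) x = FO (restriction M \<alpha>) (FO (restriction M \<beta>) x)"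
    if x: "x \<in> Obj (Mod C M c)" for x
  proof -
    obtain n \<tau> where x': "x = (n, \<tau>)" "n \<in> Obj M" "\<tau> \<in> hom M (FO (action M) (fst c, n)) n"
      using x by (cases x; cases c) (auto simp: Mod_def is_module_def)
    have n: "Ident M n \<in> hom M n n" by (rule M.Ident_hom[OF x'(2)])
    have h: "FM (action M) (f, Ident M n) \<in> hom M (FO (action M) (y, n)) (FO (action M) (z, n))"
      if "f \<in> hom C y z" for f y z
      by (rule bifunctorD(2)[OF act that n])
    have "FM (action M) (Comp C (und \<beta>) (und \<alpha>), Comp M (Ident M n) (Ident M n)) =
      Comp M (FM (action M) (und \<beta>, Ident M n)) (FM (action M) (und \<alpha>, Ident M n))"
      by (rule bifunctorD(3)[OF act u(1,2) n n])
    then have "FM (action M) (Comp C (und \<beta>) (und \<alpha>), Ident M n) =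
      Comp M (FM (action M) (und \<beta>, Ident M n)) (FM (action M) (und \<alpha>, Ident M n))"
      using x' by simp
    then show ?thesis
      using M.Comp_assoc[OF h[OF u(1)] h[OF u(2)] x'(3)] by (simp add: restriction_def Let_def x' u(3))
  qed
  have "left_adjoint (Mod C M a) (Mod C M c) (fcomp L' L) (fcomp (restriction M \<alpha>) (restriction M \<beta>))"
    by (rule left_adjoint_fcomp[OF cats L(1) L'(1)])
  then have "left_adjoint (Mod C M a) (Mod C M c) (fcomp L' L) (restriction M (Comp (Comm C) \<beta> \<alpha>))"
  proof (rule left_adjoint_cong[OF _ _ _ cats(3)])
    fix x assume "x \<in> Obj (Mod C M c)"
    then show "FO (restriction M (Comp (Comm C) \<beta> \<alpha>)) x = FO (fcomp (restriction M \<alpha>) (restriction M \<beta>)) x"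
      using r by (simp add: fcomp_def)
  next
    fix g assume "g \<in> Arr (Mod C M c)"
    then have "fst g \<in> Obj (Mod C M c)" "snd (snd g) \<in> Obj (Mod C M c)"
      unfolding Mod_def by (simp_all add: Arr_structured_cat)
    then show "FM (restriction M (Comp (Comm C) \<beta> \<alpha>)) g = FM (fcomp (restriction M \<alpha>) (restriction M \<beta>)) g"
      using r[of "fst g"] r[of "snd (snd g)"] by (cases g) (simp add: fcomp_def restriction_def Let_def)
  qed
  moreover have "preserves_finite_limits (Mod C M a) (Mod C M c) (fcomp L' L)"
    using preserves_finite_limits_fcomp L L' by (auto simp: left_adjoint_def)
  ultimately show ?thesis
    unfolding flat_def is_extension_def using Arr \<alpha>\<beta> by (auto simp: a_def c_def)
qed

lemma is_mono_Comp:
  assumes A: "category A" and f: "is_mono A f" and g: "is_mono A g" and fg: "Cod A f = Dom A g"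
  shows "is_mono A (Comp A g f)"
proof -
  interpret category A by fact
  have Arr: "f \<in> Arr A" "g \<in> Arr A" using f g by (simp_all add: is_mono_def)
  show ?thesis
    unfolding is_mono_def
  proof (intro conjI ballI impI)
    show "Comp A g f \<in> Arr A" using Arr fg by simp
    fix z h k assume z: "z \<in> Obj A" and h: "h \<in> hom A z (Dom A (Comp A g f))" and k: "k \<in> hom A z (Dom A (Comp A g f))"
      and eq: "Comp A (Comp A g f) h = Comp A (Comp A g f) k"
    have hk: "h \<in> hom A z (Dom A f)" "k \<in> hom A z (Dom A f)" using h k Arr fg by simp_all
    have fh: "f \<in> hom A (Dom A f) (Dom A g)" "g \<in> hom A (Dom A g) (Cod A g)" using Arr fg by (simp_all add: hom_def)
    have "Comp A g (Comp A f h) = Comp A g (Comp A f k)"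
      using eq Comp_assoc[OF hk(1) fh] Comp_assoc[OF hk(2) fh] by simp
    then have "Comp A f h = Comp A f k"
      using g z Comp_hom[OF hk(1) fh(1)] Comp_hom[OF hk(2) fh(1)] unfolding is_mono_def by blast
    then show "h = k" using f z hk unfolding is_mono_def by blast
  qed
qed

section \<open>Morphisms of finite type\<close>

lemma is_colimit_iff:
  "is_colimit A J D x \<iota> \<longleftrightarrow>
     (x \<in> Obj A \<and> (\<forall>i\<in>Obj J. \<iota> i \<in> hom A (FO D i) x) \<and>
       (\<forall>u\<in>Arr J. Comp A (\<iota> (Cod J u)) (FM D u) = \<iota> (Dom J u))) \<and>
     (\<forall>y \<rho>. y \<in> Obj A \<and> (\<forall>i\<in>Obj J. \<rho> i \<in> hom A (FO D i) y) \<and>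
        (\<forall>u\<in>Arr J. Comp A (\<rho> (Cod J u)) (FM D u) = \<rho> (Dom J u)) \<longrightarrow>
        (\<exists>!h. h \<in> hom A x y \<and> (\<forall>i\<in>Obj J. Comp A h (\<iota> i) = \<rho> i)))"
  unfolding is_colimit_def is_limit_def is_cone_def by simp

text \<open>
  The finiteness condition in \<open>finite_type\<close>, for an arbitrary category in place of commutative monoids.
\<close>

definition compact_in_coslice :: "'s itself \<Rightarrow> ('o, 'm, 'z) cat_scheme \<Rightarrow> 'm \<Rightarrow> bool" where
  "compact_in_coslice S A \<alpha> \<longleftrightarrow>
     (let K = coslice A (Dom A \<alpha>) in
      \<forall>J :: ('s, 's) cat. \<forall>D x \<iota>.
        small_shape J \<and> filtered J \<and> is_functor J K D \<and> is_colimit K J D x \<iota> \<longrightarrow>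
        bij_betw (colimit_comparison K \<iota>) (set_colimit J (fcomp (corep K \<alpha>) D)) (hom K \<alpha> x))"

text \<open>
  The generators of the relation that defines the colimit do not change the composite with the cocone,
  so this composite is constant on classes and the comparison map takes its value at any representative.
\<close>

lemma colimit_comparison_class:
  assumes K: "category K" and D: "is_functor J K D" and J: "category J"
    and \<iota>: "\<And>i. i \<in> Obj J \<Longrightarrow> \<iota> i \<in> hom K (FO D i) x"
      "\<And>u. u \<in> Arr J \<Longrightarrow> Comp K (\<iota> (Cod J u)) (FM D u) = \<iota> (Dom J u)"
    and i: "i \<in> Obj J" and g: "g \<in> hom K k (FO D i)"
  shows "colimit_comparison K \<iota> (set_colimit_rel J (fcomp (corep K k) D) `` {(i, g)}) = Comp K (\<iota> i) g"
proof -
  interpret K: category K by fact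
  interpret J: category J by fact
  define X where "X = fcomp (corep K k) D"
  define E where "E = {((Dom J u, s), (Cod J u, und (FM X u) s)) | u s. u \<in> Arr J \<and> s \<in> FO X (Dom J u)}"
  define T where "T = (SIGMA i : Obj J. FO X i)"
  define v where "v = (\<lambda>(i, g). Comp K (\<iota> i) g)"
  have rel: "set_colimit_rel J X = {(p, q). p \<in> T \<and> q \<in> T \<and> (p, q) \<in> (E \<union> E\<inverse>)\<^sup>*}"
    unfolding set_colimit_rel_def E_def T_def Let_def ..
  have vE: "v p = v q" if pq: "(p, q) \<in> E" for p q
  proof -
    obtain u s where us: "p = (Dom J u, s)" "q = (Cod J u, und (FM X u) s)" "u \<in> Arr J" "s \<in> FO X (Dom J u)"
      using pq unfolding E_def by blast
    have s: "s \<in> hom K k (FO D (Dom J u))" using us(4) by (simp add: X_def fcomp_def corep_def)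
    have Du: "FM D u \<in> hom K (FO D (Dom J u)) (FO D (Cod J u))"
      using is_functorD(2)[OF D] us(3) by (simp add: hom_def)
    then have "und (FM X u) s = Comp K (FM D u) s"
      using s by (simp add: X_def fcomp_def corep_def hom_def)
    then show ?thesis
      using K.Comp_assoc[OF s Du \<iota>(1)] \<iota>(2)[OF us(3)] us by (simp add: v_def)
  qed
  have vr: "v p = v q" if "(p, q) \<in> (E \<union> E\<inverse>)\<^sup>*" for p q
    using that by (induction rule: rtrancl_induct) (use vE in \<open>auto dest: vE\<close>)
  have "(i, g) \<in> T" using i g by (simp add: T_def X_def fcomp_def corep_def)
  then have "v ` (set_colimit_rel J X `` {(i, g)}) = {v (i, g)}"
    using vr by (force simp: rel)
  then show ?thesis
    unfolding colimit_comparison_def X_def[symmetric] v_def by simp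
qed

lemma is_epiD:
  assumes "is_epi A f" "category A" "g \<in> hom A (Cod A f) z" "h \<in> hom A (Cod A f) z" "Comp A g f = Comp A h f"
  shows "g = h"
proof -
  interpret category A by fact
  have "z \<in> Obj A" using assms(3) by (auto simp: hom_def)
  then show ?thesis
    using assms(1)[unfolded is_epi_def is_mono_def, THEN conjunct2, rule_format, of z g h] assms(3-5) by simp
qed

lemma category_coslice:
  assumes "category A" and a: "a \<in> Obj A"
  shows "category (coslice A a)"
proof -
  interpret category A by fact
  show ?thesis
    unfolding coslice_def by (rule category_structured_cat) (use a in \<open>auto simp: hom_def\<close>, unfold_locales)
qed

lemma hom_coslice:
  "t \<in> hom (coslice A a) f g \<longleftrightarrow> t = (f, und t, g) \<and> f \<in> Arr A \<and> Dom A f = a \<and> g \<in> Arr A \<and> Dom A g = a \<and>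
     und t \<in> hom A (Cod A f) (Cod A g) \<and> Comp A (und t) f = g"
  by (auto simp: coslice_def hom_structured_cat)

lemma coslice_simps [simp]:
  "Obj (coslice A a) = {f \<in> Arr A. Dom A f = a}"
  "Dom (coslice A a) t = fst t" "Cod (coslice A a) t = snd (snd t)"
  "Ident (coslice A a) x = (x, Ident A (Cod A x), x)"
  "Comp (coslice A a) t s = (fst s, Comp A (und t) (und s), snd (snd t))"
  by (simp_all add: coslice_def)

lemma hom_coslice_unique:
  assumes A: "category A" and e: "is_epi A e" "g \<in> hom (coslice A x) e y" "h \<in> hom (coslice A x) e y"
  shows "g = h"
proof -
  have g: "g = (e, und g, y)" "und g \<in> hom A (Cod A e) (Cod A y)" "Comp A (und g) e = y"
    and h: "h = (e, und h, y)" "und h \<in> hom A (Cod A e) (Cod A y)" "Comp A (und h) e = y"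
    using e(2,3) unfolding hom_coslice by blast+
  have "und g = und h" using is_epiD[OF e(1) A g(2) h(2)] g(3) h(3) by simp
  then show ?thesis using g(1) h(1) by metis
qed

text \<open>
  Under an epimorphism \<open>\<alpha>\<close> every hom set from \<open>\<alpha>\<close> in the coslice has at most one element, and so does
  its filtered colimit.  The comparison map is therefore injective, and bijective as soon as its source
  is inhabited whenever its target is.
\<close>

lemma compact_in_coslice_epi_iff:
  assumes A: "category A" and \<alpha>: "\<alpha> \<in> Arr A" "is_epi A \<alpha>"
  shows "compact_in_coslice (S :: 's itself) A \<alpha> \<longleftrightarrow>
     (\<forall>J :: ('s, 's) cat. \<forall>D x \<iota>.
        small_shape J \<and> filtered J \<and> is_functor J (coslice A (Dom A \<alpha>)) D \<and>
        is_colimit (coslice A (Dom A \<alpha>)) J D x \<iota> \<and> hom (coslice A (Dom A \<alpha>)) \<alpha> x \<noteq> {} \<longrightarrow>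
        (\<exists>i\<in>Obj J. hom (coslice A (Dom A \<alpha>)) \<alpha> (FO D i) \<noteq> {}))"
proof -
  define K where "K = coslice A (Dom A \<alpha>)"
  interpret A: category A by fact
  interpret K: category K unfolding K_def by (rule category_coslice[OF A]) (use \<alpha> in simp)
  note epi = hom_coslice_unique[OF A \<alpha>(2), of _ "Dom A \<alpha>", folded K_def]
  have eqv: "bij_betw (colimit_comparison K \<iota>) (set_colimit J (fcomp (corep K \<alpha>) D)) (hom K \<alpha> x) \<longleftrightarrow>
      (hom K \<alpha> x \<noteq> {} \<longrightarrow> (\<exists>i\<in>Obj J. hom K \<alpha> (FO D i) \<noteq> {}))"
    if J: "small_shape J" "filtered J" and D: "is_functor J K D" and colim: "is_colimit K J D x \<iota>"
    for J :: "('s, 's) cat" and D x \<iota>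
  proof -
    define X where "X = fcomp (corep K \<alpha>) D"
    define R where "R = set_colimit_rel J X"
    define T where "T = (SIGMA i : Obj J. FO X i)"
    have T: "p \<in> T \<longleftrightarrow> fst p \<in> Obj J \<and> snd p \<in> hom K \<alpha> (FO D (fst p))" for p
      by (cases p) (simp add: T_def X_def fcomp_def corep_def)
    have catJ: "category J" using J by (simp add: small_shape_def)
    interpret J: category J by fact
    note co = colim[unfolded is_colimit_iff, THEN conjunct1]
    have \<iota>: "\<And>i. i \<in> Obj J \<Longrightarrow> \<iota> i \<in> hom K (FO D i) x"
      "\<And>u. u \<in> Arr J \<Longrightarrow> Comp K (\<iota> (Cod J u)) (FM D u) = \<iota> (Dom J u)" using co by blast+
    have cls: "colimit_comparison K \<iota> (R `` {(i, g)}) = Comp K (\<iota> i) g"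
      if ig: "i \<in> Obj J" "g \<in> hom K \<alpha> (FO D i)" for i g
      unfolding R_def X_def by (rule colimit_comparison_class[OF K.category_axioms D catJ _ _ ig]) (fact \<iota>)+
    have sc: "c \<in> set_colimit J X \<longleftrightarrow> (\<exists>p\<in>T. c = R `` {p})" for c
      by (auto simp: set_colimit_def R_def T_def quotient_def)
    define E where "E = {((Dom J u, s), (Cod J u, und (FM X u) s)) | u s. u \<in> Arr J \<and> s \<in> FO X (Dom J u)}"
    have rel: "R = {(p, q). p \<in> T \<and> q \<in> T \<and> (p, q) \<in> (E \<union> E\<inverse>)\<^sup>*}"
      unfolding R_def set_colimit_rel_def E_def T_def Let_def ..
    have step: "((i, g), (j, h)) \<in> E" if u: "u \<in> hom J i j" and g: "g \<in> hom K \<alpha> (FO D i)" and h: "h \<in> hom K \<alpha> (FO D j)"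
      for i j u g h
    proof -
      have Du: "FM D u \<in> hom K (FO D i) (FO D j)" by (rule is_functorD(2)[OF D u])
      have "Comp K (FM D u) g = h" by (rule epi[OF K.Comp_hom[OF g Du] h])
      moreover have "und (FM X u) g = Comp K (FM D u) g"
        using g Du by (simp add: X_def fcomp_def corep_def hom_def und_def)
      ultimately have "((i, g), (j, h)) = ((Dom J u, g), (Cod J u, und (FM X u) g)) \<and> u \<in> Arr J \<and> g \<in> FO X (Dom J u)"
        using u g by (simp add: hom_def X_def fcomp_def corep_def)
      then show ?thesis unfolding E_def by blast
    qed
    have one: "(p, q) \<in> (E \<union> E\<inverse>)\<^sup>*" if p: "p \<in> T" and q: "q \<in> T" for p q
    proof -
      obtain i g j h where pq: "p = (i, g)" "q = (j, h)" by (cases p; cases q) blast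
      have i: "i \<in> Obj J" "j \<in> Obj J" and g: "g \<in> hom K \<alpha> (FO D i)" and h: "h \<in> hom K \<alpha> (FO D j)"
        using p q unfolding T pq by simp_all
      obtain k u v where k: "k \<in> Obj J" and u: "u \<in> hom J i k" and v: "v \<in> hom J j k"
        using J(2) i unfolding filtered_def by blast
      have gk: "Comp K (FM D u) g \<in> hom K \<alpha> (FO D k)" by (rule K.Comp_hom[OF g is_functorD(2)[OF D u]])
      have "(p, (k, Comp K (FM D u) g)) \<in> E \<union> E\<inverse>" "((k, Comp K (FM D u) g), q) \<in> E \<union> E\<inverse>"
        using step[OF u g gk] step[OF v h gk] by (simp_all add: pq)
      then show ?thesis by (meson rtrancl.rtrancl_into_rtrancl rtrancl.rtrancl_refl)
    qed
    then have R: "R `` {p} = T" if p: "p \<in> T" for p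
      unfolding rel using one[OF p] p by blast
    have inj: "inj_on (colimit_comparison K \<iota>) (set_colimit J X)"
      by (rule inj_onI) (use sc R in metis)
    have img: "colimit_comparison K \<iota> c \<in> hom K \<alpha> x" if c: "c \<in> set_colimit J X" for c
    proof -
      obtain p where p: "p \<in> T" "c = R `` {p}" using c sc by blast
      obtain i g where ig: "p = (i, g)" by (cases p)
      have i: "i \<in> Obj J" "g \<in> hom K \<alpha> (FO D i)" using p(1) unfolding T ig by simp_all
      show ?thesis using cls[OF i] K.Comp_hom[OF i(2) \<iota>(1)[OF i(1)]] p ig by simp
    qed
    show ?thesis
      unfolding X_def[symmetric]
    proof
      assume bij: "bij_betw (colimit_comparison K \<iota>) (set_colimit J X) (hom K \<alpha> x)"
      show "hom K \<alpha> x \<noteq> {} \<longrightarrow> (\<exists>i\<in>Obj J. hom K \<alpha> (FO D i) \<noteq> {})"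
      proof
        assume "hom K \<alpha> x \<noteq> {}"
        then have "set_colimit J X \<noteq> {}" using bij by (auto simp: bij_betw_def)
        then obtain p where "p \<in> T" using sc by blast
        then show "\<exists>i\<in>Obj J. hom K \<alpha> (FO D i) \<noteq> {}" unfolding T by blast
      qed
    next
      assume ex: "hom K \<alpha> x \<noteq> {} \<longrightarrow> (\<exists>i\<in>Obj J. hom K \<alpha> (FO D i) \<noteq> {})"
      have "\<gamma> \<in> colimit_comparison K \<iota> ` set_colimit J X" if \<gamma>: "\<gamma> \<in> hom K \<alpha> x" for \<gamma>
      proof -
        obtain i g where i: "i \<in> Obj J" "g \<in> hom K \<alpha> (FO D i)" using ex \<gamma> by blast
        have "(i, g) \<in> T" unfolding T using i by simp
        then have c: "R `` {(i, g)} \<in> set_colimit J X" using sc by blast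
        have "\<gamma> = colimit_comparison K \<iota> (R `` {(i, g)})" by (rule epi[OF \<gamma> img[OF c]])
        then show ?thesis using c by blast
      qed
      then show "bij_betw (colimit_comparison K \<iota>) (set_colimit J X) (hom K \<alpha> x)"
        using inj img by (auto simp: bij_betw_def)
    qed
  qed
  show ?thesis
    unfolding compact_in_coslice_def Let_def K_def[symmetric]
  proof (intro iffI allI impI; elim conjE)
    fix J :: "('s, 's) cat" and D x \<iota>
    assume J: "small_shape J" "filtered J" "is_functor J K D" "is_colimit K J D x \<iota>"
    { assume "hom K \<alpha> x \<noteq> {}" "\<forall>J :: ('s, 's) cat. \<forall>D x \<iota>.
        small_shape J \<and> filtered J \<and> is_functor J K D \<and> is_colimit K J D x \<iota> \<longrightarrow>
        bij_betw (colimit_comparison K \<iota>) (set_colimit J (fcomp (corep K \<alpha>) D)) (hom K \<alpha> x)"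
      then show "\<exists>i\<in>Obj J. hom K \<alpha> (FO D i) \<noteq> {}" using eqv[OF J] J by simp }
    assume "\<forall>J :: ('s, 's) cat. \<forall>D x \<iota>.
        small_shape J \<and> filtered J \<and> is_functor J K D \<and> is_colimit K J D x \<iota> \<and> hom K \<alpha> x \<noteq> {} \<longrightarrow>
        (\<exists>i\<in>Obj J. hom K \<alpha> (FO D i) \<noteq> {})"
    then show "bij_betw (colimit_comparison K \<iota>) (set_colimit J (fcomp (corep K \<alpha>) D)) (hom K \<alpha> x)"
      unfolding eqv[OF J] using J by blast
  qed
qed


lemma compact_in_coslice_epiD:
  fixes J :: "('s, 's) cat"
  assumes "category A" "\<alpha> \<in> Arr A" "is_epi A \<alpha>" and "compact_in_coslice TYPE('s) A \<alpha>"
    and "small_shape J" "filtered J" "is_functor J (coslice A (Dom A \<alpha>)) D"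
      "is_colimit (coslice A (Dom A \<alpha>)) J D x \<iota>" "hom (coslice A (Dom A \<alpha>)) \<alpha> x \<noteq> {}"
  shows "\<exists>i\<in>Obj J. hom (coslice A (Dom A \<alpha>)) \<alpha> (FO D i) \<noteq> {}"
proof -
  have "\<forall>J :: ('s, 's) cat. \<forall>D x \<iota>.
        small_shape J \<and> filtered J \<and> is_functor J (coslice A (Dom A \<alpha>)) D \<and>
        is_colimit (coslice A (Dom A \<alpha>)) J D x \<iota> \<and> hom (coslice A (Dom A \<alpha>)) \<alpha> x \<noteq> {} \<longrightarrow>
        (\<exists>i\<in>Obj J. hom (coslice A (Dom A \<alpha>)) \<alpha> (FO D i) \<noteq> {})"
    by (rule iffD1[OF compact_in_coslice_epi_iff[OF assms(1,2,3)] assms(4)])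
  then show ?thesis using assms(5-) by blast
qed

lemma full_subcat_simps [simp]:
  "Obj (full_subcat J B) = B" "Dom (full_subcat J B) = Dom J" "Cod (full_subcat J B) = Cod J"
  "Ident (full_subcat J B) = Ident J" "Comp (full_subcat J B) = Comp J"
  "Arr (full_subcat J B) = {u \<in> Arr J. Dom J u \<in> B \<and> Cod J u \<in> B}"
  by (simp_all add: full_subcat_def)

lemma hom_full_subcat: "hom (full_subcat J B) i j = (if i \<in> B \<and> j \<in> B then hom J i j else {})"
  by (auto simp: hom_def)

lemma category_full_subcat:
  assumes "category J" and B: "B \<subseteq> Obj J"
  shows "category (full_subcat J B)"
proof -
  interpret category J by fact
  show ?thesis
  proof
    fix f g h w x y z
    assume "f \<in> hom (full_subcat J B) w x" "g \<in> hom (full_subcat J B) x y" "h \<in> hom (full_subcat J B) y z"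
    then show "Comp (full_subcat J B) h (Comp (full_subcat J B) g f) =
        Comp (full_subcat J B) (Comp (full_subcat J B) h g) f"
      by (auto simp: hom_full_subcat split: if_splits intro: Comp_assoc)
  qed (use B in \<open>auto simp: hom_full_subcat split: if_splits
      intro: Comp_hom Ident_hom Ident_left Ident_right\<close>)
qed

lemma small_shape_full_subcat:
  assumes "small_shape J" and "B \<subseteq> Obj J"
  shows "small_shape (full_subcat J B)"
proof -
  have "Arr (full_subcat J B) \<lesssim> Arr J" by (rule subset_imp_lepoll) auto
  then show ?thesis
    using assms category_full_subcat unfolding small_shape_def by (blast intro: lesspoll_trans1)
qed

lemma filtered_full_subcat:
  assumes J: "filtered J" and B: "B \<subseteq> Obj J" "B \<noteq> {}"
    and up: "\<And>i j. i \<in> B \<Longrightarrow> hom J i j \<noteq> {} \<Longrightarrow> j \<in> B"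
  shows "filtered (full_subcat J B)"
  unfolding filtered_def
proof (intro conjI ballI impI)
  show "Obj (full_subcat J B) \<noteq> {}" using B by simp
  fix i j assume ij: "i \<in> Obj (full_subcat J B)" "j \<in> Obj (full_subcat J B)"
  then have "i \<in> Obj J" "j \<in> Obj J" using B by auto
  then obtain k where k: "k \<in> Obj J" "hom J i k \<noteq> {}" "hom J j k \<noteq> {}"
    using J unfolding filtered_def by blast
  then have "k \<in> B" using up ij by simp
  then show "\<exists>k\<in>Obj (full_subcat J B). hom (full_subcat J B) i k \<noteq> {} \<and> hom (full_subcat J B) j k \<noteq> {}"
    using k ij by (auto simp: hom_full_subcat)
next
  fix u v assume uv: "u \<in> Arr (full_subcat J B)" "v \<in> Arr (full_subcat J B)"
    "Dom (full_subcat J B) u = Dom (full_subcat J B) v \<and> Cod (full_subcat J B) u = Cod (full_subcat J B) v"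
  then have "u \<in> Arr J" "v \<in> Arr J" "Dom J u = Dom J v \<and> Cod J u = Cod J v" by simp_all
  then obtain w where w: "w \<in> Arr J" "Dom J w = Cod J u" "Comp J w u = Comp J w v"
    using J[unfolded filtered_def, THEN conjunct2, THEN conjunct2, rule_format, of u v] by blast
  have "w \<in> hom J (Cod J u) (Cod J w)" using w by (simp add: hom_def)
  then have "Cod J w \<in> B" using up[of "Cod J u" "Cod J w"] uv by auto
  then show "\<exists>w\<in>Arr (full_subcat J B). Dom (full_subcat J B) w = Cod (full_subcat J B) u \<and>
      Comp (full_subcat J B) w u = Comp (full_subcat J B) w v"
    using w uv by (intro bexI[of _ w]) auto
qed

text \<open>
  An upward closed nonempty part of a filtered category is final: every index has an arrow into it, and
  a cocone on the part extends along such arrows.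
\<close>

lemma is_colimit_full_subcat:
  assumes K: "category K" and J: "category J" "filtered J" and D: "is_functor J K D"
    and B: "B \<subseteq> Obj J" "B \<noteq> {}" and up: "\<And>i j. i \<in> B \<Longrightarrow> hom J i j \<noteq> {} \<Longrightarrow> j \<in> B"
    and colim: "is_colimit K J D x \<iota>"
  shows "is_colimit K (full_subcat J B) D x \<iota>"
proof -
  interpret K: category K by fact
  interpret J: category J by fact
  note DA = is_functorD(2)[OF D] and DC = is_functorD(4)[OF D]
  note co = colim[unfolded is_colimit_iff, THEN conjunct1]
    and univ = colim[unfolded is_colimit_iff, THEN conjunct2, rule_format]
  have x: "x \<in> Obj K" and \<iota>: "\<And>i. i \<in> Obj J \<Longrightarrow> \<iota> i \<in> hom K (FO D i) x"
    and \<iota>D: "\<And>u. u \<in> Arr J \<Longrightarrow> Comp K (\<iota> (Cod J u)) (FM D u) = \<iota> (Dom J u)"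
    using co by blast+
  have BJ: "i \<in> Obj J" if "i \<in> B" for i using that B by blast
  have reach: "\<exists>k\<in>B. hom J i k \<noteq> {}" if i: "i \<in> Obj J" for i
  proof -
    obtain i0 where i0: "i0 \<in> B" using B by blast
    obtain k where "k \<in> Obj J" "hom J i k \<noteq> {}" "hom J i0 k \<noteq> {}"
      using J(2) i BJ[OF i0] unfolding filtered_def by blast
    then show ?thesis using up i0 by blast
  qed
  have "\<exists>!h. h \<in> hom K x y \<and> (\<forall>i\<in>B. Comp K h (\<iota> i) = \<rho> i)"
    if y: "y \<in> Obj K" and \<rho>: "\<And>i. i \<in> B \<Longrightarrow> \<rho> i \<in> hom K (FO D i) y"
      and \<rho>D: "\<And>u. u \<in> Arr (full_subcat J B) \<Longrightarrow> Comp K (\<rho> (Cod J u)) (FM D u) = \<rho> (Dom J u)" for y \<rho>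
  proof -
    have \<rho>D: "Comp K (\<rho> j) (FM D u) = \<rho> i" if "u \<in> hom J i j" "i \<in> B" "j \<in> B" for u i j
      using \<rho>D[of u] that by (simp add: hom_def)
    \<comment> \<open>The value of the extended cocone at an index outside \<open>B\<close> does not depend on the arrow into \<open>B\<close>
      that is used to define it: two such arrows become equal further on.\<close>
    have \<rho>_unique: "Comp K (\<rho> k) (FM D u) = Comp K (\<rho> k') (FM D u')"
      if u: "u \<in> hom J i k" "k \<in> B" and u': "u' \<in> hom J i k'" "k' \<in> B" for i k k' u u'
    proof -
      obtain l v v' where v: "v \<in> hom J k l" "v' \<in> hom J k' l"
        using J(2) BJ[OF u(2)] BJ[OF u'(2)] unfolding filtered_def by blast
      have "Comp J v u \<in> hom J i l" "Comp J v' u' \<in> hom J i l"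
        using J.Comp_hom[OF u(1) v(1)] J.Comp_hom[OF u'(1) v(2)] by simp_all
      then obtain w where w: "w \<in> Arr J" "Dom J w = l" "Comp J w (Comp J v u) = Comp J w (Comp J v' u')"
        using J(2) unfolding filtered_def hom_def by fastforce
      define m where "m = Cod J w"
      have wh: "w \<in> hom J l m" using w by (simp add: hom_def m_def)
      have wv: "Comp J w v \<in> hom J k m" "Comp J w v' \<in> hom J k' m"
        using J.Comp_hom[OF v(1) wh] J.Comp_hom[OF v(2) wh] by simp_all
      have mB: "m \<in> B" using up[OF u(2)] wv(1) by blast
      have e: "Comp J (Comp J w v) u = Comp J (Comp J w v') u'"
        using J.Comp_assoc[OF u(1) v(1) wh] J.Comp_assoc[OF u'(1) v(2) wh] w(3) by simp
      have "Comp K (\<rho> k) (FM D u) = Comp K (\<rho> m) (FM D (Comp J (Comp J w v) u))"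
        using \<rho>D[OF wv(1) u(2) mB] DC[OF u(1) wv(1)] K.Comp_assoc[OF DA[OF u(1)] DA[OF wv(1)] \<rho>[OF mB]] by simp
      also have "\<dots> = Comp K (\<rho> k') (FM D u')"
        unfolding e using \<rho>D[OF wv(2) u'(2) mB] DC[OF u'(1) wv(2)]
          K.Comp_assoc[OF DA[OF u'(1)] DA[OF wv(2)] \<rho>[OF mB]] by simp
      finally show ?thesis .
    qed
    have "\<exists>s. \<forall>k u. k \<in> B \<longrightarrow> u \<in> hom J i k \<longrightarrow> s = Comp K (\<rho> k) (FM D u)" if i: "i \<in> Obj J" for i
    proof -
      obtain k0 u0 where k0: "u0 \<in> hom J i k0" "k0 \<in> B" using reach[OF i] by blast
      show ?thesis
        by (intro exI[of _ "Comp K (\<rho> k0) (FM D u0)"] allI impI) (rule \<rho>_unique[OF k0])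
    qed
    then obtain \<sigma> where \<sigma>: "\<And>i k u. i \<in> Obj J \<Longrightarrow> k \<in> B \<Longrightarrow> u \<in> hom J i k \<Longrightarrow> \<sigma> i = Comp K (\<rho> k) (FM D u)"
      by metis
    have \<sigma>hom: "\<sigma> i \<in> hom K (FO D i) y" if i: "i \<in> Obj J" for i
    proof -
      obtain k u where k: "k \<in> B" "u \<in> hom J i k" using reach[OF i] by blast
      show ?thesis unfolding \<sigma>[OF i k] by (rule K.Comp_hom[OF DA[OF k(2)] \<rho>[OF k(1)]])
    qed
    have \<sigma>D: "Comp K (\<sigma> (Cod J u)) (FM D u) = \<sigma> (Dom J u)" if u: "u \<in> Arr J" for u
    proof -
      have uh: "u \<in> hom J (Dom J u) (Cod J u)" using u by (simp add: hom_def)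
      have o: "Dom J u \<in> Obj J" "Cod J u \<in> Obj J" using u by simp_all
      obtain k v where k: "k \<in> B" "v \<in> hom J (Cod J u) k" using reach[OF o(2)] by blast
      show ?thesis
        unfolding \<sigma>[OF o(2) k] \<sigma>[OF o(1) k(1) J.Comp_hom[OF uh k(2)]] DC[OF uh k(2)]
        by (rule K.Comp_assoc[OF DA[OF uh] DA[OF k(2)] \<rho>[OF k(1)], symmetric])
    qed
    have \<sigma>\<rho>: "\<sigma> i = \<rho> i" if i: "i \<in> B" for i
      using \<sigma>[OF BJ[OF i] i J.Ident_hom[OF BJ[OF i]]] is_functorD(3)[OF D BJ[OF i]] K.Ident_right[OF \<rho>[OF i]]
      by simp
    have ex1: "\<exists>!h. h \<in> hom K x y \<and> (\<forall>i\<in>Obj J. Comp K h (\<iota> i) = \<sigma> i)"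
      by (rule univ) (use y \<sigma>hom \<sigma>D in blast)
    have "(\<forall>i\<in>Obj J. Comp K h (\<iota> i) = \<sigma> i) \<longleftrightarrow> (\<forall>i\<in>B. Comp K h (\<iota> i) = \<rho> i)" if h: "h \<in> hom K x y" for h
    proof
      assume "\<forall>i\<in>Obj J. Comp K h (\<iota> i) = \<sigma> i"
      then show "\<forall>i\<in>B. Comp K h (\<iota> i) = \<rho> i" using BJ \<sigma>\<rho> by simp
    next
      assume *: "\<forall>i\<in>B. Comp K h (\<iota> i) = \<rho> i"
      show "\<forall>i\<in>Obj J. Comp K h (\<iota> i) = \<sigma> i"
      proof
        fix i assume i: "i \<in> Obj J"
        obtain k u where k: "k \<in> B" "u \<in> hom J i k" using reach[OF i] by blast
        have "\<iota> i = Comp K (\<iota> k) (FM D u)" using \<iota>D[of u] k(2) by (simp add: hom_def)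
        then show "Comp K h (\<iota> i) = \<sigma> i"
          using K.Comp_assoc[OF DA[OF k(2)] \<iota>[OF BJ[OF k(1)]] h] * k \<sigma>[OF i k] by simp
      qed
    qed
    then show ?thesis using ex1 by metis
  qed
  then show ?thesis
    unfolding is_colimit_iff full_subcat_simps(1,2,3) using x \<iota> \<iota>D BJ
    by (intro conjI allI impI ballI) auto
qed

text \<open>
  Precomposition with an epimorphism is a fully faithful functor from the coslice under its codomain.
\<close>

lemma hom_coslice_epi:
  assumes A: "category A" and \<alpha>: "\<alpha> \<in> Arr A" "is_epi A \<alpha>"
    and f: "f \<in> Arr A" "Dom A f = Cod A \<alpha>" and g: "g \<in> Arr A" "Dom A g = Cod A \<alpha>"
  shows "(f, h, g) \<in> hom (coslice A (Cod A \<alpha>)) f g \<longleftrightarrow>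
     (Comp A f \<alpha>, h, Comp A g \<alpha>) \<in> hom (coslice A (Dom A \<alpha>)) (Comp A f \<alpha>) (Comp A g \<alpha>)"
proof -
  interpret category A by fact
  have "Comp A h f = g \<longleftrightarrow> Comp A (Comp A h f) \<alpha> = Comp A g \<alpha>" if "h \<in> hom A (Cod A f) (Cod A g)"
  proof
    assume "Comp A (Comp A h f) \<alpha> = Comp A g \<alpha>"
    then show "Comp A h f = g"
      by (rule is_epiD[OF \<alpha>(2) A, rotated -1]) (use that f g in \<open>auto simp: hom_def\<close>)
  qed simp
  then show ?thesis
    unfolding hom_coslice using f g \<alpha>(1) by (auto simp: hom_def)
qed

text \<open>
  A fully faithful functor, here precomposition with \<open>\<alpha>\<close>, reflects colimits.
\<close>

lemma is_colimit_coslice_epi: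
  assumes A: "category A" and \<alpha>: "\<alpha> \<in> Arr A" "is_epi A \<alpha>"
    and D: "is_functor J (coslice A (Dom A \<alpha>)) D" and D': "is_functor J (coslice A (Cod A \<alpha>)) D'"
    and \<gamma>: "\<gamma> \<in> Arr A" "Dom A \<gamma> = Cod A \<alpha>"
    and DO: "\<And>i. i \<in> Obj J \<Longrightarrow> FO D i = Comp A (FO D' i) \<alpha>"
    and DA: "\<And>u. u \<in> Arr J \<Longrightarrow> und (FM D u) = und (FM D' u)"
    and J: "category J" and colim: "is_colimit (coslice A (Dom A \<alpha>)) J D (Comp A \<gamma> \<alpha>) \<iota>"
  shows "is_colimit (coslice A (Cod A \<alpha>)) J D' \<gamma> (\<lambda>i. (FO D' i, und (\<iota> i), \<gamma>))"
proof -
  interpret category A by fact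
  interpret J: category J by fact
  define a b where "a = Dom A \<alpha>" and "b = Cod A \<alpha>"
  note hom_epi = hom_coslice_epi[OF A \<alpha>, folded a_def b_def]
  note co = colim[unfolded is_colimit_iff, THEN conjunct1]
    and univ = colim[unfolded is_colimit_iff, THEN conjunct2, rule_format]
  have D'i: "FO D' i \<in> Arr A" "Dom A (FO D' i) = b" if "i \<in> Obj J" for i
    using is_functorD(1)[OF D' that] by (simp_all add: b_def)
  have \<gamma>b: "\<gamma> \<in> Arr A" "Dom A \<gamma> = b" using \<gamma> by (simp_all add: b_def)
  have D'u: "FM D' u = (FO D' (Dom J u), und (FM D' u), FO D' (Cod J u))" if u: "u \<in> Arr J" for u
    using is_functorD(2)[OF D', of u "Dom J u" "Cod J u"] u
    unfolding hom_coslice by (simp add: hom_def)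
  have \<iota>: "\<iota> i = (FO D i, und (\<iota> i), Comp A \<gamma> \<alpha>)" "(FO D i, und (\<iota> i), Comp A \<gamma> \<alpha>) \<in> hom (coslice A a) (FO D i) (Comp A \<gamma> \<alpha>)"
    if i: "i \<in> Obj J" for i
  proof -
    have h: "\<iota> i \<in> hom (coslice A a) (FO D i) (Comp A \<gamma> \<alpha>)" using co i by (simp add: a_def)
    then show 1: "\<iota> i = (FO D i, und (\<iota> i), Comp A \<gamma> \<alpha>)" unfolding hom_coslice by blast
    show "(FO D i, und (\<iota> i), Comp A \<gamma> \<alpha>) \<in> hom (coslice A a) (FO D i) (Comp A \<gamma> \<alpha>)"
      using h unfolding 1[symmetric] .
  qed
  have \<iota>D: "Comp A (und (\<iota> (Cod J u))) (und (FM D' u)) = und (\<iota> (Dom J u))" if "u \<in> Arr J" for u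
    using arg_cong[OF co[THEN conjunct2, THEN conjunct2, rule_format, OF that], of und] DA[OF that] by simp
  have lift: "\<exists>!h. h \<in> hom (coslice A b) \<gamma> y \<and> (\<forall>i\<in>Obj J. Comp (coslice A b) h (FO D' i, und (\<iota> i), \<gamma>) = \<rho> i)"
    if y: "y \<in> Arr A" "Dom A y = b" and \<rho>: "\<And>i. i \<in> Obj J \<Longrightarrow> \<rho> i \<in> hom (coslice A b) (FO D' i) y"
      and \<rho>D: "\<And>u. u \<in> Arr J \<Longrightarrow> Comp (coslice A b) (\<rho> (Cod J u)) (FM D' u) = \<rho> (Dom J u)" for y \<rho>
  proof -
    have \<rho>_eq: "\<rho> i = (FO D' i, und (\<rho> i), y)" if "i \<in> Obj J" for i
      using \<rho>[OF that] unfolding hom_coslice by blast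
    define \<sigma> where "\<sigma> i = (FO D i, und (\<rho> i), Comp A y \<alpha>)" for i
    have "\<sigma> i \<in> hom (coslice A a) (FO D i) (Comp A y \<alpha>)" if i: "i \<in> Obj J" for i
      using \<rho>[OF i] unfolding \<sigma>_def DO[OF i]
      by (subst (asm) \<rho>_eq[OF i]) (simp only: hom_epi[OF D'i[OF i] y])
    moreover have "Comp (coslice A a) (\<sigma> (Cod J u)) (FM D u) = \<sigma> (Dom J u)" if u: "u \<in> Arr J" for u
    proof -
      have "FM D u \<in> hom (coslice A a) (FO D (Dom J u)) (FO D (Cod J u))"
        using is_functorD(2)[OF D, of u] u by (simp add: a_def hom_def)
      then have "FM D u = (FO D (Dom J u), und (FM D u), FO D (Cod J u))" unfolding hom_coslice by blast
      then have "fst (FM D u) = FO D (Dom J u)" by (metis fst_conv)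
      then show ?thesis
        using arg_cong[OF \<rho>D[OF u], of und] DA[OF u] by (simp add: \<sigma>_def)
    qed
    ultimately have ex1: "\<exists>!h. h \<in> hom (coslice A a) (Comp A \<gamma> \<alpha>) (Comp A y \<alpha>) \<and>
        (\<forall>i\<in>Obj J. Comp (coslice A a) h (\<iota> i) = \<sigma> i)"
      using univ[folded a_def, of "Comp A y \<alpha>" \<sigma>] y \<alpha>(1) by (simp add: a_def b_def)
    then obtain h where h: "h \<in> hom (coslice A a) (Comp A \<gamma> \<alpha>) (Comp A y \<alpha>)"
      and h\<iota>: "\<And>i. i \<in> Obj J \<Longrightarrow> Comp (coslice A a) h (\<iota> i) = \<sigma> i" by blast
    have h_eq: "h = (Comp A \<gamma> \<alpha>, und h, Comp A y \<alpha>)" using h unfolding hom_coslice by blast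
    have hb: "(\<gamma>, und h, y) \<in> hom (coslice A b) \<gamma> y"
      unfolding hom_epi[OF \<gamma>b y] using h by (subst h_eq[symmetric])
    show ?thesis
    proof (rule ex1I[of _ "(\<gamma>, und h, y)"], intro conjI ballI hb)
      fix i assume i: "i \<in> Obj J"
      show "Comp (coslice A b) (\<gamma>, und h, y) (FO D' i, und (\<iota> i), \<gamma>) = \<rho> i"
        using arg_cong[OF h\<iota>[OF i], of und] by (subst \<rho>_eq[OF i]) (simp add: \<sigma>_def)
    next
      fix g assume g: "g \<in> hom (coslice A b) \<gamma> y \<and>
        (\<forall>i\<in>Obj J. Comp (coslice A b) g (FO D' i, und (\<iota> i), \<gamma>) = \<rho> i)"
      then have g_eq: "g = (\<gamma>, und g, y)" unfolding hom_coslice by blast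
      have gb: "(\<gamma>, und g, y) \<in> hom (coslice A b) \<gamma> y" using g by (subst g_eq[symmetric]) blast
      define k where "k = (Comp A \<gamma> \<alpha>, und g, Comp A y \<alpha>)"
      have "k \<in> hom (coslice A a) (Comp A \<gamma> \<alpha>) (Comp A y \<alpha>)"
        using gb unfolding hom_epi[OF \<gamma>b y] k_def .
      moreover have "Comp (coslice A a) k (\<iota> i) = \<sigma> i" if i: "i \<in> Obj J" for i
      proof -
        have "Comp (coslice A b) g (FO D' i, und (\<iota> i), \<gamma>) = \<rho> i" using g i by blast
        from arg_cong[OF this, of und] have "Comp A (und g) (und (\<iota> i)) = und (\<rho> i)" by simp
        moreover have "fst (\<iota> i) = FO D i" using arg_cong[OF \<iota>(1)[OF i], of fst] by simp
        ultimately show ?thesis by (simp add: k_def \<sigma>_def)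
      qed
      ultimately have "k = h" using ex1 h h\<iota> by blast
      then have "und g = und h" by (auto simp: k_def)
      then show "g = (\<gamma>, und h, y)" using g_eq by simp
    qed
  qed
  show ?thesis
    unfolding is_colimit_iff b_def[symmetric]
  proof (intro conjI allI impI ballI)
    show "\<gamma> \<in> Obj (coslice A b)" using \<gamma>b by simp
    show "(FO D' i, und (\<iota> i), \<gamma>) \<in> hom (coslice A b) (FO D' i) \<gamma>" if i: "i \<in> Obj J" for i
      unfolding hom_epi[OF D'i[OF i] \<gamma>b] using \<iota>(2)[OF i] by (simp only: DO[OF i])
    show "Comp (coslice A b) (FO D' (Cod J u), und (\<iota> (Cod J u)), \<gamma>) (FM D' u) =
        (FO D' (Dom J u), und (\<iota> (Dom J u)), \<gamma>)" if u: "u \<in> Arr J" for u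
      using \<iota>D[OF u] by (subst D'u[OF u]) simp
    fix y \<rho>
    assume *: "y \<in> Obj (coslice A b) \<and> (\<forall>i\<in>Obj J. \<rho> i \<in> hom (coslice A b) (FO D' i) y) \<and>
      (\<forall>u\<in>Arr J. Comp (coslice A b) (\<rho> (Cod J u)) (FM D' u) = \<rho> (Dom J u))"
    then have "y \<in> Arr A" "Dom A y = b" by simp_all
    then show "\<exists>!h. h \<in> hom (coslice A b) \<gamma> y \<and>
        (\<forall>i\<in>Obj J. Comp (coslice A b) h (FO D' i, und (\<iota> i), \<gamma>) = \<rho> i)"
      by (rule lift) (use * in blast)+
  qed
qed

text \<open>
  A map from the codomain of \<open>\<beta>\<close> to a filtered colimit \<open>x\<close> under \<open>a\<close> restricts to a map from \<open>b\<close>, so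
  finite type of \<open>\<alpha>\<close> provides an index whose object lies under \<open>b\<close>.  The indices of this kind form a
  final part \<open>B\<close> of the diagram; on it the diagram lifts to the coslice under \<open>b\<close>, still with colimit
  \<open>x\<close>, and finite type of \<open>\<beta>\<close> applies to the lifted diagram.
\<close>

lemma compact_in_coslice_Comp:
  fixes A :: "('o, 'm, 'z) cat_scheme"
  assumes A: "category A" and \<alpha>: "\<alpha> \<in> Arr A" "is_epi A \<alpha>" and \<beta>: "\<beta> \<in> Arr A" "is_epi A \<beta>"
    and \<alpha>\<beta>: "Cod A \<alpha> = Dom A \<beta>"
    and c\<alpha>: "compact_in_coslice TYPE('s) A \<alpha>" and c\<beta>: "compact_in_coslice TYPE('s) A \<beta>"
  shows "compact_in_coslice TYPE('s) A (Comp A \<beta> \<alpha>)"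
proof -
  interpret category A by fact
  define a b where "a = Dom A \<alpha>" and "b = Dom A \<beta>"
  have ab: "a \<in> Obj A" "b \<in> Obj A" "Dom A (Comp A \<beta> \<alpha>) = a" "Cod A \<alpha> = b" "Dom A \<alpha> = a" "Dom A \<beta> = b"
    using \<alpha> \<beta> \<alpha>\<beta> by (simp_all add: a_def b_def)
  note K = category_coslice[OF A ab(1)] and K' = category_coslice[OF A ab(2)]
  have \<beta>\<alpha>: "Comp A \<beta> \<alpha> \<in> Arr A" "Cod A (Comp A \<beta> \<alpha>) = Cod A \<beta>" using \<alpha> \<beta> \<alpha>\<beta> by simp_all
  have "is_epi A (Comp A \<beta> \<alpha>)"
    using is_mono_Comp[OF category_op_cat[OF A], of \<beta> \<alpha>] \<alpha> \<beta> \<alpha>\<beta> by (simp add: is_epi_def)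
  note epi\<alpha> = is_epiD[OF \<alpha>(2) A, unfolded ab]
  have "\<exists>i\<in>Obj J. hom (coslice A a) (Comp A \<beta> \<alpha>) (FO D i) \<noteq> {}"
    if J: "small_shape J" "filtered J" and D: "is_functor J (coslice A a) D"
      and colim: "is_colimit (coslice A a) J D x \<iota>" and ne: "hom (coslice A a) (Comp A \<beta> \<alpha>) x \<noteq> {}"
    for J :: "('s, 's) cat" and D x \<iota>
  proof -
    have catJ: "category J" using J by (simp add: small_shape_def)
    interpret J: category J by fact
    have Di: "FO D i \<in> Arr A" "Dom A (FO D i) = a" if "i \<in> Obj J" for i
      using is_functorD(1)[OF D that] by simp_all
    have Du: "und (FM D u) \<in> hom A (Cod A (FO D i)) (Cod A (FO D j))" "Comp A (und (FM D u)) (FO D i) = FO D j"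
      if "u \<in> hom J i j" for u i j
      using is_functorD(2)[OF D that] unfolding hom_coslice by blast+
    have x: "x \<in> Arr A" "Dom A x = a" using colim by (simp_all add: is_colimit_iff)
    obtain \<delta>' where "\<delta>' \<in> hom (coslice A a) (Comp A \<beta> \<alpha>) x" using ne by blast
    then obtain \<delta> where \<delta>: "\<delta> \<in> hom A (Cod A \<beta>) (Cod A x)" "Comp A \<delta> (Comp A \<beta> \<alpha>) = x"
      unfolding hom_coslice using \<beta>\<alpha> by auto
    define \<gamma> where "\<gamma> = Comp A \<delta> \<beta>"
    have \<gamma>: "\<gamma> \<in> Arr A" "Dom A \<gamma> = b" "Cod A \<gamma> = Cod A x" "Comp A \<gamma> \<alpha> = x"
      unfolding \<gamma>_def using \<delta> \<alpha> \<beta> \<alpha>\<beta> ab by (auto simp: hom_def)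
    \<comment> \<open>The indices at which the diagram receives an arrow from \<open>b\<close>, necessarily a unique one.\<close>
    define B where "B = {i \<in> Obj J. \<exists>\<phi> \<in> hom A b (Cod A (FO D i)). Comp A \<phi> \<alpha> = FO D i}"
    define \<phi> where "\<phi> i = (SOME \<phi>. \<phi> \<in> hom A b (Cod A (FO D i)) \<and> Comp A \<phi> \<alpha> = FO D i)" for i
    have \<phi>: "\<phi> i \<in> hom A b (Cod A (FO D i))" "Comp A (\<phi> i) \<alpha> = FO D i" if i: "i \<in> B" for i
    proof -
      have "\<exists>\<phi>. \<phi> \<in> hom A b (Cod A (FO D i)) \<and> Comp A \<phi> \<alpha> = FO D i" using i by (auto simp: B_def)
      from someI_ex[OF this] show "\<phi> i \<in> hom A b (Cod A (FO D i))" "Comp A (\<phi> i) \<alpha> = FO D i"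
        unfolding \<phi>_def by blast+
    qed
    have \<phi>': "\<phi> i \<in> Arr A" "Dom A (\<phi> i) = b" "Cod A (\<phi> i) = Cod A (FO D i)" if "i \<in> B" for i
      using \<phi>[OF that] by (simp_all add: hom_def)
    have BJ: "B \<subseteq> Obj J" by (auto simp: B_def)
    have B_up: "j \<in> B" and \<phi>D: "Comp A (und (FM D u)) (\<phi> i) = \<phi> j" if u: "u \<in> hom J i j" and i: "i \<in> B" for u i j
    proof -
      have j: "j \<in> Obj J" using u by (auto simp: hom_def)
      have c: "Comp A (und (FM D u)) (\<phi> i) \<in> hom A b (Cod A (FO D j))" by (rule Comp_hom[OF \<phi>(1)[OF i] Du(1)[OF u]])
      have e: "Comp A (Comp A (und (FM D u)) (\<phi> i)) \<alpha> = FO D j"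
        using Comp_assoc[of \<alpha> a b "\<phi> i" "Cod A (FO D i)" "und (FM D u)" "Cod A (FO D j)"]
          \<phi>[OF i] Du[OF u] \<alpha> ab by (simp add: hom_def)
      show jB: "j \<in> B" using j c e by (auto simp: B_def)
      show "Comp A (und (FM D u)) (\<phi> i) = \<phi> j"
        by (rule epi\<alpha>[OF c \<phi>(1)[OF jB]]) (simp add: e \<phi>(2)[OF jB])
    qed
    have up: "j \<in> B" if "i \<in> B" "hom J i j \<noteq> {}" for i j using B_up that by blast
    have "(\<alpha>, \<gamma>, x) \<in> hom (coslice A a) \<alpha> x" unfolding hom_coslice using \<gamma> \<alpha> x ab by (simp add: hom_def)
    then have "\<exists>i\<in>Obj J. hom (coslice A a) \<alpha> (FO D i) \<noteq> {}"
      using compact_in_coslice_epiD[OF A \<alpha> c\<alpha> J, unfolded ab(5), OF D colim] by blast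
    then have "B \<noteq> {}" unfolding B_def hom_coslice by (auto simp: ab hom_coslice)
    define J' where "J' = full_subcat J B"
    have J': "small_shape J'" "filtered J'" "category J'"
      unfolding J'_def
      by (rule small_shape_full_subcat[OF J(1) BJ], rule filtered_full_subcat[OF J(2) BJ \<open>B \<noteq> {}\<close> up],
          assumption+, rule category_full_subcat[OF catJ BJ])
    have DJ': "is_functor J' (coslice A a) D"
      using D BJ unfolding is_functor_def J'_def by auto
    have colimB: "is_colimit (coslice A a) J' D (Comp A \<gamma> \<alpha>) \<iota>"
      unfolding \<gamma>(4) J'_def by (rule is_colimit_full_subcat[OF K catJ J(2) D BJ \<open>B \<noteq> {}\<close> up colim])
    define D' where "D' = \<lparr>FO = \<phi>, FM = (\<lambda>u. (\<phi> (Dom J u), und (FM D u), \<phi> (Cod J u)))\<rparr>"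
    have D'_simps: "FO D' = \<phi>" "FM D' u = (\<phi> (Dom J u), und (FM D u), \<phi> (Cod J u))" for u by (simp_all add: D'_def)
    have D': "is_functor J' (coslice A b) D'"
      unfolding is_functor_def
    proof (intro conjI ballI impI)
      fix i assume "i \<in> Obj J'"
      then have i: "i \<in> B" "i \<in> Obj J" using BJ by (auto simp: J'_def)
      show "FO D' i \<in> Obj (coslice A b)" using \<phi>'[OF i(1)] by (simp add: D'_simps)
      show "FM D' (Ident J' i) = Ident (coslice A b) (FO D' i)"
        using i \<phi>'[OF i(1)] is_functorD(3)[OF D i(2)] by (simp add: D'_simps J'_def)
    next
      fix u assume "u \<in> Arr J'"
      then have u: "u \<in> hom J (Dom J u) (Cod J u)" "Dom J u \<in> B" "Cod J u \<in> B" by (simp_all add: J'_def hom_def)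
      then show "FM D' u \<in> hom (coslice A b) (FO D' (Dom J' u)) (FO D' (Cod J' u))"
        unfolding hom_coslice using \<phi>'[OF u(2)] \<phi>'[OF u(3)] Du(1)[OF u(1)] \<phi>D[OF u(1,2)]
        by (simp add: D'_simps J'_def)
    next
      fix u v assume uv: "u \<in> Arr J'" "v \<in> Arr J'" "Cod J' u = Dom J' v"
      then show "FM D' (Comp J' v u) = Comp (coslice A b) (FM D' v) (FM D' u)"
        using is_functorD(4)[OF D, of u "Dom J u" "Cod J u" v "Cod J v"] by (simp add: J'_def D'_simps hom_def)
    qed
    have colim': "is_colimit (coslice A b) J' D' \<gamma> (\<lambda>i. (FO D' i, und (\<iota> i), \<gamma>))"
      using is_colimit_coslice_epi[OF A \<alpha>, of J' D D' \<gamma> \<iota>] DJ' D' \<gamma> colimB J' \<phi>(2)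
      by (simp add: ab D'_simps J'_def)
    have "(\<beta>, \<delta>, \<gamma>) \<in> hom (coslice A b) \<beta> \<gamma>"
      unfolding hom_coslice using \<beta> ab \<gamma> \<delta> by (simp add: \<gamma>_def)
    then have "\<exists>j\<in>Obj J'. hom (coslice A b) \<beta> (FO D' j) \<noteq> {}"
      using compact_in_coslice_epiD[OF A \<beta> c\<beta> J'(1,2), unfolded ab(6), OF D' colim'] by blast
    then obtain j \<psi>' where j: "j \<in> B" and "\<psi>' \<in> hom (coslice A b) \<beta> (\<phi> j)" by (auto simp: J'_def D'_simps)
    then have \<psi>: "und \<psi>' \<in> hom A (Cod A \<beta>) (Cod A (FO D j))" "Comp A (und \<psi>') \<beta> = \<phi> j"
      unfolding hom_coslice \<phi>'(3)[OF j] by blast+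
    have jJ: "j \<in> Obj J" using j BJ by blast
    have "\<alpha> \<in> hom A a b" "\<beta> \<in> hom A b (Cod A \<beta>)" using \<alpha> \<beta> ab by (simp_all add: hom_def)
    from Comp_assoc[OF this \<psi>(1)] have "Comp A (und \<psi>') (Comp A \<beta> \<alpha>) = FO D j" using \<psi>(2) \<phi>(2)[OF j] by simp
    then have "(Comp A \<beta> \<alpha>, und \<psi>', FO D j) \<in> hom (coslice A a) (Comp A \<beta> \<alpha>) (FO D j)"
      unfolding hom_coslice using \<psi>(1) \<beta>\<alpha> Di[OF jJ] ab by simp
    then show ?thesis using jJ by blast
  qed
  then show ?thesis
    unfolding compact_in_coslice_epi_iff[OF A \<beta>\<alpha>(1) \<open>is_epi A (Comp A \<beta> \<alpha>)\<close>] ab(3) by blast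
qed

lemma finite_type_iff: "finite_type S C \<alpha> \<longleftrightarrow> \<alpha> \<in> Arr (Comm C) \<and> compact_in_coslice S (Comm C) \<alpha>"
  by (simp add: finite_type_def compact_in_coslice_def)

lemma spectral_immersion_Comp:
  assumes C: "symmetric_monoidal C" and M: "left_actegory C M"
    and \<alpha>: "spectral_immersion TYPE('s) C M \<alpha>" and \<beta>: "spectral_immersion TYPE('s) C M \<beta>"
    and \<alpha>\<beta>: "Cod (Comm C) \<alpha> = Dom (Comm C) \<beta>"
  shows "spectral_immersion TYPE('s) C M (Comp (Comm C) \<beta> \<alpha>)"
proof -
  note K = category_Comm[OF C]
  interpret category "Comm C" by (rule K)
  have Arr: "\<alpha> \<in> Arr (Comm C)" "\<beta> \<in> Arr (Comm C)" using \<alpha> \<beta> by (simp_all add: spectral_immersion_def flat_def)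
  have epi: "is_epi (Comm C) \<alpha>" "is_epi (Comm C) \<beta>" using \<alpha> \<beta> by (simp_all add: spectral_immersion_def)
  have "is_epi (Comm C) (Comp (Comm C) \<beta> \<alpha>)"
    using is_mono_Comp[OF category_op_cat[OF K], of \<beta> \<alpha>] epi \<alpha>\<beta> by (simp add: is_epi_def)
  moreover have "flat C M (Comp (Comm C) \<beta> \<alpha>)"
    using \<alpha> \<beta> by (intro flat_Comp[OF C M _ _ \<alpha>\<beta>]) (simp_all add: spectral_immersion_def)
  moreover have "compact_in_coslice TYPE('s) (Comm C) (Comp (Comm C) \<beta> \<alpha>)"
    using \<alpha> \<beta> by (intro compact_in_coslice_Comp[OF K Arr(1) epi(1) Arr(2) epi(2) \<alpha>\<beta>])
      (simp_all add: spectral_immersion_def finite_type_iff)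
  ultimately show ?thesis
    using Arr \<alpha>\<beta> by (simp add: spectral_immersion_def finite_type_iff)
qed

section \<open>The topology generated by a class of families\<close>

text \<open>
  Each axiom of a topology is inherited by intersections.
\<close>

lemma generated_topology_grothendieck:
  assumes "category A"
  shows "grothendieck_topology A (generated_topology A cov)"
proof -
  interpret category A by fact
  define G where "G = generated_topology A cov"
  have G: "S \<in> G x \<longleftrightarrow> sieve A x S \<and> (\<forall>T. grothendieck_topology A T \<and>
     (\<forall>y\<in>Obj A. \<forall>\<Phi>. cov y \<Phi> \<longrightarrow> generated_sieve A \<Phi> \<in> T y) \<longrightarrow> S \<in> T x)" for x S
    by (simp add: G_def generated_topology_def)
  have pb: "sieve A (Dom A h) (pullback_sieve A h S)" if "sieve A (Cod A h) S" "h \<in> Arr A" for h S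
    using that by (auto simp: sieve_def pullback_sieve_def)

  have "grothendieck_topology A G"
    unfolding grothendieck_topology_def
  proof (intro conjI ballI allI impI)
    fix x S assume "x \<in> Obj A" "S \<in> G x" then show "sieve A x S" by (simp add: G)
  next
    fix x assume x: "x \<in> Obj A"
    have "sieve A x {f \<in> Arr A. Cod A f = x}" by (auto simp: sieve_def)
    then show "{f \<in> Arr A. Cod A f = x} \<in> G x"
      using x by (simp add: G grothendieck_topology_def)
  next
    fix h S assume h: "h \<in> Arr A" "S \<in> G (Cod A h)"
    show "pullback_sieve A h S \<in> G (Dom A h)"
      unfolding G
    proof (intro conjI allI impI)
      show "sieve A (Dom A h) (pullback_sieve A h S)" using h by (intro pb) (simp_all add: G)
      fix T assume "grothendieck_topology A T \<and>
        (\<forall>y\<in>Obj A. \<forall>\<Phi>. cov y \<Phi> \<longrightarrow> generated_sieve A \<Phi> \<in> T y)"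
      moreover from this have "S \<in> T (Cod A h)" using h by (simp add: G)
      ultimately show "pullback_sieve A h S \<in> T (Dom A h)"
        using h(1) by (simp add: grothendieck_topology_def)
    qed
  next
    fix x S R assume x: "x \<in> Obj A" "S \<in> G x"
      and R: "sieve A x R \<and> (\<forall>h\<in>S. pullback_sieve A h R \<in> G (Dom A h))"
    show "R \<in> G x"
      unfolding G
    proof (intro conjI allI impI)
      show "sieve A x R" using R by blast
      fix T assume T: "grothendieck_topology A T \<and>
        (\<forall>y\<in>Obj A. \<forall>\<Phi>. cov y \<Phi> \<longrightarrow> generated_sieve A \<Phi> \<in> T y)"
      have "S \<in> T x" using x T by (simp add: G)
      moreover have "\<forall>h\<in>S. pullback_sieve A h R \<in> T (Dom A h)"
        using R T by (simp add: G)
      ultimately show "R \<in> T x" using x(1) R T unfolding grothendieck_topology_def by blast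
    qed
  qed
  then show ?thesis by (simp add: G_def)
qed

lemma generated_topology_mono:
  assumes "\<And>y \<Phi>. cov y \<Phi> \<Longrightarrow> cov' y \<Phi>"
  shows "generated_topology A cov x \<subseteq> generated_topology A cov' x"
  using assms by (auto simp: generated_topology_def)

lemma is_sheaf_mono:
  assumes "is_sheaf A T F" "\<And>x. T' x \<subseteq> T x"
  shows "is_sheaf A T' F"
  unfolding is_sheaf_def
proof (intro conjI ballI allI impI)
  show "is_functor (op_cat A) SET F" using assms(1) by (simp add: is_sheaf_def)
next
  fix x S s assume x: "x \<in> Obj A" and S: "S \<in> T' x" and s: "(\<forall>f\<in>S. s f \<in> FO F (Dom A f)) \<and>
        (\<forall>f\<in>S. \<forall>g\<in>Arr A. Cod A g = Dom A f \<longrightarrow> und (FM F g) (s f) = s (Comp A f g))"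
  have "S \<in> T x" using S assms(2) by blast
  from assms(1)[unfolded is_sheaf_def, THEN conjunct2, rule_format, OF x this s]
  show "\<exists>!t. t \<in> FO F x \<and> (\<forall>f\<in>S. und (FM F f) t = s f)" .
qed


section \<open>Local truth and sheaves\<close>

locale site = category A for A :: "('o, 'm, 'z) cat_scheme" (structure) +
  fixes T :: "'o \<Rightarrow> 'm set set"
  assumes topology: "grothendieck_topology A T"
begin

lemmas topology_axioms = topology[unfolded grothendieck_topology_def]

lemma covering_sieve: "x \<in> Obj A \<Longrightarrow> S \<in> T x \<Longrightarrow> sieve A x S"
  using topology_axioms[THEN conjunct1] by blast

lemma covering_max: "x \<in> Obj A \<Longrightarrow> {f \<in> Arr A. Cod A f = x} \<in> T x"
  using topology_axioms[THEN conjunct2, THEN conjunct1] by blast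

lemma covering_pull: "h \<in> Arr A \<Longrightarrow> S \<in> T (Cod A h) \<Longrightarrow> pullback_sieve A h S \<in> T (Dom A h)"
  using topology_axioms[THEN conjunct2, THEN conjunct2, THEN conjunct1] by blast

lemma covering_trans:
  assumes "x \<in> Obj A" "S \<in> T x" "sieve A x R" "\<And>h. h \<in> S \<Longrightarrow> pullback_sieve A h R \<in> T (Dom A h)"
  shows "R \<in> T x"
  using topology_axioms[THEN conjunct2, THEN conjunct2, THEN conjunct2, rule_format, of x S R] assms
  by blast

text \<open>
  A sieve is represented by a predicate on arrows.  Covering arguments then become arguments about
  statements that hold locally: these can be pulled back, are closed under conjunction, and hold locally
  if they hold locally on a covering.
\<close>

definition locally :: "'o \<Rightarrow> ('m \<Rightarrow> bool) \<Rightarrow> bool" where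
  "locally x P \<longleftrightarrow> {h \<in> Arr A. Cod A h = x \<and> P h} \<in> T x"

definition stable :: "'o \<Rightarrow> ('m \<Rightarrow> bool) \<Rightarrow> bool" where
  "stable x P \<longleftrightarrow> (\<forall>h\<in>Arr A. Cod A h = x \<and> P h \<longrightarrow> (\<forall>k\<in>Arr A. Cod A k = Dom A h \<longrightarrow> P (h \<cdot> k)))"

lemma stableI:
  "(\<And>h k. h \<in> Arr A \<Longrightarrow> Cod A h = x \<Longrightarrow> P h \<Longrightarrow> k \<in> Arr A \<Longrightarrow> Cod A k = Dom A h \<Longrightarrow> P (h \<cdot> k)) \<Longrightarrow> stable x P"
  by (auto simp: stable_def)

lemma stableD:
  "stable x P \<Longrightarrow> h \<in> Arr A \<Longrightarrow> Cod A h = x \<Longrightarrow> P h \<Longrightarrow> k \<in> Arr A \<Longrightarrow> Cod A k = Dom A h \<Longrightarrow> P (h \<cdot> k)"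
  by (auto simp: stable_def)

lemma locally_stable: "x \<in> Obj A \<Longrightarrow> locally x P \<Longrightarrow> stable x P"
  unfolding locally_def by (drule (1) covering_sieve) (auto simp: sieve_def stable_def)

lemma locally_pull:
  assumes "h \<in> Arr A" "locally (Cod A h) P"
  shows "locally (Dom A h) (\<lambda>k. P (h \<cdot> k))"
proof -
  have "pullback_sieve A h {k \<in> Arr A. Cod A k = Cod A h \<and> P k} \<in> T (Dom A h)"
    using assms by (simp add: locally_def covering_pull)
  moreover have "pullback_sieve A h {k \<in> Arr A. Cod A k = Cod A h \<and> P k}
      = {k \<in> Arr A. Cod A k = Dom A h \<and> P (h \<cdot> k)}"
    using assms(1) by (auto simp: pullback_sieve_def)
  ultimately show ?thesis by (simp add: locally_def)
qed

lemma locally_trans: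
  assumes x: "x \<in> Obj A" and Q: "stable x Q" and P: "locally x P"
    and PQ: "\<And>h. h \<in> Arr A \<Longrightarrow> Cod A h = x \<Longrightarrow> P h \<Longrightarrow> locally (Dom A h) (\<lambda>k. Q (h \<cdot> k))"
  shows "locally x Q"
proof -
  let ?S = "{h \<in> Arr A. Cod A h = x \<and> P h}" and ?R = "{h \<in> Arr A. Cod A h = x \<and> Q h}"
  have "sieve A x ?R" using Q by (auto simp: sieve_def stable_def)
  moreover have "pullback_sieve A h ?R \<in> T (Dom A h)" if "h \<in> ?S" for h
  proof -
    have "pullback_sieve A h ?R = {k \<in> Arr A. Cod A k = Dom A h \<and> Q (h \<cdot> k)}"
      using that by (auto simp: pullback_sieve_def)
    then show ?thesis using PQ[of h] that by (simp add: locally_def)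
  qed
  moreover have "?S \<in> T x" using P by (simp add: locally_def)
  ultimately show ?thesis
    unfolding locally_def by (intro covering_trans[OF x, of ?S ?R])
qed

lemma locally_all:
  assumes "x \<in> Obj A" "\<And>h. h \<in> Arr A \<Longrightarrow> Cod A h = x \<Longrightarrow> P h"
  shows "locally x P"
proof -
  have "{f \<in> Arr A. Cod A f = x} = {h \<in> Arr A. Cod A h = x \<and> P h}" using assms(2) by auto
  then show ?thesis using covering_max[OF assms(1)] by (simp add: locally_def)
qed

lemma locally_mono:
  assumes x: "x \<in> Obj A" and P: "locally x P" and Q: "stable x Q"
    and PQ: "\<And>h. h \<in> Arr A \<Longrightarrow> Cod A h = x \<Longrightarrow> P h \<Longrightarrow> Q h"
  shows "locally x Q"
  by (rule locally_trans[OF x Q P], rule locally_all) (use PQ stableD[OF Q] in auto)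

lemma locally_cong:
  assumes "\<And>h. h \<in> Arr A \<Longrightarrow> Cod A h = x \<Longrightarrow> P h = Q h"
  shows "locally x P = locally x Q"
proof -
  have "{h \<in> Arr A. Cod A h = x \<and> P h} = {h \<in> Arr A. Cod A h = x \<and> Q h}" using assms by auto
  then show ?thesis by (simp add: locally_def)
qed

lemma locally_conj:
  assumes x: "x \<in> Obj A" and P: "locally x P" and Q: "locally x Q"
  shows "locally x (\<lambda>h. P h \<and> Q h)"
proof (rule locally_trans[OF x _ P])
  note sP = locally_stable[OF x P] and sQ = locally_stable[OF x Q]
  show "stable x (\<lambda>h. P h \<and> Q h)" using sP sQ by (auto simp: stable_def)
  fix h assume h: "h \<in> Arr A" "Cod A h = x" "P h"
  have "locally (Dom A h) (\<lambda>k. Q (h \<cdot> k))" using locally_pull[OF h(1)] h(2) Q by simp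
  then show "locally (Dom A h) (\<lambda>k. P (h \<cdot> k) \<and> Q (h \<cdot> k))"
    using stableD[OF sP h] by (subst locally_cong[where Q = "\<lambda>k. Q (h \<cdot> k)"]) auto
qed

text \<open>
  Here sections may have any type, so that sheaves can be built from pairs of sections and from sets of
  germs before their sections are encoded in the universe \<open>'u\<close>.
\<close>

definition set_presheaf :: "('o \<Rightarrow> 'v set) \<Rightarrow> ('m \<Rightarrow> 'v \<Rightarrow> 'v) \<Rightarrow> bool" where
  "set_presheaf X r \<longleftrightarrow> (\<forall>f\<in>Arr A. \<forall>s\<in>X (Cod A f). r f s \<in> X (Dom A f)) \<and>
     (\<forall>x\<in>Obj A. \<forall>s\<in>X x. r (Ident A x) s = s) \<and>
     (\<forall>f\<in>Arr A. \<forall>g\<in>Arr A. Cod A g = Dom A f \<longrightarrow> (\<forall>s\<in>X (Cod A f). r (f \<cdot> g) s = r g (r f s)))"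

definition set_sheaf :: "('o \<Rightarrow> 'v set) \<Rightarrow> ('m \<Rightarrow> 'v \<Rightarrow> 'v) \<Rightarrow> bool" where
  "set_sheaf X r \<longleftrightarrow> set_presheaf X r \<and>
     (\<forall>x\<in>Obj A. \<forall>s\<in>X x. \<forall>t\<in>X x. locally x (\<lambda>h. r h s = r h t) \<longrightarrow> s = t) \<and>
     (\<forall>x\<in>Obj A. \<forall>P m. locally x P \<longrightarrow>
        (\<forall>h\<in>Arr A. Cod A h = x \<and> P h \<longrightarrow>
           m h \<in> X (Dom A h) \<and> (\<forall>k\<in>Arr A. Cod A k = Dom A h \<longrightarrow> r k (m h) = m (h \<cdot> k))) \<longrightarrow>
        (\<exists>t\<in>X x. \<forall>h\<in>Arr A. Cod A h = x \<and> P h \<longrightarrow> r h t = m h))"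

lemma set_sheafI:
  assumes "set_presheaf X r"
    and "\<And>x s t. x \<in> Obj A \<Longrightarrow> s \<in> X x \<Longrightarrow> t \<in> X x \<Longrightarrow> locally x (\<lambda>h. r h s = r h t) \<Longrightarrow> s = t"
    and "\<And>x P m. x \<in> Obj A \<Longrightarrow> locally x P \<Longrightarrow>
        \<forall>h\<in>Arr A. Cod A h = x \<and> P h \<longrightarrow>
           m h \<in> X (Dom A h) \<and> (\<forall>k\<in>Arr A. Cod A k = Dom A h \<longrightarrow> r k (m h) = m (h \<cdot> k)) \<Longrightarrow>
        \<exists>t\<in>X x. \<forall>h\<in>Arr A. Cod A h = x \<and> P h \<longrightarrow> r h t = m h"
  shows "set_sheaf X r"
  unfolding set_sheaf_def
  by (intro conjI ballI allI impI; (rule assms(1) | rule assms(2) | rule assms(3)); assumption?)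

lemma set_presheafD:
  assumes "set_presheaf X r"
  shows "f \<in> Arr A \<Longrightarrow> s \<in> X (Cod A f) \<Longrightarrow> r f s \<in> X (Dom A f)"
    "x \<in> Obj A \<Longrightarrow> s \<in> X x \<Longrightarrow> r (Ident A x) s = s"
    "f \<in> Arr A \<Longrightarrow> g \<in> Arr A \<Longrightarrow> Cod A g = Dom A f \<Longrightarrow> s \<in> X (Cod A f) \<Longrightarrow> r (f \<cdot> g) s = r g (r f s)"
  using assms unfolding set_presheaf_def by blast+

lemma set_sheaf_presheaf: "set_sheaf X r \<Longrightarrow> set_presheaf X r"
  by (simp add: set_sheaf_def)

lemma set_sheaf_separated:
  "set_sheaf X r \<Longrightarrow> x \<in> Obj A \<Longrightarrow> s \<in> X x \<Longrightarrow> t \<in> X x \<Longrightarrow> locally x (\<lambda>h. r h s = r h t) \<Longrightarrow> s = t"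
  unfolding set_sheaf_def by blast

lemma set_sheaf_glue:
  assumes "set_sheaf X r" "x \<in> Obj A" "locally x P"
    and "\<And>h. h \<in> Arr A \<Longrightarrow> Cod A h = x \<Longrightarrow> P h \<Longrightarrow> m h \<in> X (Dom A h)"
    and "\<And>h k. h \<in> Arr A \<Longrightarrow> Cod A h = x \<Longrightarrow> P h \<Longrightarrow> k \<in> Arr A \<Longrightarrow> Cod A k = Dom A h
           \<Longrightarrow> r k (m h) = m (h \<cdot> k)"
  obtains t where "t \<in> X x" "\<And>h. h \<in> Arr A \<Longrightarrow> Cod A h = x \<Longrightarrow> P h \<Longrightarrow> r h t = m h"
proof -
  have "\<exists>t\<in>X x. \<forall>h\<in>Arr A. Cod A h = x \<and> P h \<longrightarrow> r h t = m h"
    using assms(1)[unfolded set_sheaf_def, THEN conjunct2, THEN conjunct2, rule_format, OF assms(2,3), of m]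
      assms(4,5) by blast
  then show ?thesis using that by blast
qed

lemma locally_eq_stable:
  assumes X: "set_presheaf X r" and st: "s \<in> X x" "t \<in> X x"
  shows "stable x (\<lambda>h. r h s = r h t)"
  by (rule stableI) (use st in \<open>auto simp: set_presheafD(3)[OF X]\<close>)

lemma set_sheaf_eqI:
  assumes X: "set_sheaf X r" and x: "x \<in> Obj A" "s \<in> X x" "t \<in> X x" and P: "locally x P"
    and eq: "\<And>h. h \<in> Arr A \<Longrightarrow> Cod A h = x \<Longrightarrow> P h \<Longrightarrow> r h s = r h t"
  shows "s = t"
proof (rule set_sheaf_separated[OF X x])
  show "locally x (\<lambda>h. r h s = r h t)"
    by (rule locally_mono[OF x(1) P locally_eq_stable]) (use x eq set_sheaf_presheaf[OF X] in auto)
qed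

text \<open>
  The map \<open>e\<close> encodes sections by other values; the sheaf conditions mention sections only up to bijection.
\<close>

lemma set_sheaf_transport:
  assumes X: "set_sheaf X r" and de: "\<And>z s. z \<in> Obj A \<Longrightarrow> s \<in> X z \<Longrightarrow> d (e s) = s"
  shows "set_sheaf (\<lambda>z. e ` X z) (\<lambda>f s. e (r f (d s)))"
proof -
  note pX = set_presheafD[OF set_sheaf_presheaf[OF X]]
  have de': "f \<in> Arr A \<Longrightarrow> s \<in> X (Cod A f) \<Longrightarrow> d (e s) = s"
    "f \<in> Arr A \<Longrightarrow> s \<in> X (Dom A f) \<Longrightarrow> d (e s) = s" for f s
    using de[of "Cod A f" s] de[of "Dom A f" s] by simp_all
  have einj: "z \<in> Obj A \<Longrightarrow> s \<in> X z \<Longrightarrow> t \<in> X z \<Longrightarrow> e s = e t \<longleftrightarrow> s = t" for z s t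
    using de by metis
  have "set_presheaf (\<lambda>z. e ` X z) (\<lambda>f s. e (r f (d s)))"
    unfolding set_presheaf_def by (auto simp: de' de pX)
  moreover have "s = t" if x: "x \<in> Obj A" and s: "s \<in> e ` X x" and t: "t \<in> e ` X x"
      and l: "locally x (\<lambda>h. e (r h (d s)) = e (r h (d t)))" for x s t
  proof -
    obtain s' t' where st: "s = e s'" "t = e t'" "s' \<in> X x" "t' \<in> X x" using s t by blast
    have "locally x (\<lambda>h. r h s' = r h t')"
    proof (subst locally_cong)
      fix h assume "h \<in> Arr A" "Cod A h = x"
      then show "(r h s' = r h t') = (e (r h (d s)) = e (r h (d t)))"
        using st x by (simp add: de einj[of "Dom A h"] pX)
    qed (rule l)
    then show "s = t" using set_sheaf_separated[OF X x] st by auto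
  qed
  moreover have "\<exists>t\<in>e ` X x. \<forall>h\<in>Arr A. Cod A h = x \<and> P h \<longrightarrow> e (r h (d t)) = m h"
    if x: "x \<in> Obj A" and P: "locally x P"
      and m: "\<forall>h\<in>Arr A. Cod A h = x \<and> P h \<longrightarrow> m h \<in> e ` X (Dom A h) \<and>
               (\<forall>k\<in>Arr A. Cod A k = Dom A h \<longrightarrow> e (r k (d (m h))) = m (h \<cdot> k))" for x P m
  proof -
    have em: "e (d (m h)) = m h" "d (m h) \<in> X (Dom A h)" if "h \<in> Arr A" "Cod A h = x" "P h" for h
      using m that de'(2)[OF that(1)] by (metis imageE)+
    obtain t where t: "t \<in> X x" "\<And>h. h \<in> Arr A \<Longrightarrow> Cod A h = x \<Longrightarrow> P h \<Longrightarrow> r h t = d (m h)"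
    proof (rule set_sheaf_glue[OF X x P, where m = "\<lambda>h. d (m h)"])
      fix h k assume h: "h \<in> Arr A" "Cod A h = x" "P h" "k \<in> Arr A" "Cod A k = Dom A h"
      then show "r k (d (m h)) = d (m (h \<cdot> k))"
        using m em(2)[OF h(1-3)] by (metis de' pX(1))
    qed (use em in auto)
    have "\<forall>h\<in>Arr A. Cod A h = x \<and> P h \<longrightarrow> e (r h (d (e t))) = m h"
      using t x em by (auto simp: de)
    then show ?thesis using t(1) by blast
  qed
  ultimately show ?thesis by (rule set_sheafI)
qed

lemma set_sheaf_sub:
  assumes X: "set_sheaf X r" and YX: "\<And>z. z \<in> Obj A \<Longrightarrow> Y z \<subseteq> X z"
    and res: "\<And>f s. f \<in> Arr A \<Longrightarrow> s \<in> Y (Cod A f) \<Longrightarrow> r f s \<in> Y (Dom A f)"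
    and loc: "\<And>z s. z \<in> Obj A \<Longrightarrow> s \<in> X z \<Longrightarrow> locally z (\<lambda>h. r h s \<in> Y (Dom A h)) \<Longrightarrow> s \<in> Y z"
  shows "set_sheaf Y r"
proof -
  note pX = set_presheafD[OF set_sheaf_presheaf[OF X]]
  have YX': "f \<in> Arr A \<Longrightarrow> s \<in> Y (Cod A f) \<Longrightarrow> s \<in> X (Cod A f)" for f s
    using YX[of "Cod A f"] by auto
  have "set_presheaf Y r"
    unfolding set_presheaf_def
    by (intro conjI ballI impI) (simp_all add: res YX' pX subsetD[OF YX])
  moreover have "s = t" if "x \<in> Obj A" "s \<in> Y x" "t \<in> Y x" "locally x (\<lambda>h. r h s = r h t)" for x s t
    using set_sheaf_separated[OF X that(1) _ _ that(4)] YX[OF that(1)] that(2,3) by blast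
  moreover have "\<exists>t\<in>Y x. \<forall>h\<in>Arr A. Cod A h = x \<and> P h \<longrightarrow> r h t = m h"
    if x: "x \<in> Obj A" and P: "locally x P"
      and m: "\<forall>h\<in>Arr A. Cod A h = x \<and> P h \<longrightarrow> m h \<in> Y (Dom A h) \<and>
               (\<forall>k\<in>Arr A. Cod A k = Dom A h \<longrightarrow> r k (m h) = m (h \<cdot> k))" for x P m
  proof -
    obtain t where t: "t \<in> X x" "\<And>h. h \<in> Arr A \<Longrightarrow> Cod A h = x \<Longrightarrow> P h \<Longrightarrow> r h t = m h"
      by (rule set_sheaf_glue[OF X x P, of m]) (use m in \<open>auto intro: subsetD[OF YX[OF Dom_Obj]]\<close>)
    have "stable x (\<lambda>h. r h t \<in> Y (Dom A h))"
      by (rule stableI) (use t x res in \<open>auto simp: pX\<close>)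
    then have "locally x (\<lambda>h. r h t \<in> Y (Dom A h))"
      by (rule locally_mono[OF x P]) (use t(2) m in auto)
    then show ?thesis using loc[OF x t(1)] t(2) by blast
  qed
  ultimately show ?thesis by (rule set_sheafI)
qed

definition presheaf_of :: "('o \<Rightarrow> 'u set) \<Rightarrow> ('m \<Rightarrow> 'u \<Rightarrow> 'u) \<Rightarrow> ('o, 'm, 'u) presheaf" where
  "presheaf_of X r = \<lparr>FO = X, FM = (\<lambda>f. (X (Cod A f), (\<lambda>s \<in> X (Cod A f). r f s), X (Dom A f)))\<rparr>"

definition res :: "('o, 'm, 'u) presheaf \<Rightarrow> 'm \<Rightarrow> 'u \<Rightarrow> 'u" where
  "res F f s = und (FM F f) s"

lemma presheaf_of_simps [simp]:
  "FO (presheaf_of X r) = X"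
  "s \<in> X (Cod A f) \<Longrightarrow> res (presheaf_of X r) f s = r f s"
  by (simp_all add: presheaf_of_def res_def und_def)

lemma SET_hom: "f \<in> hom SET X Y \<longleftrightarrow> f = (X, und f, Y) \<and> und f \<in> X \<rightarrow>\<^sub>E Y"
  by (cases f) (auto simp: hom_def SET_def und_def)

lemma is_functor_presheaf:
  assumes F: "is_functor (op_cat A) SET F"
  shows "set_presheaf (FO F) (res F)"
    "f \<in> Arr A \<Longrightarrow> FM F f = (FO F (Cod A f), restrict (res F f) (FO F (Cod A f)), FO F (Dom A f))"
proof -
  have h: "FM F f = (FO F (Cod A f), und (FM F f), FO F (Dom A f)) \<and>
      und (FM F f) \<in> FO F (Cod A f) \<rightarrow>\<^sub>E FO F (Dom A f)" if "f \<in> Arr A" for f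
    using F that by (auto simp: is_functor_def SET_hom)
  show "FM F f = (FO F (Cod A f), restrict (res F f) (FO F (Cod A f)), FO F (Dom A f))"
    if "f \<in> Arr A" for f
    using h[OF that] by (auto simp: res_def[abs_def] PiE_restrict)
  have i: "FM F (Ident A x) = Ident SET (FO F x)" if "x \<in> Obj A" for x
    using F that by (auto simp: is_functor_def)
  have c: "FM F (f \<cdot> g) = Comp SET (FM F g) (FM F f)" if "f \<in> Arr A" "g \<in> Arr A" "Cod A g = Dom A f" for f g
    using F that by (auto simp: is_functor_def)
  have fst: "fst (FM F f) = FO F (Cod A f)" if "f \<in> Arr A" for f
    using h[OF that] by (metis fst_conv)
  show "set_presheaf (FO F) (res F)"
    unfolding set_presheaf_def
  proof (intro conjI ballI impI)
    fix f s assume "f \<in> Arr A" "s \<in> FO F (Cod A f)"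
    then show "res F f s \<in> FO F (Dom A f)" using h[of f] by (auto simp: res_def)
  next
    fix x s assume "x \<in> Obj A" "s \<in> FO F x"
    then show "res F (Ident A x) s = s" by (simp add: res_def i SET_def und_def)
  next
    fix f g s assume "f \<in> Arr A" "g \<in> Arr A" "Cod A g = Dom A f" "s \<in> FO F (Cod A f)"
    then show "res F (f \<cdot> g) s = res F g (res F f s)"
      unfolding res_def by (simp add: c, simp add: SET_def und_def fst[unfolded und_def] compose_def)
  qed
qed

lemma presheaf_of_functor:
  assumes X: "set_presheaf X r"
  shows "is_functor (op_cat A) SET (presheaf_of X r)"
  unfolding is_functor_def
proof (intro conjI ballI impI)
  note pX = set_presheafD[OF X]
  show "FO (presheaf_of X r) x \<in> Obj SET" for x by (simp add: SET_def)
  show "FM (presheaf_of X r) f \<in> hom SET (FO (presheaf_of X r) (Dom (op_cat A) f))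
      (FO (presheaf_of X r) (Cod (op_cat A) f))" if "f \<in> Arr (op_cat A)" for f
    using that by (auto simp: SET_hom presheaf_of_def und_def pX)
  show "FM (presheaf_of X r) (Ident (op_cat A) x) = Ident SET (FO (presheaf_of X r) x)"
    if "x \<in> Obj (op_cat A)" for x
    using that by (auto simp: presheaf_of_def SET_def pX restrict_def fun_eq_iff)
  show "FM (presheaf_of X r) (Comp (op_cat A) g f) =
      Comp SET (FM (presheaf_of X r) g) (FM (presheaf_of X r) f)"
    if "f \<in> Arr (op_cat A)" "g \<in> Arr (op_cat A)" "Cod (op_cat A) f = Dom (op_cat A) g" for f g
    using that pX(1)[of f] by (auto simp: presheaf_of_def SET_def und_def pX restrict_def compose_def fun_eq_iff)
qed

lemma is_sheaf_iff:
  "is_sheaf A T F \<longleftrightarrow> is_functor (op_cat A) SET F \<and> set_sheaf (FO F) (res F)"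
proof (cases "is_functor (op_cat A) SET F")
  case True
  note P = is_functor_presheaf(1)[OF True] note pF = set_presheafD[OF P]
  show ?thesis
  proof
    assume F: "is_sheaf A T F"
    have ex1: "\<exists>!t. t \<in> FO F x \<and> (\<forall>h\<in>Arr A. Cod A h = x \<and> P h \<longrightarrow> res F h t = m h)"
      if x: "x \<in> Obj A" and P: "locally x P"
      and m: "\<forall>h\<in>Arr A. Cod A h = x \<and> P h \<longrightarrow> m h \<in> FO F (Dom A h) \<and>
               (\<forall>k\<in>Arr A. Cod A k = Dom A h \<longrightarrow> res F k (m h) = m (h \<cdot> k))" for x P m
    proof -
      let ?S = "{h \<in> Arr A. Cod A h = x \<and> P h}"
      have "?S \<in> T x" using P by (simp add: locally_def)
      moreover have "(\<forall>f\<in>?S. m f \<in> FO F (Dom A f)) \<and>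
        (\<forall>f\<in>?S. \<forall>g\<in>Arr A. Cod A g = Dom A f \<longrightarrow> und (FM F g) (m f) = m (f \<cdot> g))"
        using m by (auto simp: res_def)
      ultimately have "\<exists>!t. t \<in> FO F x \<and> (\<forall>f\<in>?S. und (FM F f) t = m f)"
        using F[unfolded is_sheaf_def, THEN conjunct2, rule_format, OF x, of ?S m] by blast
      then show ?thesis by (simp add: res_def Ball_def imp_conjL)
    qed
    have "set_sheaf (FO F) (res F)"
      unfolding set_sheaf_def
    proof (intro conjI ballI allI impI P)
      fix x s t assume x: "x \<in> Obj A" "s \<in> FO F x" "t \<in> FO F x"
        and l: "locally x (\<lambda>h. res F h s = res F h t)"
      show "s = t"
        using ex1[OF x(1) l, of "\<lambda>h. res F h s"] x by (auto simp: pF)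
    next
      fix x P m assume *: "x \<in> Obj A" "locally x P" "\<forall>h\<in>Arr A. Cod A h = x \<and> P h \<longrightarrow> m h \<in> FO F (Dom A h) \<and>
               (\<forall>k\<in>Arr A. Cod A k = Dom A h \<longrightarrow> res F k (m h) = m (h \<cdot> k))"
      show "\<exists>t\<in>FO F x. \<forall>h\<in>Arr A. Cod A h = x \<and> P h \<longrightarrow> res F h t = m h"
        using ex1[OF *] by blast
    qed
    then show "is_functor (op_cat A) SET F \<and> set_sheaf (FO F) (res F)" using True by simp
  next
    assume "is_functor (op_cat A) SET F \<and> set_sheaf (FO F) (res F)"
    then have F: "set_sheaf (FO F) (res F)" by simp
    show "is_sheaf A T F"
      unfolding is_sheaf_def
    proof (intro conjI True ballI allI impI)
      fix x S s assume x: "x \<in> Obj A" and S: "S \<in> T x" and s: "(\<forall>f\<in>S. s f \<in> FO F (Dom A f)) \<and>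
        (\<forall>f\<in>S. \<forall>g\<in>Arr A. Cod A g = Dom A f \<longrightarrow> und (FM F g) (s f) = s (f \<cdot> g))"
      have S': "S \<subseteq> {f \<in> Arr A. Cod A f = x}"
        using covering_sieve[OF x S] by (auto simp: sieve_def)
      then have "S = {h \<in> Arr A. Cod A h = x \<and> h \<in> S}" by auto
      then have l: "locally x (\<lambda>h. h \<in> S)" using S by (simp add: locally_def)
      obtain t where t: "t \<in> FO F x" "\<And>h. h \<in> Arr A \<Longrightarrow> Cod A h = x \<Longrightarrow> h \<in> S \<Longrightarrow> res F h t = s h"
        by (rule set_sheaf_glue[OF F x l, of s]) (use s in \<open>auto simp: res_def\<close>)
      show "\<exists>!t. t \<in> FO F x \<and> (\<forall>f\<in>S. und (FM F f) t = s f)"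
      proof (rule ex1I[of _ t])
        show "t \<in> FO F x \<and> (\<forall>f\<in>S. und (FM F f) t = s f)" using t S' by (auto simp: res_def)
        fix t' assume t': "t' \<in> FO F x \<and> (\<forall>f\<in>S. und (FM F f) t' = s f)"
        show "t' = t"
          by (rule set_sheaf_eqI[OF F x _ _ l]) (use t t' in \<open>auto simp: res_def\<close>)
      qed
    qed
  qed
qed (simp add: is_sheaf_def)

lemma presheaf_of_sheaf:
  assumes X: "set_sheaf X r"
  shows "is_sheaf A T (presheaf_of X r)"
proof -
  note pX = set_presheafD[OF set_sheaf_presheaf[OF X]]
  have P: "set_presheaf X (res (presheaf_of X r))"
    using is_functor_presheaf(1)[OF presheaf_of_functor[OF set_sheaf_presheaf[OF X]]] by simp
  have "set_sheaf X (res (presheaf_of X r))"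
    unfolding set_sheaf_def
  proof (intro conjI P ballI allI impI)
    fix x s t assume x: "x \<in> Obj A" "s \<in> X x" "t \<in> X x"
      and l: "locally x (\<lambda>h. res (presheaf_of X r) h s = res (presheaf_of X r) h t)"
    show "s = t"
      by (rule set_sheaf_eqI[OF X x l]) (use x in auto)
  next
    fix x P m assume x: "x \<in> Obj A" "locally x P"
      and m: "\<forall>h\<in>Arr A. Cod A h = x \<and> P h \<longrightarrow> m h \<in> X (Dom A h) \<and>
        (\<forall>k\<in>Arr A. Cod A k = Dom A h \<longrightarrow> res (presheaf_of X r) k (m h) = m (h \<cdot> k))"
    have m': "m h \<in> X (Dom A h)" "\<And>k. k \<in> Arr A \<Longrightarrow> Cod A k = Dom A h \<Longrightarrow> r k (m h) = m (h \<cdot> k)"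
      if h: "h \<in> Arr A" "Cod A h = x" "P h" for h
    proof -
      show 1: "m h \<in> X (Dom A h)" using m h by blast
      fix k assume k: "k \<in> Arr A" "Cod A k = Dom A h"
      then have "res (presheaf_of X r) k (m h) = m (h \<cdot> k)" using m h by blast
      then show "r k (m h) = m (h \<cdot> k)" using 1 k by simp
    qed
    obtain t where "t \<in> X x" "\<And>h. h \<in> Arr A \<Longrightarrow> Cod A h = x \<Longrightarrow> P h \<Longrightarrow> r h t = m h"
      using set_sheaf_glue[OF X x, of m] m' by blast
    then show "\<exists>t\<in>X x. \<forall>h\<in>Arr A. Cod A h = x \<and> P h \<longrightarrow> res (presheaf_of X r) h t = m h"
      by auto
  qed
  then show ?thesis
    using presheaf_of_functor[OF set_sheaf_presheaf[OF X]] by (simp add: is_sheaf_iff)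
qed

end

lemma infinite_times_self_eqpoll: "infinite A \<Longrightarrow> A \<times> A \<approx> A"
  using card_of_Times_infinite[of A A] card_of_mono1[of A A] by (auto simp: eqpoll_iff_card_of_ordIso)

lemma Pow_lepoll_mono: "A \<lesssim> B \<Longrightarrow> Pow A \<lesssim> Pow B"
  unfolding lepoll_def using inj_on_image_Pow image_Pow_mono by metis

context site
begin

section \<open>The category of sheaves in terms of sections\<close>

abbreviation Sheaves :: "(('o, 'm, 'u) presheaf, ('o, 'm, 'u) presheaf_arr) cat" where
  "Sheaves \<equiv> sheaf_cat A T"

definition app :: "('o, 'm, 'u) presheaf_arr \<Rightarrow> 'o \<Rightarrow> 'u \<Rightarrow> 'u" where
  "app \<eta> z s = und (und \<eta> z) s"

definition arr_of ::
  "('o, 'm, 'u) presheaf \<Rightarrow> ('o \<Rightarrow> 'u \<Rightarrow> 'u) \<Rightarrow> ('o, 'm, 'u) presheaf \<Rightarrow> ('o, 'm, 'u) presheaf_arr" where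
  "arr_of F t G = (F, (\<lambda>z\<in>Obj A. (FO F z, restrict (t z) (FO F z), FO G z)), G)"

lemma arr_of_ends: "fst (arr_of F t G) = F" "snd (snd (arr_of F t G)) = G"
  "und (arr_of F t G) = (\<lambda>z\<in>Obj A. (FO F z, restrict (t z) (FO F z), FO G z))"
  by (simp_all add: arr_of_def und_def)

lemma Sheaves_simps [simp]:
  "Obj Sheaves = {F. is_sheaf A T F}"
  "Dom Sheaves \<eta> = fst \<eta>" "Cod Sheaves \<eta> = snd (snd \<eta>)"
  by (simp_all add: sheaf_cat_def full_subcat_def functor_cat_def)

lemma Comp_Sheaves:
  "Comp Sheaves \<theta> \<eta> = (fst \<eta>, \<lambda>x\<in>Obj A. Comp SET (und \<theta> x) (und \<eta> x), snd (snd \<theta>))"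
  by (simp add: sheaf_cat_def full_subcat_def functor_cat_def)

lemma Arr_Sheaves:
  "\<eta> \<in> Arr Sheaves \<longleftrightarrow> is_sheaf A T (fst \<eta>) \<and> is_sheaf A T (snd (snd \<eta>)) \<and>
     natural_trans (op_cat A) SET (fst \<eta>) (und \<eta>) (snd (snd \<eta>))"
  by (cases \<eta>) (auto simp: sheaf_cat_def full_subcat_def functor_cat_def is_sheaf_def und_def)

lemma sheaf_functor: "is_sheaf A T F \<Longrightarrow> is_functor (op_cat A) SET F"
  by (simp add: is_sheaf_def)

lemma sheaf_set_sheaf: "is_sheaf A T F \<Longrightarrow> set_sheaf (FO F) (res F)"
  by (simp add: is_sheaf_iff)

lemma sheaf_res:
  assumes "is_sheaf A T F"
  shows "f \<in> Arr A \<Longrightarrow> s \<in> FO F (Cod A f) \<Longrightarrow> res F f s \<in> FO F (Dom A f)"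
    "x \<in> Obj A \<Longrightarrow> s \<in> FO F x \<Longrightarrow> res F (Ident A x) s = s"
    "f \<in> Arr A \<Longrightarrow> g \<in> Arr A \<Longrightarrow> Cod A g = Dom A f \<Longrightarrow> s \<in> FO F (Cod A f)
       \<Longrightarrow> res F (f \<cdot> g) s = res F g (res F f s)"
  using set_presheafD[OF set_sheaf_presheaf[OF sheaf_set_sheaf[OF assms]]] by blast+

lemma SET_Comp_eq:
  assumes "f = (X, restrict \<phi> X, Y)" "g = (Y, restrict \<psi> Y, Z)" "f' = (X, restrict \<phi>' X, Y')"
    "g' = (Y', restrict \<psi>' Y', Z)" "\<phi> ` X \<subseteq> Y" "\<phi>' ` X \<subseteq> Y'"
  shows "Comp SET g f = Comp SET g' f' \<longleftrightarrow> (\<forall>s\<in>X. \<psi> (\<phi> s) = \<psi>' (\<phi>' s))"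
proof -
  have 1: "Comp SET g f = (X, \<lambda>s\<in>X. \<psi> (\<phi> s), Z)"
    using assms by (auto simp: SET_def und_def compose_def restrict_def fun_eq_iff)
  have 2: "Comp SET g' f' = (X, \<lambda>s\<in>X. \<psi>' (\<phi>' s), Z)"
    using assms by (auto simp: SET_def und_def compose_def restrict_def fun_eq_iff)
  show ?thesis unfolding 1 2 by (auto simp: fun_eq_iff restrict_def)
qed

text \<open>
  That an arrow equals \<open>arr_of\<close> of its values says that its extensional components carry no further
  information; from here on arrows of sheaves are handled through their values on sections.
\<close>

lemma sheaf_hom_iff:
  "\<eta> \<in> hom Sheaves F G \<longleftrightarrow> is_sheaf A T F \<and> is_sheaf A T G \<and> \<eta> = arr_of F (app \<eta>) G \<and>
     (\<forall>z\<in>Obj A. \<forall>s\<in>FO F z. app \<eta> z s \<in> FO G z) \<and>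
     (\<forall>f\<in>Arr A. \<forall>s\<in>FO F (Cod A f). app \<eta> (Dom A f) (res F f s) = res G f (app \<eta> (Cod A f) s))"
    (is "?L \<longleftrightarrow> ?R")
proof -
  have nat: "Comp SET (FM G f) (und \<eta> (Cod A f)) = Comp SET (und \<eta> (Dom A f)) (FM F f) \<longleftrightarrow>
      (\<forall>s\<in>FO F (Cod A f). app \<eta> (Dom A f) (res F f s) = res G f (app \<eta> (Cod A f) s))"
    if F: "is_sheaf A T F" and G: "is_sheaf A T G" and f: "f \<in> Arr A"
      and \<eta>: "\<And>z. z \<in> Obj A \<Longrightarrow> und \<eta> z = (FO F z, restrict (app \<eta> z) (FO F z), FO G z)"
      "\<And>z s. z \<in> Obj A \<Longrightarrow> s \<in> FO F z \<Longrightarrow> app \<eta> z s \<in> FO G z" for f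
    by (subst SET_Comp_eq[OF \<eta>(1)[OF Dom_Cod_Obj(2)[OF f]] is_functor_presheaf(2)[OF sheaf_functor[OF G] f]
          is_functor_presheaf(2)[OF sheaf_functor[OF F] f] \<eta>(1)[OF Dom_Cod_Obj(1)[OF f]]])
      (use f \<eta>(2) sheaf_res(1)[OF F] in auto)
  show ?thesis
  proof
    assume L: ?L
    then have F: "is_sheaf A T F" and G: "is_sheaf A T G" and e: "\<eta> = (F, und \<eta>, G)"
      and n: "natural_trans (op_cat A) SET F (und \<eta>) G"
      by (cases \<eta>; auto simp: hom_def Arr_Sheaves und_def)+
    have c: "und \<eta> z = (FO F z, restrict (app \<eta> z) (FO F z), FO G z)"
      "s \<in> FO F z \<Longrightarrow> app \<eta> z s \<in> FO G z" if "z \<in> Obj A" for z s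
    proof -
      have "und \<eta> z \<in> hom SET (FO F z) (FO G z)" using n that by (simp add: natural_trans_def)
      then have h: "und \<eta> z = (FO F z, und (und \<eta> z), FO G z)" "und (und \<eta> z) \<in> FO F z \<rightarrow>\<^sub>E FO G z"
        unfolding SET_hom by auto
      show "und \<eta> z = (FO F z, restrict (app \<eta> z) (FO F z), FO G z)"
        using h by (simp add: app_def[abs_def] PiE_restrict)
      show "s \<in> FO F z \<Longrightarrow> app \<eta> z s \<in> FO G z" using h(2) by (auto simp: app_def)
    qed
    have "und \<eta> = (\<lambda>z\<in>Obj A. (FO F z, restrict (app \<eta> z) (FO F z), FO G z))"
      by (rule extensionalityI[where A = "Obj A"]) (use n c in \<open>auto simp: natural_trans_def\<close>)
    then have "\<eta> = arr_of F (app \<eta>) G" using e unfolding arr_of_def by metis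
    moreover have "\<forall>f\<in>Arr A. \<forall>s\<in>FO F (Cod A f). app \<eta> (Dom A f) (res F f s) = res G f (app \<eta> (Cod A f) s)"
    proof
      fix f assume f: "f \<in> Arr A"
      have "Comp SET (FM G f) (und \<eta> (Cod A f)) = Comp SET (und \<eta> (Dom A f)) (FM F f)"
        using n f by (simp add: natural_trans_def)
      then show "\<forall>s\<in>FO F (Cod A f). app \<eta> (Dom A f) (res F f s) = res G f (app \<eta> (Cod A f) s)"
        using nat[OF F G f c] by blast
    qed
    ultimately show ?R using F G c by simp
  next
    assume R: ?R
    then have F: "is_sheaf A T F" and G: "is_sheaf A T G" and e: "\<eta> = arr_of F (app \<eta>) G"
      and i: "\<And>z s. z \<in> Obj A \<Longrightarrow> s \<in> FO F z \<Longrightarrow> app \<eta> z s \<in> FO G z"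
      and n: "\<And>f. f \<in> Arr A \<Longrightarrow> \<forall>s\<in>FO F (Cod A f). app \<eta> (Dom A f) (res F f s) = res G f (app \<eta> (Cod A f) s)"
      by simp_all
    have fs: "fst \<eta> = F" "snd (snd \<eta>) = G"
      and u: "und \<eta> = (\<lambda>z\<in>Obj A. (FO F z, restrict (app \<eta> z) (FO F z), FO G z))"
      using arg_cong[OF e, of fst] arg_cong[OF e, of "\<lambda>e. snd (snd e)"] arg_cong[OF e, of und]
      unfolding arr_of_ends by this+
    have u': "und \<eta> z = (FO F z, restrict (app \<eta> z) (FO F z), FO G z)" if "z \<in> Obj A" for z
      using fun_cong[OF u, of z] that by simp
    have "natural_trans (op_cat A) SET F (und \<eta>) G"
      unfolding natural_trans_def
    proof (intro conjI ballI)
      show "und \<eta> \<in> extensional (Obj (op_cat A))" by (subst u) simp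
      fix z assume "z \<in> Obj (op_cat A)"
      then show "und \<eta> z \<in> hom SET (FO F z) (FO G z)"
        using i unfolding SET_hom by (auto simp: u')
    next
      fix f assume "f \<in> Arr (op_cat A)"
      then have f: "f \<in> Arr A" by simp
      show "Comp SET (FM G f) (und \<eta> (Dom (op_cat A) f)) = Comp SET (und \<eta> (Cod (op_cat A) f)) (FM F f)"
        using nat[OF F G f u' i] n[OF f] by simp
    qed
    then show ?L using F G fs by (simp add: hom_def Arr_Sheaves)
  qed
qed

lemma sheaf_homD:
  assumes "\<eta> \<in> hom Sheaves F G"
  shows "is_sheaf A T F" "is_sheaf A T G" "\<eta> = arr_of F (app \<eta>) G"
    "z \<in> Obj A \<Longrightarrow> s \<in> FO F z \<Longrightarrow> app \<eta> z s \<in> FO G z"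
    "f \<in> Arr A \<Longrightarrow> s \<in> FO F (Cod A f) \<Longrightarrow> app \<eta> (Dom A f) (res F f s) = res G f (app \<eta> (Cod A f) s)"
proof -
  note R = assms[unfolded sheaf_hom_iff]
  show "is_sheaf A T F" "is_sheaf A T G" "\<eta> = arr_of F (app \<eta>) G"
    by (rule R[THEN conjunct1] R[THEN conjunct2, THEN conjunct1]
      R[THEN conjunct2, THEN conjunct2, THEN conjunct1])+
  note R' = R[THEN conjunct2, THEN conjunct2, THEN conjunct2]
  show "z \<in> Obj A \<Longrightarrow> s \<in> FO F z \<Longrightarrow> app \<eta> z s \<in> FO G z"
    by (rule R'[THEN conjunct1, rule_format])
  show "f \<in> Arr A \<Longrightarrow> s \<in> FO F (Cod A f) \<Longrightarrow> app \<eta> (Dom A f) (res F f s) = res G f (app \<eta> (Cod A f) s)"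
    by (rule R'[THEN conjunct2, rule_format])
qed

lemma app_arr_of [simp]: "z \<in> Obj A \<Longrightarrow> s \<in> FO F z \<Longrightarrow> app (arr_of F t G) z s = t z s"
  by (simp add: app_def arr_of_def und_def)

lemma arr_of_cong:
  assumes "\<And>z s. z \<in> Obj A \<Longrightarrow> s \<in> FO F z \<Longrightarrow> t z s = t' z s"
  shows "arr_of F t G = arr_of F t' G"
  using assms unfolding arr_of_def by (auto simp: restrict_def fun_eq_iff)

lemma arr_of_hom:
  assumes "is_sheaf A T F" "is_sheaf A T G" "\<And>z s. z \<in> Obj A \<Longrightarrow> s \<in> FO F z \<Longrightarrow> t z s \<in> FO G z"
    and "\<And>f s. f \<in> Arr A \<Longrightarrow> s \<in> FO F (Cod A f) \<Longrightarrow> t (Dom A f) (res F f s) = res G f (t (Cod A f) s)"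
  shows "arr_of F t G \<in> hom Sheaves F G"
proof -
  have "arr_of F t G = arr_of F (app (arr_of F t G)) G" by (rule arr_of_cong) simp
  then show ?thesis
    unfolding sheaf_hom_iff using assms(1,2,3,4) sheaf_res(1)[OF assms(1)] by simp
qed

lemma sheaf_hom_eqI:
  assumes "\<eta> \<in> hom Sheaves F G" "\<theta> \<in> hom Sheaves F G"
    "\<And>z s. z \<in> Obj A \<Longrightarrow> s \<in> FO F z \<Longrightarrow> app \<eta> z s = app \<theta> z s"
  shows "\<eta> = \<theta>"
proof -
  have "\<eta> = arr_of F (app \<eta>) G" by (rule sheaf_homD(3)[OF assms(1)])
  also have "\<dots> = arr_of F (app \<theta>) G" by (rule arr_of_cong[OF assms(3)])
  also have "\<dots> = \<theta>" by (rule sheaf_homD(3)[OF assms(2), symmetric])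
  finally show ?thesis .
qed

lemma sheaf_Comp:
  assumes \<eta>: "\<eta> \<in> hom Sheaves F G" and \<theta>: "\<theta> \<in> hom Sheaves G H"
  shows "Comp Sheaves \<theta> \<eta> \<in> hom Sheaves F H"
    "z \<in> Obj A \<Longrightarrow> s \<in> FO F z \<Longrightarrow> app (Comp Sheaves \<theta> \<eta>) z s = app \<theta> z (app \<eta> z s)"
proof -
  have fs: "fst \<eta> = F" "snd (snd \<theta>) = H"
    using arg_cong[OF sheaf_homD(3)[OF \<eta>], of fst]
      arg_cong[OF sheaf_homD(3)[OF \<theta>], of "\<lambda>e. snd (snd e)"] unfolding arr_of_ends by this+
  have u: "und \<eta> z = (FO F z, restrict (app \<eta> z) (FO F z), FO G z)"
     "und \<theta> z = (FO G z, restrict (app \<theta> z) (FO G z), FO H z)" if "z \<in> Obj A" for z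
    using arg_cong[OF sheaf_homD(3)[OF \<eta>], of "\<lambda>e. und e z"]
      arg_cong[OF sheaf_homD(3)[OF \<theta>], of "\<lambda>e. und e z"] that unfolding arr_of_ends by simp_all
  have c: "Comp SET (und \<theta> z) (und \<eta> z) = (FO F z, restrict (\<lambda>s. app \<theta> z (app \<eta> z s)) (FO F z), FO H z)"
    if "z \<in> Obj A" for z
    unfolding u[OF that] using sheaf_homD(4)[OF \<eta> that]
    by (auto simp: SET_def und_def compose_def restrict_def fun_eq_iff)
  have eq: "Comp Sheaves \<theta> \<eta> = arr_of F (\<lambda>z s. app \<theta> z (app \<eta> z s)) H"
    unfolding Comp_Sheaves arr_of_def fs using c by (auto simp: restrict_def fun_eq_iff)
  show "Comp Sheaves \<theta> \<eta> \<in> hom Sheaves F H"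
    unfolding eq using sheaf_homD[OF \<eta>] sheaf_homD[OF \<theta>] by (intro arr_of_hom) auto
  show "z \<in> Obj A \<Longrightarrow> s \<in> FO F z \<Longrightarrow> app (Comp Sheaves \<theta> \<eta>) z s = app \<theta> z (app \<eta> z s)"
    unfolding eq by simp
qed

lemma sheaf_hom_DomCod: "\<eta> \<in> Arr Sheaves \<Longrightarrow> \<eta> \<in> hom Sheaves (fst \<eta>) (snd (snd \<eta>))"
  by (simp add: hom_def)

lemma sheaf_hom_ends: "\<eta> \<in> hom Sheaves F G \<Longrightarrow> fst \<eta> = F" "\<eta> \<in> hom Sheaves F G \<Longrightarrow> snd (snd \<eta>) = G"
   "\<eta> \<in> hom Sheaves F G \<Longrightarrow> \<eta> \<in> Arr Sheaves"
  by (simp_all add: hom_def)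

definition injective_on_sections :: "('o, 'm, 'u) presheaf_arr \<Rightarrow> bool" where
  "injective_on_sections \<eta> \<longleftrightarrow> (\<forall>z\<in>Obj A. inj_on (app \<eta> z) (FO (fst \<eta>) z))"

lemma injective_on_sectionsD:
  "injective_on_sections \<eta> \<Longrightarrow> \<eta> \<in> hom Sheaves F G \<Longrightarrow> z \<in> Obj A \<Longrightarrow> s \<in> FO F z \<Longrightarrow> t \<in> FO F z
    \<Longrightarrow> app \<eta> z s = app \<eta> z t \<Longrightarrow> s = t"
  by (auto simp: injective_on_sections_def hom_def inj_on_def)

text \<open>
  Local preimages under an injective map are unique, hence compatible, so they glue.
\<close>

lemma image_of_injective_local:
  assumes n: "n \<in> hom Sheaves N X" and inj: "injective_on_sections n"
    and z: "z \<in> Obj A" "s \<in> FO X z"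
    and l: "locally z (\<lambda>h. res X h s \<in> app n (Dom A h) ` FO N (Dom A h))"
  shows "s \<in> app n z ` FO N z"
proof -
  note N = sheaf_homD(1)[OF n] and X = sheaf_homD(2)[OF n]
  define m where "m h = inv_into (FO N (Dom A h)) (app n (Dom A h)) (res X h s)" for h
  have m: "m h \<in> FO N (Dom A h)" "app n (Dom A h) (m h) = res X h s"
    if "res X h s \<in> app n (Dom A h) ` FO N (Dom A h)" for h
    using that by (simp_all add: m_def inv_into_into f_inv_into_f)
  obtain t where t: "t \<in> FO N z" "\<And>h. h \<in> Arr A \<Longrightarrow> Cod A h = z \<Longrightarrow>
      res X h s \<in> app n (Dom A h) ` FO N (Dom A h) \<Longrightarrow> res N h t = m h"
  proof (rule set_sheaf_glue[OF sheaf_set_sheaf[OF N] z(1) l, of m])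
    fix h k assume h: "h \<in> Arr A" "Cod A h = z" "res X h s \<in> app n (Dom A h) ` FO N (Dom A h)"
      and k: "k \<in> Arr A" "Cod A k = Dom A h"
    have hk: "res X (h \<cdot> k) s = res X k (res X h s)" using h k z sheaf_res(3)[OF X] by simp
    have kn: "app n (Dom A k) (res N k (m h)) = res X (h \<cdot> k) s"
      using sheaf_homD(5)[OF n k(1)] m[OF h(3)] k hk by simp
    have kin: "res N k (m h) \<in> FO N (Dom A k)" using sheaf_res(1)[OF N k(1)] m[OF h(3)] k by simp
    then have "res X (h \<cdot> k) s \<in> app n (Dom A (h \<cdot> k)) ` FO N (Dom A (h \<cdot> k))" using kn h k by force
    from m[OF this] kn kin show "res N k (m h) = m (h \<cdot> k)"
      using injective_on_sectionsD[OF inj n, of "Dom A k"] h k by simp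
  qed (use m in auto)
  have "app n z t = s"
  proof (rule set_sheaf_eqI[OF sheaf_set_sheaf[OF X] z(1) _ z(2) l])
    show "app n z t \<in> FO X z" using sheaf_homD(4)[OF n] t z by blast
    fix h assume h: "h \<in> Arr A" "Cod A h = z" "res X h s \<in> app n (Dom A h) ` FO N (Dom A h)"
    then show "res X h (app n z t) = res X h s"
      using sheaf_homD(5)[OF n h(1)] t m[OF h(3)] by force
  qed
  then show ?thesis using t by blast
qed

text \<open>
  Preimages under the injective map \<open>n\<close> are unique, so choosing them is natural.
\<close>

lemma factors_through_iff:
  assumes k: "k \<in> hom Sheaves K X" and n: "n \<in> hom Sheaves N X" and inj: "injective_on_sections n"
  shows "factors_through Sheaves k n \<longleftrightarrow> (\<forall>z\<in>Obj A. \<forall>s\<in>FO K z. app k z s \<in> app n z ` FO N z)"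
proof
  assume "factors_through Sheaves k n"
  then obtain g where g: "g \<in> hom Sheaves K N" "k = Comp Sheaves n g"
    using sheaf_hom_ends[OF k] sheaf_hom_ends[OF n] by (auto simp: factors_through_def)
  then show "\<forall>z\<in>Obj A. \<forall>s\<in>FO K z. app k z s \<in> app n z ` FO N z"
    using sheaf_Comp(2)[OF g(1) n] sheaf_homD(4)[OF g(1)] by simp
next
  assume i: "\<forall>z\<in>Obj A. \<forall>s\<in>FO K z. app k z s \<in> app n z ` FO N z"
  define t where "t z s = inv_into (FO N z) (app n z) (app k z s)" for z s
  have t: "t z s \<in> FO N z" "app n z (t z s) = app k z s" if "z \<in> Obj A" "s \<in> FO K z" for z s
    using that i by (simp_all add: t_def inv_into_into f_inv_into_f)
  note K = sheaf_homD(1)[OF k] and N = sheaf_homD(1)[OF n]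
  have g: "arr_of K t N \<in> hom Sheaves K N"
  proof (rule arr_of_hom[OF K N t(1)])
    fix f s assume f: "f \<in> Arr A" "s \<in> FO K (Cod A f)"
    show "t (Dom A f) (res K f s) = res N f (t (Cod A f) s)"
    proof (rule injective_on_sectionsD[OF inj n, of "Dom A f"])
      show "app n (Dom A f) (t (Dom A f) (res K f s)) = app n (Dom A f) (res N f (t (Cod A f) s))"
        using f t sheaf_res(1)[OF K] sheaf_homD(5)[OF k] sheaf_homD(5)[OF n] by simp
    qed (use f t sheaf_res(1)[OF K] sheaf_res(1)[OF N] in auto)
  qed
  have "k = Comp Sheaves n (arr_of K t N)"
    by (rule sheaf_hom_eqI[OF k sheaf_Comp(1)[OF g n]]) (simp add: sheaf_Comp(2)[OF g n] t)
  then show "factors_through Sheaves k n"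
    using g sheaf_hom_ends[OF k] sheaf_hom_ends[OF n] unfolding factors_through_def by auto
qed

text \<open>
  Limits of sheaves are computed on sections: the mediating arrow picks the unique section with given components.
\<close>

lemma pullback_of_sectionsI:
  assumes f: "f \<in> hom Sheaves F G" and g: "g \<in> hom Sheaves X G"
    and p: "p \<in> hom Sheaves P F" and q: "q \<in> hom Sheaves P X"
    and comm: "\<And>z w. z \<in> Obj A \<Longrightarrow> w \<in> FO P z \<Longrightarrow> app f z (app p z w) = app g z (app q z w)"
    and ex: "\<And>z s t. z \<in> Obj A \<Longrightarrow> s \<in> FO F z \<Longrightarrow> t \<in> FO X z \<Longrightarrow> app f z s = app g z t \<Longrightarrow>
       \<exists>w\<in>FO P z. app p z w = s \<and> app q z w = t"
    and un: "\<And>z w w'. z \<in> Obj A \<Longrightarrow> w \<in> FO P z \<Longrightarrow> w' \<in> FO P z \<Longrightarrow> app p z w = app p z w' \<Longrightarrow>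
       app q z w = app q z w' \<Longrightarrow> w = w'"
  shows "is_pullback Sheaves f g p q"
proof -
  note fgpq = sheaf_hom_ends[OF f] sheaf_hom_ends[OF g] sheaf_hom_ends[OF p] sheaf_hom_ends[OF q]
  note P = sheaf_homD(1)[OF p]
  have cm: "Comp Sheaves f p = Comp Sheaves g q"
    by (rule sheaf_hom_eqI[OF sheaf_Comp(1)[OF p f] sheaf_Comp(1)[OF q g]])
      (simp add: sheaf_Comp(2)[OF p f] sheaf_Comp(2)[OF q g] comm)
  have "\<exists>!h. h \<in> hom Sheaves Z P \<and> Comp Sheaves p h = s \<and> Comp Sheaves q h = t"
    if s: "s \<in> hom Sheaves Z F" and t: "t \<in> hom Sheaves Z X" and st: "Comp Sheaves f s = Comp Sheaves g t"
    for Z s t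
  proof -
    note Z = sheaf_homD(1)[OF s]
    have st': "app f z (app s z a) = app g z (app t z a)" if "z \<in> Obj A" "a \<in> FO Z z" for z a
      using sheaf_Comp(2)[OF s f that] sheaf_Comp(2)[OF t g that] st by simp
    define w where "w z a = (SOME w. w \<in> FO P z \<and> app p z w = app s z a \<and> app q z w = app t z a)" for z a
    have w: "w z a \<in> FO P z \<and> app p z (w z a) = app s z a \<and> app q z (w z a) = app t z a"
      if "z \<in> Obj A" "a \<in> FO Z z" for z a
    proof -
      have "\<exists>w. w \<in> FO P z \<and> app p z w = app s z a \<and> app q z w = app t z a"
        using ex[OF that(1) sheaf_homD(4)[OF s that] sheaf_homD(4)[OF t that] st'[OF that]] by blast
      then show ?thesis unfolding w_def by (rule someI_ex)
    qed
    have h: "arr_of Z w P \<in> hom Sheaves Z P"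
    proof (rule arr_of_hom[OF Z P])
      fix k a assume k: "k \<in> Arr A" "a \<in> FO Z (Cod A k)"
      have wk: "w (Cod A k) a \<in> FO P (Cod A k)" using w k by simp
      show "w (Dom A k) (res Z k a) = res P k (w (Cod A k) a)"
        by (rule un[of "Dom A k"])
          (use k wk w[OF Dom_Cod_Obj(1)[OF k(1)] sheaf_res(1)[OF Z k]] w[OF Dom_Cod_Obj(2)[OF k(1)] k(2)]
              sheaf_res(1)[OF P k(1) wk] sheaf_homD(5)[OF p k(1) wk] sheaf_homD(5)[OF q k(1) wk]
              sheaf_homD(5)[OF s k] sheaf_homD(5)[OF t k] in auto)
    qed (use w in blast)
    show ?thesis
    proof (rule ex1I[of _ "arr_of Z w P"], intro conjI h)
      show "Comp Sheaves p (arr_of Z w P) = s"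
        by (rule sheaf_hom_eqI[OF sheaf_Comp(1)[OF h p] s]) (simp add: sheaf_Comp(2)[OF h p] w)
      show "Comp Sheaves q (arr_of Z w P) = t"
        by (rule sheaf_hom_eqI[OF sheaf_Comp(1)[OF h q] t]) (simp add: sheaf_Comp(2)[OF h q] w)
      fix h' assume h': "h' \<in> hom Sheaves Z P \<and> Comp Sheaves p h' = s \<and> Comp Sheaves q h' = t"
      then have h1: "h' \<in> hom Sheaves Z P" by simp
      show "h' = arr_of Z w P"
      proof (rule sheaf_hom_eqI[OF h1 h])
        fix z a assume z: "z \<in> Obj A" "a \<in> FO Z z"
        show "app h' z a = app (arr_of Z w P) z a"
          by (rule un[OF z(1)])
            (use h' z w[OF z] sheaf_Comp(2)[OF h1 p z] sheaf_Comp(2)[OF h1 q z] sheaf_homD(4)[OF h1 z]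
              sheaf_homD(4)[OF h z] in auto)
      qed
    qed
  qed
  then show ?thesis unfolding is_pullback_def using fgpq cm by simp
qed

end


section \<open>Subcanonical topologies\<close>

text \<open>
  The bound \<open>large_values\<close> leaves room in \<open>'u\<close> for sets of triples of arrows; these are the sections of
  the coproducts of representables constructed below.
\<close>

locale subcanonical_site = site A T for A :: "('o, 'm, 'z) cat_scheme" (structure) and T +
  fixes U :: "'u itself"
  assumes representable_sheaf:
      "a \<in> Obj A \<Longrightarrow> is_sheaf A T (representable A a :: ('o, 'm, 'u) presheaf)"
    and infinite_values: "infinite (UNIV :: 'u set)"
    and large_values: "Pow (Arr A) \<lesssim> (UNIV :: 'u set)"
begin

abbreviation enc :: "'m \<Rightarrow> 'u" where "enc \<equiv> encode A"

abbreviation Rep :: "'o \<Rightarrow> ('o, 'm, 'u) presheaf" where "Rep a \<equiv> representable A a"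

lemma inj_enc: "inj_on enc (Arr A)"
proof -
  have "Arr A \<lesssim> (UNIV :: 'u set)"
    using lepoll_Pow_self large_values by (rule lepoll_trans)
  then have "\<exists>e :: 'm \<Rightarrow> 'u. inj_on e (Arr A)" by (auto simp: lepoll_def)
  then show ?thesis unfolding encode_def by (rule someI_ex)
qed

lemma enc_eq [simp]: "h \<in> Arr A \<Longrightarrow> k \<in> Arr A \<Longrightarrow> enc h = enc k \<longleftrightarrow> h = k"
  using inj_enc by (auto simp: inj_on_def)

lemma decode_enc [simp]: "h \<in> Arr A \<Longrightarrow> decode A (enc h) = h"
  unfolding decode_def using inj_enc by (rule inv_into_f_f)

lemma FO_Rep: "FO (Rep a) z = enc ` hom A z a"
  by (simp add: representable_def)

lemma Rep_section: "s \<in> FO (Rep a) z \<Longrightarrow> (\<And>h. h \<in> Arr A \<Longrightarrow> Dom A h = z \<Longrightarrow> Cod A h = a \<Longrightarrow> s = enc h \<Longrightarrow> thesis) \<Longrightarrow> thesis"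
  by (auto simp: FO_Rep hom_def)

lemma enc_Rep [simp]: "h \<in> Arr A \<Longrightarrow> Dom A h = z \<Longrightarrow> Cod A h = a \<Longrightarrow> enc h \<in> FO (Rep a) z"
  by (auto simp: FO_Rep hom_def)

lemma res_Rep [simp]:
  assumes "f \<in> Arr A" "h \<in> Arr A" "Dom A h = Cod A f" "Cod A h = a"
  shows "res (Rep a) f (enc h) = enc (h \<cdot> f)"
proof -
  have "enc h \<in> enc ` hom A (Cod A f) a" using assms by (auto simp: hom_def)
  then show ?thesis using assms by (simp add: res_def representable_def und_def)
qed

lemma Rep_hom_eqI:
  assumes g: "g \<in> hom Sheaves (Rep a) F" "g' \<in> hom Sheaves (Rep a) F"
    and eq: "app g a (enc (Ident A a)) = app g' a (enc (Ident A a))" and a: "a \<in> Obj A"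
  shows "g = g'"
proof (rule sheaf_hom_eqI[OF g])
  fix z s assume z: "z \<in> Obj A" "s \<in> FO (Rep a) z"
  then obtain h where h: "h \<in> Arr A" "Dom A h = z" "Cod A h = a" "s = enc h" by (auto elim: Rep_section)
  have "app k (Dom A h) (res (Rep a) h (enc (Ident A a))) = res F h (app k (Cod A h) (enc (Ident A a)))"
    if "k \<in> hom Sheaves (Rep a) F" for k
    by (rule sheaf_homD(5)[OF that h(1)]) (use h a in simp)
  then have "app k z s = res F h (app k a (enc (Ident A a)))" if "k \<in> hom Sheaves (Rep a) F" for k
    using that h a by simp
  then show "app g z s = app g' z s" using g eq by simp
qed

lemma Rep_hom_app:
  assumes g: "g \<in> hom Sheaves (Rep a) F" and h: "h \<in> Arr A" "Cod A h = a"
  shows "app g (Dom A h) (enc h) = res F h (app g a (enc (Ident A a)))"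
proof -
  have a: "a \<in> Obj A" using h by auto
  have "app g (Dom A h) (res (Rep a) h (enc (Ident A a))) = res F h (app g (Cod A h) (enc (Ident A a)))"
    by (rule sheaf_homD(5)[OF g h(1)]) (use h a in simp)
  then show ?thesis using h a by simp
qed

definition yoneda_arr :: "('o, 'm, 'u) presheaf \<Rightarrow> 'o \<Rightarrow> 'u \<Rightarrow> ('o, 'm, 'u) presheaf_arr" where
  "yoneda_arr F a r = arr_of (Rep a) (\<lambda>z s. res F (decode A s) r) F"

lemma yoneda_arr:
  assumes F: "is_sheaf A T F" and a: "a \<in> Obj A" "r \<in> FO F a"
  shows "yoneda_arr F a r \<in> hom Sheaves (Rep a) F"
    "h \<in> Arr A \<Longrightarrow> Cod A h = a \<Longrightarrow> app (yoneda_arr F a r) (Dom A h) (enc h) = res F h r"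
    "app (yoneda_arr F a r) a (enc (Ident A a)) = r"
proof -
  show 1: "yoneda_arr F a r \<in> hom Sheaves (Rep a) F"
    unfolding yoneda_arr_def
  proof (rule arr_of_hom[OF representable_sheaf[OF a(1)] F])
    fix z s assume "z \<in> Obj A" "s \<in> FO (Rep a) z"
    then show "res F (decode A s) r \<in> FO F z"
      using a sheaf_res(1)[OF F, of _ r] by (auto elim!: Rep_section)
  next
    fix f s assume f: "f \<in> Arr A" "s \<in> FO (Rep a) (Cod A f)"
    then show "res F (decode A (res (Rep a) f s)) r = res F f (res F (decode A s) r)"
      using a sheaf_res(3)[OF F, of _ f r] by (auto elim!: Rep_section)
  qed
  show 2: "app (yoneda_arr F a r) (Dom A h) (enc h) = res F h r" if "h \<in> Arr A" "Cod A h = a" for h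
    unfolding yoneda_arr_def using that by simp
  show "app (yoneda_arr F a r) a (enc (Ident A a)) = r"
    using 2[of "Ident A a"] a sheaf_res(2)[OF F] by simp
qed

text \<open>
  Sections over \<open>z\<close> are arrows out of the sheaf that \<open>z\<close> represents, so a monomorphism separates them.
\<close>

lemma mono_iff_injective_on_sections:
  assumes n: "n \<in> hom Sheaves N (X :: ('o, 'm, 'u) presheaf)"
  shows "is_mono Sheaves n \<longleftrightarrow> injective_on_sections n"
proof
  assume m: "is_mono Sheaves n"
  show "injective_on_sections n"
    unfolding injective_on_sections_def
  proof (intro ballI inj_onI)
    fix z s t assume z: "z \<in> Obj A" and s: "s \<in> FO (fst n) z" and t: "t \<in> FO (fst n) z"
      and eq: "app n z s = app n z t"
    have s: "s \<in> FO N z" and t: "t \<in> FO N z" using s t sheaf_hom_ends[OF n] by auto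
    note N = sheaf_homD(1)[OF n]
    note ys = yoneda_arr[OF N z s] and yt = yoneda_arr[OF N z t]
    have I: "enc (Ident A z) \<in> FO (Rep z) z" using z by simp
    have "Comp Sheaves n (yoneda_arr N z s) = Comp Sheaves n (yoneda_arr N z t)"
      by (rule Rep_hom_eqI[OF sheaf_Comp(1)[OF ys(1) n] sheaf_Comp(1)[OF yt(1) n] _ z])
        (simp add: sheaf_Comp(2)[OF ys(1) n z I] sheaf_Comp(2)[OF yt(1) n z I] ys(3) yt(3) eq)
    moreover have "Rep z \<in> Obj Sheaves" using representable_sheaf[OF z] by simp
    ultimately have "yoneda_arr N z s = yoneda_arr N z t"
      using m[unfolded is_mono_def, THEN conjunct2, rule_format, of "Rep z" "yoneda_arr N z s" "yoneda_arr N z t"]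
        ys(1) yt(1) sheaf_hom_ends[OF n] by simp
    from arg_cong[OF this, of "\<lambda>y. app y z (enc (Ident A z))"] show "s = t"
      unfolding ys(3) yt(3) .
  qed
next
  assume inj: "injective_on_sections n"
  show "is_mono Sheaves n"
    unfolding is_mono_def
  proof (intro conjI ballI impI)
    show "n \<in> Arr Sheaves" using sheaf_hom_ends[OF n] by simp
    fix Z g h assume "g \<in> hom Sheaves Z (Dom Sheaves n)" "h \<in> hom Sheaves Z (Dom Sheaves n)"
      and eq: "Comp Sheaves n g = Comp Sheaves n h"
    then have g: "g \<in> hom Sheaves Z N" and h: "h \<in> hom Sheaves Z N" using sheaf_hom_ends[OF n] by simp_all
    show "g = h"
    proof (rule sheaf_hom_eqI[OF g h])
      fix z s assume z: "z \<in> Obj A" "s \<in> FO Z z"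
      show "app g z s = app h z s"
        by (rule injective_on_sectionsD[OF inj n z(1)])
          (use sheaf_Comp(2)[OF g n z] sheaf_Comp(2)[OF h n z] eq sheaf_homD(4)[OF g z] sheaf_homD(4)[OF h z] in auto)
    qed
  qed
qed

text \<open>
  The universal property of a pullback, tested on representables, describes its sections.
\<close>

lemma pullback_sections:
  assumes pb: "is_pullback Sheaves f g p (q :: ('o, 'm, 'u) presheaf_arr)"
    and f: "f \<in> hom Sheaves F G" and g: "g \<in> hom Sheaves X G"
  obtains P where "p \<in> hom Sheaves P F" "q \<in> hom Sheaves P X"
    "\<And>z w. z \<in> Obj A \<Longrightarrow> w \<in> FO P z \<Longrightarrow> app f z (app p z w) = app g z (app q z w)"
    "\<And>z s t. z \<in> Obj A \<Longrightarrow> s \<in> FO F z \<Longrightarrow> t \<in> FO X z \<Longrightarrow> app f z s = app g z t \<Longrightarrow>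
       \<exists>w\<in>FO P z. app p z w = s \<and> app q z w = t"
    "\<And>z w w'. z \<in> Obj A \<Longrightarrow> w \<in> FO P z \<Longrightarrow> w' \<in> FO P z \<Longrightarrow> app p z w = app p z w' \<Longrightarrow>
       app q z w = app q z w' \<Longrightarrow> w = w'"
proof -
  note fg = sheaf_hom_ends[OF f] sheaf_hom_ends[OF g]
  define P where "P = fst p"
  have p: "p \<in> hom Sheaves P F" and q: "q \<in> hom Sheaves P X" and cm: "Comp Sheaves f p = Comp Sheaves g q"
    using pb fg by (auto simp: is_pullback_def hom_def P_def)
  have ex1: "\<exists>!h. h \<in> hom Sheaves Z P \<and> Comp Sheaves p h = s \<and> Comp Sheaves q h = t"
    if "is_sheaf A T Z" "s \<in> hom Sheaves Z F" "t \<in> hom Sheaves Z X" "Comp Sheaves f s = Comp Sheaves g t" for Z s t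
    using pb[unfolded is_pullback_def, THEN conjunct2, THEN conjunct2, THEN conjunct2, THEN conjunct2,
        THEN conjunct2, THEN conjunct2, THEN conjunct2, THEN conjunct2, THEN conjunct2, rule_format, of Z s t]
      that fg unfolding P_def by simp
  note P = sheaf_homD(1)[OF p] and F = sheaf_homD(1)[OF f] and X = sheaf_homD(1)[OF g]
  show thesis
  proof (rule that[OF p q])
    fix z w assume z: "z \<in> Obj A" "w \<in> FO P z"
    show "app f z (app p z w) = app g z (app q z w)"
      using sheaf_Comp(2)[OF p f z] sheaf_Comp(2)[OF q g z] cm by simp
  next
    fix z s t assume z: "z \<in> Obj A" and s: "s \<in> FO F z" and t: "t \<in> FO X z" and eq: "app f z s = app g z t"
    have I: "enc (Ident A z) \<in> FO (Rep z) z" using z by simp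
    note ys = yoneda_arr[OF F z s] and yt = yoneda_arr[OF X z t]
    have "Comp Sheaves f (yoneda_arr F z s) = Comp Sheaves g (yoneda_arr X z t)"
      by (rule Rep_hom_eqI[OF sheaf_Comp(1)[OF ys(1) f] sheaf_Comp(1)[OF yt(1) g] _ z])
        (simp add: sheaf_Comp(2)[OF ys(1) f z I] sheaf_Comp(2)[OF yt(1) g z I] ys(3) yt(3) eq)
    from ex1[OF representable_sheaf[OF z] ys(1) yt(1) this]
    obtain h where h: "h \<in> hom Sheaves (Rep z) P" "Comp Sheaves p h = yoneda_arr F z s"
      "Comp Sheaves q h = yoneda_arr X z t" by blast
    show "\<exists>w\<in>FO P z. app p z w = s \<and> app q z w = t"
      by (rule bexI[of _ "app h z (enc (Ident A z))"])
        (use sheaf_Comp(2)[OF h(1) p z I] sheaf_Comp(2)[OF h(1) q z I] h ys(3) yt(3)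
            sheaf_homD(4)[OF h(1) z I] in simp_all)
  next
    fix z w w' assume z: "z \<in> Obj A" and w: "w \<in> FO P z" and w': "w' \<in> FO P z"
      and pw: "app p z w = app p z w'" and qw: "app q z w = app q z w'"
    have I: "enc (Ident A z) \<in> FO (Rep z) z" using z by simp
    note y = yoneda_arr[OF P z w] and y' = yoneda_arr[OF P z w']
    have ep: "Comp Sheaves p (yoneda_arr P z w) = Comp Sheaves p (yoneda_arr P z w')"
      by (rule Rep_hom_eqI[OF sheaf_Comp(1)[OF y(1) p] sheaf_Comp(1)[OF y'(1) p] _ z])
        (simp add: sheaf_Comp(2)[OF y(1) p z I] sheaf_Comp(2)[OF y'(1) p z I] y(3) y'(3) pw)
    have eq: "Comp Sheaves q (yoneda_arr P z w) = Comp Sheaves q (yoneda_arr P z w')"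
      by (rule Rep_hom_eqI[OF sheaf_Comp(1)[OF y(1) q] sheaf_Comp(1)[OF y'(1) q] _ z])
        (simp add: sheaf_Comp(2)[OF y(1) q z I] sheaf_Comp(2)[OF y'(1) q z I] y(3) y'(3) qw)
    have fq: "Comp Sheaves f (Comp Sheaves p (yoneda_arr P z w)) = Comp Sheaves g (Comp Sheaves q (yoneda_arr P z w))"
      by (rule sheaf_hom_eqI[OF sheaf_Comp(1)[OF sheaf_Comp(1)[OF y(1) p] f] sheaf_Comp(1)[OF sheaf_Comp(1)[OF y(1) q] g]])
       (use sheaf_Comp(2)[OF p f] sheaf_Comp(2)[OF q g] cm in \<open>simp add: sheaf_Comp(2)[OF sheaf_Comp(1)[OF y(1) p] f]
         sheaf_Comp(2)[OF sheaf_Comp(1)[OF y(1) q] g] sheaf_Comp(2)[OF y(1) p] sheaf_Comp(2)[OF y(1) q] sheaf_homD(4)[OF y(1)]\<close>)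
    have "yoneda_arr P z w = yoneda_arr P z w'"
      using ex1[OF representable_sheaf[OF z] sheaf_Comp(1)[OF y(1) p] sheaf_Comp(1)[OF y(1) q] fq]
        y(1) y'(1) ep eq by metis
    from arg_cong[OF this, of "\<lambda>y. app y z (enc (Ident A z))"] show "w = w'"
      unfolding y(3) y'(3) .
  qed
qed

end

context site
begin

section \<open>Sheafification\<close>

text \<open>
  The sheaf associated with a presheaf \<open>P\<close> is built without a quotient.  A section over \<open>z\<close> is the set
  of all its germs, which are the pairs of an arrow \<open>h\<close> into \<open>z\<close> and an element of \<open>P\<close> that represents
  the restriction of the section along \<open>h\<close>.  Such a set is closed under restriction, has a member over
  a covering of \<open>z\<close>, any two members over the same arrow are locally equal, and it is saturated.
  Saturation makes equal sections equal as sets, and all sections are elements of one power set, which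
  bounds their number.
\<close>

definition restrict_germs :: "'m \<Rightarrow> ('m \<times> 'v) set \<Rightarrow> ('m \<times> 'v) set" where
  "restrict_germs f S = {(h, p). h \<in> Arr A \<and> Cod A h = Dom A f \<and> (f \<cdot> h, p) \<in> S}"

context
  fixes P :: "'o \<Rightarrow> 'v set" and r :: "'m \<Rightarrow> 'v \<Rightarrow> 'v"
begin

definition sheafified :: "'o \<Rightarrow> ('m \<times> 'v) set set" where
  "sheafified z = {S. S \<subseteq> {(h, p). h \<in> Arr A \<and> Cod A h = z \<and> p \<in> P (Dom A h)} \<and>
     (\<forall>h p k. (h, p) \<in> S \<and> k \<in> Arr A \<and> Cod A k = Dom A h \<longrightarrow> (h \<cdot> k, r k p) \<in> S) \<and>
     locally z (\<lambda>h. \<exists>p. (h, p) \<in> S) \<and>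
     (\<forall>h p q. (h, p) \<in> S \<and> (h, q) \<in> S \<longrightarrow> locally (Dom A h) (\<lambda>k. r k p = r k q)) \<and>
     (\<forall>h p. h \<in> Arr A \<and> Cod A h = z \<and> p \<in> P (Dom A h) \<and>
        locally (Dom A h) (\<lambda>k. (h \<cdot> k, r k p) \<in> S) \<longrightarrow> (h, p) \<in> S)}"

definition germs_of :: "'o \<Rightarrow> 'v \<Rightarrow> ('m \<times> 'v) set" where
  "germs_of z p = {(h, q). h \<in> Arr A \<and> Cod A h = z \<and> q \<in> P (Dom A h) \<and>
     locally (Dom A h) (\<lambda>k. r k q = r k (r h p))}"

lemma sheafifiedI:
  assumes "\<And>h p. (h, p) \<in> S \<Longrightarrow> h \<in> Arr A \<and> Cod A h = z \<and> p \<in> P (Dom A h)"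
    "\<And>h p k. (h, p) \<in> S \<Longrightarrow> k \<in> Arr A \<Longrightarrow> Cod A k = Dom A h \<Longrightarrow> (h \<cdot> k, r k p) \<in> S"
    "locally z (\<lambda>h. \<exists>p. (h, p) \<in> S)"
    "\<And>h p q. (h, p) \<in> S \<Longrightarrow> (h, q) \<in> S \<Longrightarrow> locally (Dom A h) (\<lambda>k. r k p = r k q)"
    "\<And>h p. h \<in> Arr A \<Longrightarrow> Cod A h = z \<Longrightarrow> p \<in> P (Dom A h) \<Longrightarrow>
        locally (Dom A h) (\<lambda>k. (h \<cdot> k, r k p) \<in> S) \<Longrightarrow> (h, p) \<in> S"
  shows "S \<in> sheafified z"
  unfolding sheafified_def mem_Collect_eq
  by (intro conjI allI impI subsetI) (use assms in blast)+

lemma sheafifiedD: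
  assumes "S \<in> sheafified z"
  shows "(h, p) \<in> S \<Longrightarrow> h \<in> Arr A" "(h, p) \<in> S \<Longrightarrow> Cod A h = z" "(h, p) \<in> S \<Longrightarrow> p \<in> P (Dom A h)"
    "(h, p) \<in> S \<Longrightarrow> k \<in> Arr A \<Longrightarrow> Cod A k = Dom A h \<Longrightarrow> (h \<cdot> k, r k p) \<in> S"
    "locally z (\<lambda>h. \<exists>p. (h, p) \<in> S)"
    "(h, p) \<in> S \<Longrightarrow> (h, q) \<in> S \<Longrightarrow> locally (Dom A h) (\<lambda>k. r k p = r k q)"
    "h \<in> Arr A \<Longrightarrow> Cod A h = z \<Longrightarrow> p \<in> P (Dom A h) \<Longrightarrow>
        locally (Dom A h) (\<lambda>k. (h \<cdot> k, r k p) \<in> S) \<Longrightarrow> (h, p) \<in> S"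
  using assms unfolding sheafified_def mem_Collect_eq by blast+

context
  assumes P: "set_presheaf P r"
begin

lemma restriction_mem: "f \<in> Arr A \<Longrightarrow> x = Cod A f \<Longrightarrow> s \<in> P x \<Longrightarrow> y = Dom A f \<Longrightarrow> r f s \<in> P y"
  using set_presheafD(1)[OF P] by simp

lemma restriction_restriction: "f \<in> Arr A \<Longrightarrow> g \<in> Arr A \<Longrightarrow> Cod A g = Dom A f \<Longrightarrow> x = Cod A f \<Longrightarrow> s \<in> P x \<Longrightarrow>
    r g (r f s) = r (f \<cdot> g) s"
  using set_presheafD(3)[OF P] by simp

lemma restrict_germs_sheafified:
  assumes f: "f \<in> Arr A" and S: "S \<in> sheafified (Cod A f)"
  shows "restrict_germs f S \<in> sheafified (Dom A f)"
proof (rule sheafifiedI)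
  note SD = sheafifiedD[OF S]
  fix h p assume hp: "(h, p) \<in> restrict_germs f S"
  then have h: "h \<in> Arr A" "Cod A h = Dom A f" "(f \<cdot> h, p) \<in> S" by (auto simp: restrict_germs_def)
  then have "p \<in> P (Dom A h)" using SD(3)[OF h(3)] f by simp
  then show "h \<in> Arr A \<and> Cod A h = Dom A f \<and> p \<in> P (Dom A h)" using h by simp
  { fix k assume k: "k \<in> Arr A" "Cod A k = Dom A h"
    then have "((f \<cdot> h) \<cdot> k, r k p) \<in> S" using SD(4)[OF h(3)] h f by simp
    then show "(h \<cdot> k, r k p) \<in> restrict_germs f S" using h f k by (simp add: restrict_germs_def) }
  fix q assume "(h, q) \<in> restrict_germs f S"
  then have "(f \<cdot> h, q) \<in> S" by (simp add: restrict_germs_def)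
  from SD(6)[OF h(3) this] show "locally (Dom A h) (\<lambda>k. r k p = r k q)" using h f by simp
next
  have "locally (Dom A f) (\<lambda>h. \<exists>p. (f \<cdot> h, p) \<in> S)"
    by (rule locally_pull[OF f sheafifiedD(5)[OF S]])
  then show "locally (Dom A f) (\<lambda>h. \<exists>p. (h, p) \<in> restrict_germs f S)"
    by (subst locally_cong[where Q = "\<lambda>h. \<exists>p. (f \<cdot> h, p) \<in> S"]) (auto simp: restrict_germs_def)
next
  fix h p assume h: "h \<in> Arr A" "Cod A h = Dom A f" "p \<in> P (Dom A h)"
    and l: "locally (Dom A h) (\<lambda>k. (h \<cdot> k, r k p) \<in> restrict_germs f S)"
  have "locally (Dom A h) (\<lambda>k. ((f \<cdot> h) \<cdot> k, r k p) \<in> S)"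
    using l by (subst (asm) locally_cong[where Q = "\<lambda>k. ((f \<cdot> h) \<cdot> k, r k p) \<in> S"])
      (use h f in \<open>auto simp: restrict_germs_def\<close>)
  then have "(f \<cdot> h, p) \<in> S" using sheafifiedD(7)[OF S, of "f \<cdot> h" p] h f by simp
  then show "(h, p) \<in> restrict_germs f S" using h by (simp add: restrict_germs_def)
qed

lemma germs_of_sheafified:
  assumes z: "z \<in> Obj A" and p: "p \<in> P z"
  shows "germs_of z p \<in> sheafified z"
proof (rule sheafifiedI)
  fix h q assume hq: "(h, q) \<in> germs_of z p"
  then have h: "h \<in> Arr A" "Cod A h = z" "q \<in> P (Dom A h)"
    and l: "locally (Dom A h) (\<lambda>k. r k q = r k (r h p))" by (auto simp: germs_of_def)
  show "h \<in> Arr A \<and> Cod A h = z \<and> q \<in> P (Dom A h)" using h by simp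
  { fix k assume k: "k \<in> Arr A" "Cod A k = Dom A h"
    have "locally (Dom A k) (\<lambda>l. r (k \<cdot> l) q = r (k \<cdot> l) (r h p))"
      using locally_pull[OF k(1)] k l by simp
    then have "locally (Dom A k) (\<lambda>l. r l (r k q) = r l (r (h \<cdot> k) p))"
      by (subst (asm) locally_cong[where Q = "\<lambda>l. r l (r k q) = r l (r (h \<cdot> k) p)"])
        (use h k p in \<open>auto simp: restriction_restriction restriction_mem\<close>)
    then show "(h \<cdot> k, r k q) \<in> germs_of z p" using h k by (simp add: germs_of_def restriction_mem) }
  fix q' assume "(h, q') \<in> germs_of z p"
  then have l': "locally (Dom A h) (\<lambda>k. r k q' = r k (r h p))" and q': "q' \<in> P (Dom A h)"
    by (auto simp: germs_of_def)
  show "locally (Dom A h) (\<lambda>k. r k q = r k q')"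
    by (rule locally_mono[OF _ locally_conj[OF _ l l'] locally_eq_stable[OF P]]) (use h q' in auto)
next
  show "locally z (\<lambda>h. \<exists>q. (h, q) \<in> germs_of z p)"
  proof (rule locally_all[OF z])
    fix h assume "h \<in> Arr A" "Cod A h = z"
    then have "(h, r h p) \<in> germs_of z p" using p by (auto simp: germs_of_def restriction_mem intro!: locally_all)
    then show "\<exists>q. (h, q) \<in> germs_of z p" by blast
  qed
next
  fix h q assume h: "h \<in> Arr A" "Cod A h = z" "q \<in> P (Dom A h)"
    and l: "locally (Dom A h) (\<lambda>k. (h \<cdot> k, r k q) \<in> germs_of z p)"
  have "locally (Dom A h) (\<lambda>k. r k q = r k (r h p))"
  proof (rule locally_trans[OF _ locally_eq_stable[OF P] l])
    fix k assume k: "k \<in> Arr A" "Cod A k = Dom A h" "(h \<cdot> k, r k q) \<in> germs_of z p"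
    then have "locally (Dom A k) (\<lambda>l. r l (r k q) = r l (r (h \<cdot> k) p))"
      using h by (simp add: germs_of_def)
    then show "locally (Dom A k) (\<lambda>l. r (k \<cdot> l) q = r (k \<cdot> l) (r h p))"
      by (subst (asm) locally_cong[where Q = "\<lambda>l. r (k \<cdot> l) q = r (k \<cdot> l) (r h p)"])
        (use h k p in \<open>auto simp: restriction_restriction restriction_mem\<close>)
  qed (use h p restriction_mem in auto)
  then show "(h, q) \<in> germs_of z p" using h by (simp add: germs_of_def)
qed

text \<open>
  The germs of a section are the elements of \<open>P\<close> that induce its restrictions.
\<close>

lemma mem_sheafified_iff:
  assumes S: "S \<in> sheafified z" and h: "h \<in> Arr A" "Cod A h = z" and p: "p \<in> P (Dom A h)"
  shows "(h, p) \<in> S \<longleftrightarrow> restrict_germs h S = germs_of (Dom A h) p"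
proof
  note SD = sheafifiedD[OF S]
  assume hp: "(h, p) \<in> S"
  show "restrict_germs h S = germs_of (Dom A h) p"
  proof (intro equalityI subsetI; clarify)
    fix k q assume "(k, q) \<in> restrict_germs h S"
    then have k: "k \<in> Arr A" "Cod A k = Dom A h" "(h \<cdot> k, q) \<in> S" by (auto simp: restrict_germs_def)
    have "q \<in> P (Dom A k)" using SD(3)[OF k(3)] k h by simp
    moreover have "locally (Dom A k) (\<lambda>l. r l q = r l (r k p))"
      using SD(6)[OF k(3) SD(4)[OF hp k(1,2)]] k h by simp
    ultimately show "(k, q) \<in> germs_of (Dom A h) p" using k by (simp add: germs_of_def)
  next
    fix k q assume "(k, q) \<in> germs_of (Dom A h) p"
    then have k: "k \<in> Arr A" "Cod A k = Dom A h" "q \<in> P (Dom A k)"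
      and l: "locally (Dom A k) (\<lambda>l. r l q = r l (r k p))" by (auto simp: germs_of_def)
    have hk: "(h \<cdot> k, r k p) \<in> S" using SD(4)[OF hp k(1,2)] .
    have "(h \<cdot> k, q) \<in> S"
    proof (rule SD(7))
      have st: "stable (Dom A k) (\<lambda>l. ((h \<cdot> k) \<cdot> l, r l q) \<in> S)"
      proof (rule stableI)
        fix l m assume l: "l \<in> Arr A" "Cod A l = Dom A k" "((h \<cdot> k) \<cdot> l, r l q) \<in> S" "m \<in> Arr A" "Cod A m = Dom A l"
        have "(((h \<cdot> k) \<cdot> l) \<cdot> m, r m (r l q)) \<in> S" by (rule SD(4)[OF l(3)]) (use l h k in auto)
        then show "((h \<cdot> k) \<cdot> (l \<cdot> m), r (l \<cdot> m) q) \<in> S" using l h k by (simp add: restriction_restriction)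
      qed
      have "locally (Dom A k) (\<lambda>l. ((h \<cdot> k) \<cdot> l, r l q) \<in> S)"
      proof (rule locally_mono[OF _ l st])
        fix l assume l: "l \<in> Arr A" "Cod A l = Dom A k" "r l q = r l (r k p)"
        have "((h \<cdot> k) \<cdot> l, r l (r k p)) \<in> S" by (rule SD(4)[OF hk]) (use l h k in auto)
        then show "((h \<cdot> k) \<cdot> l, r l q) \<in> S" using l by simp
      qed (use k in auto)
      then show "locally (Dom A (h \<cdot> k)) (\<lambda>l. ((h \<cdot> k) \<cdot> l, r l q) \<in> S)" using h k by simp
    qed (use h k in auto)
    then show "(k, q) \<in> restrict_germs h S" using k by (simp add: restrict_germs_def)
  qed
next
  assume eq: "restrict_germs h S = germs_of (Dom A h) p"
  have "(Ident A (Dom A h), p) \<in> germs_of (Dom A h) p"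
    using h p by (auto simp: germs_of_def set_presheafD(2)[OF P] restriction_mem intro!: locally_all)
  then have "(Ident A (Dom A h), p) \<in> restrict_germs h S" by (simp only: eq)
  then show "(h, p) \<in> S" using h by (simp add: restrict_germs_def)
qed

lemma sheafified_stable:
  assumes S: "S \<in> sheafified z" and h: "h \<in> Arr A" "Cod A h = z" and p: "p \<in> P (Dom A h)"
  shows "stable (Dom A h) (\<lambda>k. (h \<cdot> k, r k p) \<in> S)"
proof (rule stableI)
  fix k m assume k: "k \<in> Arr A" "Cod A k = Dom A h" "(h \<cdot> k, r k p) \<in> S" "m \<in> Arr A" "Cod A m = Dom A k"
  have "((h \<cdot> k) \<cdot> m, r m (r k p)) \<in> S" by (rule sheafifiedD(4)[OF S k(3)]) (use k h in auto)
  then show "(h \<cdot> (k \<cdot> m), r (k \<cdot> m) p) \<in> S" using k h p by (simp add: restriction_restriction)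
qed

text \<open>
  Sections are glued by taking all germs that belong to a given section locally on the covering; the
  identity arrow in the definition of \<open>L\<close> expresses that an element induces the given section itself.
\<close>

lemma sheafified_set_sheaf: "set_sheaf sheafified restrict_germs"
proof (rule set_sheafI)
  show "set_presheaf sheafified restrict_germs"
    unfolding set_presheaf_def
  proof (intro conjI ballI impI)
    fix x S assume "x \<in> Obj A" "S \<in> sheafified x"
    then show "restrict_germs (Ident A x) S = S"
      using sheafifiedD(1-3)[of S x] by (fastforce simp: restrict_germs_def)
  next
    fix f g S assume "f \<in> Arr A" "g \<in> Arr A" "Cod A g = Dom A f"
    then show "restrict_germs (f \<cdot> g) S = restrict_germs g (restrict_germs f S)"
      by (auto simp: restrict_germs_def)
  qed (rule restrict_germs_sheafified)
next
  have sub: "S \<subseteq> S'" if x: "x \<in> Obj A" and S: "S \<in> sheafified x" and S': "S' \<in> sheafified x"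
    and l: "locally x (\<lambda>h. restrict_germs h S = restrict_germs h S')" for x S S'
  proof clarify
    fix h p assume hp: "(h, p) \<in> S"
    note SD = sheafifiedD[OF S]
    note h = SD(1-3)[OF hp]
    show "(h, p) \<in> S'"
    proof (rule sheafifiedD(7)[OF S' h])
      show "locally (Dom A h) (\<lambda>k. (h \<cdot> k, r k p) \<in> S')"
      proof (rule locally_mono[OF _ _ sheafified_stable[OF S' h]])
        show "locally (Dom A h) (\<lambda>k. restrict_germs (h \<cdot> k) S = restrict_germs (h \<cdot> k) S')"
          using locally_pull[OF h(1)] l h(2) by simp
        fix k assume k: "k \<in> Arr A" "Cod A k = Dom A h" "restrict_germs (h \<cdot> k) S = restrict_germs (h \<cdot> k) S'"
        have "(h \<cdot> k, r k p) \<in> S" by (rule SD(4)[OF hp k(1,2)])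
        then show "(h \<cdot> k, r k p) \<in> S'"
          using mem_sheafified_iff[OF S, of "h \<cdot> k" "r k p"] mem_sheafified_iff[OF S', of "h \<cdot> k" "r k p"] k h
          by (simp add: restriction_mem)
      qed (use h in auto)
    qed
  qed
  fix x S S' assume x: "x \<in> Obj A" "S \<in> sheafified x" "S' \<in> sheafified x"
    and l: "locally x (\<lambda>h. restrict_germs h S = restrict_germs h S')"
  then have "locally x (\<lambda>h. restrict_germs h S' = restrict_germs h S)" by (simp add: eq_commute)
  with sub[OF x l] sub[OF x(1,3,2)] show "S = S'" by blast
next
  fix x Q m assume x: "x \<in> Obj A" and Q: "locally x Q" and m: "\<forall>h\<in>Arr A. Cod A h = x \<and> Q h \<longrightarrow>
     m h \<in> sheafified (Dom A h) \<and> (\<forall>k\<in>Arr A. Cod A k = Dom A h \<longrightarrow> restrict_germs k (m h) = m (h \<cdot> k))"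
  have m1: "m h \<in> sheafified (Dom A h)" if "h \<in> Arr A" "Cod A h = x" "Q h" for h using m that by blast
  have m2: "restrict_germs k (m h) = m (h \<cdot> k)" if "h \<in> Arr A" "Cod A h = x" "Q h" "k \<in> Arr A" "Cod A k = Dom A h"
    for h k using m that by blast
  have sQ: "Q (h \<cdot> k)" if "h \<in> Arr A" "Cod A h = x" "Q h" "k \<in> Arr A" "Cod A k = Dom A h" for h k
    using stableD[OF locally_stable[OF x Q]] that .
  define L where "L h p = (\<lambda>k. Q (h \<cdot> k) \<and> (Ident A (Dom A k), r k p) \<in> m (h \<cdot> k))" for h p
  define S where "S = {(h, p). h \<in> Arr A \<and> Cod A h = x \<and> p \<in> P (Dom A h) \<and> locally (Dom A h) (L h p)}"
  have id: "(Ident A (Dom A k), q) \<in> m (f \<cdot> k) \<longleftrightarrow> (k, q) \<in> m f"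
    if "f \<in> Arr A" "Cod A f = x" "Q f" "k \<in> Arr A" "Cod A k = Dom A f" for f k q
    unfolding m2[OF that, symmetric] using that by (simp add: restrict_germs_def)
  have Lpull: "L (h \<cdot> k) (r k p) l \<longleftrightarrow> L h p (k \<cdot> l)"
    if "h \<in> Arr A" "k \<in> Arr A" "Cod A k = Dom A h" "l \<in> Arr A" "Cod A l = Dom A k" "p \<in> P (Dom A h)" for h k l p
    using that by (simp add: L_def restriction_restriction)
  have mem: "(f \<cdot> h, p) \<in> S \<longleftrightarrow> (h, p) \<in> m f"
    if f: "f \<in> Arr A" "Cod A f = x" "Q f" and h: "h \<in> Arr A" "Cod A h = Dom A f" for f h p
  proof (cases "p \<in> P (Dom A h)")
    case True
    have "(f \<cdot> h, p) \<in> S \<longleftrightarrow> locally (Dom A h) (L (f \<cdot> h) p)" using f h True by (simp add: S_def)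
    also have "\<dots> \<longleftrightarrow> locally (Dom A h) (\<lambda>k. (h \<cdot> k, r k p) \<in> m f)"
    proof (rule locally_cong)
      fix k assume k: "k \<in> Arr A" "Cod A k = Dom A h"
      show "L (f \<cdot> h) p k \<longleftrightarrow> (h \<cdot> k, r k p) \<in> m f"
        using id[OF f, of "h \<cdot> k" "r k p"] sQ[OF f, of "h \<cdot> k"] f h k by (simp add: L_def)
    qed
    also have "\<dots> \<longleftrightarrow> (h, p) \<in> m f"
      using sheafifiedD(7)[OF m1[OF f] h True] sheafifiedD(4)[OF m1[OF f]] h by (auto intro!: locally_all)
    finally show ?thesis .
  next
    case False
    then show ?thesis using sheafifiedD(3)[OF m1[OF f]] f h by (auto simp: S_def)
  qed
  have "S \<in> sheafified x"
  proof (rule sheafifiedI)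
    fix h p assume hp: "(h, p) \<in> S"
    then have h: "h \<in> Arr A" "Cod A h = x" "p \<in> P (Dom A h)" and l: "locally (Dom A h) (L h p)"
      by (auto simp: S_def)
    show "h \<in> Arr A \<and> Cod A h = x \<and> p \<in> P (Dom A h)" using h by simp
    { fix k assume k: "k \<in> Arr A" "Cod A k = Dom A h"
      have "locally (Dom A k) (\<lambda>l. L h p (k \<cdot> l))" using locally_pull[OF k(1)] k l by simp
      then have "locally (Dom A k) (L (h \<cdot> k) (r k p))"
        by (subst locally_cong[OF Lpull]) (use h k in auto)
      then show "(h \<cdot> k, r k p) \<in> S" using h k by (simp add: S_def restriction_mem) }
    fix q assume "(h, q) \<in> S"
    then have q: "q \<in> P (Dom A h)" and l': "locally (Dom A h) (L h q)" by (auto simp: S_def)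
    show "locally (Dom A h) (\<lambda>k. r k p = r k q)"
    proof (rule locally_trans[OF _ locally_eq_stable[OF P] locally_conj[OF _ l l']])
      fix k assume k: "k \<in> Arr A" "Cod A k = Dom A h" "L h p k \<and> L h q k"
      have "locally (Dom A (Ident A (Dom A k))) (\<lambda>l. r l (r k p) = r l (r k q))"
        by (rule sheafifiedD(6)[OF m1[of "h \<cdot> k"]]) (use h k in \<open>auto simp: L_def\<close>)
      then show "locally (Dom A k) (\<lambda>l. r (k \<cdot> l) p = r (k \<cdot> l) q)"
        by (subst locally_cong[where Q = "\<lambda>l. r l (r k p) = r l (r k q)"]) (use h q k in \<open>auto simp: restriction_restriction\<close>)
    qed (use h q in auto)
  next
    show "locally x (\<lambda>h. \<exists>p. (h, p) \<in> S)"
    proof (rule locally_trans[OF x _ Q])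
      show "stable x (\<lambda>h. \<exists>p. (h, p) \<in> S)"
      proof (rule stableI)
        fix h k assume "h \<in> Arr A" "Cod A h = x" "\<exists>p. (h, p) \<in> S" and k: "k \<in> Arr A" "Cod A k = Dom A h"
        then obtain p where h: "h \<in> Arr A" "Cod A h = x" "p \<in> P (Dom A h)" and l: "locally (Dom A h) (L h p)"
          by (auto simp: S_def)
        have "locally (Dom A k) (\<lambda>l. L h p (k \<cdot> l))" using locally_pull[OF k(1)] k l by simp
        then have "locally (Dom A k) (L (h \<cdot> k) (r k p))"
          by (subst locally_cong[OF Lpull]) (use h k in auto)
        then have "(h \<cdot> k, r k p) \<in> S" using h k by (simp add: S_def restriction_mem)
        then show "\<exists>p. (h \<cdot> k, p) \<in> S" by blast
      qed
      fix f assume f: "f \<in> Arr A" "Cod A f = x" "Q f"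
      show "locally (Dom A f) (\<lambda>h. \<exists>p. (f \<cdot> h, p) \<in> S)"
        using sheafifiedD(5)[OF m1[OF f]] by (subst locally_cong[where Q = "\<lambda>h. \<exists>p. (h, p) \<in> m f"]) (use mem[OF f] in auto)
    qed
  next
    fix h p assume h: "h \<in> Arr A" "Cod A h = x" "p \<in> P (Dom A h)"
      and l: "locally (Dom A h) (\<lambda>k. (h \<cdot> k, r k p) \<in> S)"
    have "locally (Dom A h) (L h p)"
    proof (rule locally_trans[OF _ _ l])
      show "stable (Dom A h) (L h p)"
      proof (rule stableI)
        fix k l assume k: "k \<in> Arr A" "Cod A k = Dom A h" "L h p k" "l \<in> Arr A" "Cod A l = Dom A k"
        have Qk: "Q (h \<cdot> k)" and i: "(Ident A (Dom A k), r k p) \<in> m (h \<cdot> k)" using k by (auto simp: L_def)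
        have "(Ident A (Dom A k) \<cdot> l, r l (r k p)) \<in> m (h \<cdot> k)"
          by (rule sheafifiedD(4)[OF m1 i]) (use Qk h k in auto)
        then have "(Ident A (Dom A l), r l (r k p)) \<in> m ((h \<cdot> k) \<cdot> l)"
          by (subst id) (use Qk h k in auto)
        then show "L h p (k \<cdot> l)" using sQ[OF _ _ Qk, of l] h k by (simp add: L_def restriction_restriction)
      qed
      fix k assume k: "k \<in> Arr A" "Cod A k = Dom A h" "(h \<cdot> k, r k p) \<in> S"
      then have "locally (Dom A k) (L (h \<cdot> k) (r k p))" using h by (simp add: S_def)
      then show "locally (Dom A k) (\<lambda>l. L h p (k \<cdot> l))"
        by (subst (asm) locally_cong[OF Lpull]) (use h k in auto)
    qed (use h in auto)
    then show "(h, p) \<in> S" using h by (simp add: S_def)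
  qed
  moreover have "restrict_germs h S = m h" if h: "h \<in> Arr A" "Cod A h = x" "Q h" for h
  proof -
    have "(k, q) \<in> restrict_germs h S \<longleftrightarrow> (k, q) \<in> m h" for k q
      using mem[OF h, of k q] sheafifiedD(1,2)[OF m1[OF h], of k q] h by (auto simp: restrict_germs_def)
    then show ?thesis by auto
  qed
  ultimately show "\<exists>t\<in>sheafified x. \<forall>h\<in>Arr A. Cod A h = x \<and> Q h \<longrightarrow> restrict_germs h t = m h" by blast
qed

text \<open>
  The values of \<open>t\<close> at the germs of \<open>S\<close> form a matching family: germs over the same arrow are locally
  equal, and a sheaf does not distinguish between them.
\<close>

lemma sheafified_universal:
  assumes Y: "set_sheaf Y ry"
    and t: "\<And>z p. z \<in> Obj A \<Longrightarrow> p \<in> P z \<Longrightarrow> t z p \<in> Y z"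
    and nat: "\<And>f p. f \<in> Arr A \<Longrightarrow> p \<in> P (Cod A f) \<Longrightarrow> t (Dom A f) (r f p) = ry f (t (Cod A f) p)"
    and z: "z \<in> Obj A" and S: "S \<in> sheafified z"
  shows "\<exists>!y. y \<in> Y z \<and> (\<forall>h p. (h, p) \<in> S \<longrightarrow> ry h y = t (Dom A h) p)"
proof -
  note SD = sheafifiedD[OF S] and pY = set_presheafD[OF set_sheaf_presheaf[OF Y]]
  have eq: "t (Dom A h) p = t (Dom A h) q" if hp: "(h, p) \<in> S" "(h, q) \<in> S" for h p q
  proof (rule set_sheaf_eqI[OF Y _ _ _ SD(6)[OF hp]])
    note h = SD(1-3)[OF hp(1)] SD(3)[OF hp(2)]
    show "Dom A h \<in> Obj A" "t (Dom A h) p \<in> Y (Dom A h)" "t (Dom A h) q \<in> Y (Dom A h)" using h t by auto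
    fix k assume k: "k \<in> Arr A" "Cod A k = Dom A h" "r k p = r k q"
    then show "ry k (t (Dom A h) p) = ry k (t (Dom A h) q)"
      using nat[of k p] nat[of k q] h by simp
  qed
  define m where "m h = t (Dom A h) (SOME p. (h, p) \<in> S)" for h
  have m: "m h = t (Dom A h) p" if "(h, p) \<in> S" for h p
    unfolding m_def by (rule eq[OF someI that]) (rule that)
  obtain y where y: "y \<in> Y z" "\<And>h. h \<in> Arr A \<Longrightarrow> Cod A h = z \<Longrightarrow> \<exists>p. (h, p) \<in> S \<Longrightarrow> ry h y = m h"
  proof (rule set_sheaf_glue[OF Y z SD(5), of m])
    fix h assume h: "h \<in> Arr A" "Cod A h = z" "\<exists>p. (h, p) \<in> S"
    then obtain p where p: "(h, p) \<in> S" by blast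
    show "m h \<in> Y (Dom A h)" using m[OF p] t[OF _ SD(3)[OF p]] h by simp
    fix k assume k: "k \<in> Arr A" "Cod A k = Dom A h"
    show "ry k (m h) = m (h \<cdot> k)"
      using m[OF p] m[OF SD(4)[OF p k]] nat[OF k(1), of p] SD(3)[OF p] h k by simp
  qed blast
  show ?thesis
  proof (rule ex1I[of _ y])
    show "y \<in> Y z \<and> (\<forall>h p. (h, p) \<in> S \<longrightarrow> ry h y = t (Dom A h) p)"
      using y m SD(1,2) by metis
    fix y' assume y': "y' \<in> Y z \<and> (\<forall>h p. (h, p) \<in> S \<longrightarrow> ry h y' = t (Dom A h) p)"
    show "y' = y"
    proof (rule set_sheaf_eqI[OF Y z _ y(1) SD(5)])
      fix h assume h: "h \<in> Arr A" "Cod A h = z" "\<exists>p. (h, p) \<in> S"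
      then obtain p where "(h, p) \<in> S" by blast
      then show "ry h y' = ry h y" using y(2)[OF h] y' m by simp
    qed (use y' in blast)
  qed
qed

end

end

end

context subcanonical_site
begin

section \<open>Fibre products and coproducts of sheaves\<close>

text \<open>
  Sections of the pullback are pairs of sections; they fit into the infinite set \<open>UNIV :: 'u set\<close>.
\<close>

lemma pullback_exists:
  assumes f: "f \<in> hom Sheaves F G" and g: "g \<in> hom Sheaves X (G :: ('o, 'm, 'u) presheaf)"
  obtains p q where "is_pullback Sheaves f g p q"
proof -
  note F = sheaf_homD(1)[OF f] and X = sheaf_homD(1)[OF g] and G = sheaf_homD(2)[OF f]
  note sF = sheaf_set_sheaf[OF F] and sX = sheaf_set_sheaf[OF X]
  have "(UNIV :: ('u \<times> 'u) set) \<lesssim> (UNIV :: 'u set)"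
    using infinite_times_self_eqpoll[OF infinite_values] by (simp add: eqpoll_imp_lepoll)
  then obtain c :: "'u \<times> 'u \<Rightarrow> 'u" where c: "inj c" by (auto simp: lepoll_def)
  define Y where "Y z = {(s, t). s \<in> FO F z \<and> t \<in> FO X z \<and> app f z s = app g z t}" for z
  define rY where "rY h = map_prod (res F h) (res X h)" for h
  have "set_sheaf Y rY"
  proof (rule set_sheafI)
    show "set_presheaf Y rY"
      unfolding set_presheaf_def
    proof (intro conjI ballI impI)
      fix k w assume k: "k \<in> Arr A" "w \<in> Y (Cod A k)"
      then show "rY k w \<in> Y (Dom A k)"
        using sheaf_res(1)[OF F k(1)] sheaf_res(1)[OF X k(1)] sheaf_homD(5)[OF f k(1)] sheaf_homD(5)[OF g k(1)]
        by (auto simp: Y_def rY_def)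
    qed (auto simp: Y_def rY_def sheaf_res[OF F] sheaf_res[OF X])
  next
    fix x w w' assume x: "x \<in> Obj A" "w \<in> Y x" "w' \<in> Y x" and l: "locally x (\<lambda>h. rY h w = rY h w')"
    have "fst w = fst w'"
      by (rule set_sheaf_eqI[OF sF x(1) _ _ l]) (use x in \<open>auto simp: Y_def rY_def\<close>)
    moreover have "snd w = snd w'"
      by (rule set_sheaf_eqI[OF sX x(1) _ _ l]) (use x in \<open>auto simp: Y_def rY_def\<close>)
    ultimately show "w = w'" by (rule prod_eqI)
  next
    fix x Q m assume x: "x \<in> Obj A" and Q: "locally x Q" and m: "\<forall>h\<in>Arr A. Cod A h = x \<and> Q h \<longrightarrow>
      m h \<in> Y (Dom A h) \<and> (\<forall>k\<in>Arr A. Cod A k = Dom A h \<longrightarrow> rY k (m h) = m (h \<cdot> k))"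
    have m1: "fst (m h) \<in> FO F (Dom A h)" "snd (m h) \<in> FO X (Dom A h)"
      "app f (Dom A h) (fst (m h)) = app g (Dom A h) (snd (m h))"
      if "h \<in> Arr A" "Cod A h = x" "Q h" for h using m that by (auto simp: Y_def)
    have m2: "rY k (m h) = m (h \<cdot> k)" if "h \<in> Arr A" "Cod A h = x" "Q h" "k \<in> Arr A" "Cod A k = Dom A h"
      for h k using m that by blast
    have m3: "res F k (fst (m h)) = fst (m (h \<cdot> k))" "res X k (snd (m h)) = snd (m (h \<cdot> k))"
      if "h \<in> Arr A" "Cod A h = x" "Q h" "k \<in> Arr A" "Cod A k = Dom A h" for h k
      unfolding m2[OF that, symmetric] by (simp_all add: rY_def)
    obtain s where s: "s \<in> FO F x" "\<And>h. h \<in> Arr A \<Longrightarrow> Cod A h = x \<Longrightarrow> Q h \<Longrightarrow> res F h s = fst (m h)"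
      by (rule set_sheaf_glue[OF sF x Q, of "\<lambda>h. fst (m h)"]) (use m1 m3 in auto)
    obtain t where t: "t \<in> FO X x" "\<And>h. h \<in> Arr A \<Longrightarrow> Cod A h = x \<Longrightarrow> Q h \<Longrightarrow> res X h t = snd (m h)"
      by (rule set_sheaf_glue[OF sX x Q, of "\<lambda>h. snd (m h)"]) (use m1 m3 in auto)
    have "app f x s = app g x t"
    proof (rule set_sheaf_eqI[OF sheaf_set_sheaf[OF G] x _ _ Q])
      fix h assume h: "h \<in> Arr A" "Cod A h = x" "Q h"
      then show "res G h (app f x s) = res G h (app g x t)"
        using sheaf_homD(5)[OF f h(1), of s] sheaf_homD(5)[OF g h(1), of t] s t m1[OF h] by simp
    qed (use s t sheaf_homD(4)[OF f x] sheaf_homD(4)[OF g x] in auto)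
    then have "(s, t) \<in> Y x" using s t by (simp add: Y_def)
    moreover have "\<forall>h\<in>Arr A. Cod A h = x \<and> Q h \<longrightarrow> rY h (s, t) = m h"
      using s t by (simp add: rY_def)
    ultimately show "\<exists>t\<in>Y x. \<forall>h\<in>Arr A. Cod A h = x \<and> Q h \<longrightarrow> rY h t = m h" by blast
  qed
  then have S: "set_sheaf (\<lambda>z. c ` Y z) (\<lambda>h w. c (rY h (inv c w)))"
    by (rule set_sheaf_transport) (simp add: c)
  define P where "P = presheaf_of (\<lambda>z. c ` Y z) (\<lambda>h w. c (rY h (inv c w)))"
  have P: "is_sheaf A T P" unfolding P_def by (rule presheaf_of_sheaf[OF S])
  have FOP: "FO P z = c ` Y z" for z by (simp add: P_def)
  have resP: "inv c (res P h w) = rY h (inv c w)" if "w \<in> FO P (Cod A h)" for h w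
    using that c unfolding FOP by (simp add: P_def)
  have inP: "fst (inv c w) \<in> FO F z \<and> snd (inv c w) \<in> FO X z \<and>
      app f z (fst (inv c w)) = app g z (snd (inv c w))" if "w \<in> FO P z" for w z
    using that c by (auto simp: FOP Y_def)
  have p: "arr_of P (\<lambda>z w. fst (inv c w)) F \<in> hom Sheaves P F"
    by (rule arr_of_hom[OF P F]) (use inP in \<open>auto simp: resP rY_def\<close>)
  have q: "arr_of P (\<lambda>z w. snd (inv c w)) X \<in> hom Sheaves P X"
    by (rule arr_of_hom[OF P X]) (use inP in \<open>auto simp: resP rY_def\<close>)
  have "is_pullback Sheaves f g (arr_of P (\<lambda>z w. fst (inv c w)) F) (arr_of P (\<lambda>z w. snd (inv c w)) X)"
  proof (rule pullback_of_sectionsI[OF f g p q])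
    fix z s t assume z: "z \<in> Obj A" and st: "s \<in> FO F z" "t \<in> FO X z" "app f z s = app g z t"
    then have "c (s, t) \<in> FO P z" by (auto simp: FOP Y_def)
    then show "\<exists>w\<in>FO P z. app (arr_of P (\<lambda>z w. fst (inv c w)) F) z w = s \<and>
        app (arr_of P (\<lambda>z w. snd (inv c w)) X) z w = t"
      by (rule bexI[rotated]) (use \<open>c (s, t) \<in> FO P z\<close> z c in simp)
  next
    fix z w w' assume "z \<in> Obj A" "w \<in> FO P z" "w' \<in> FO P z"
      "app (arr_of P (\<lambda>z w. fst (inv c w)) F) z w = app (arr_of P (\<lambda>z w. fst (inv c w)) F) z w'"
      "app (arr_of P (\<lambda>z w. snd (inv c w)) X) z w = app (arr_of P (\<lambda>z w. snd (inv c w)) X) z w'"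
    then show "w = w'" using c by (auto simp: FOP)
  qed (use inP in auto)
  then show thesis by (rule that)
qed

text \<open>
  The coproduct is the sheafification of the disjoint union of the representable presheaves, whose
  elements over \<open>z\<close> are the pairs of an index \<open>i\<close> and an arrow \<open>z \<rightarrow> x i\<close>.
\<close>

lemma coproduct_of_representables_exists:
  assumes I: "I \<subseteq> Arr A" and x: "\<And>i. i \<in> I \<Longrightarrow> x i \<in> Obj A"
  obtains Q and j :: "'m \<Rightarrow> ('o, 'm, 'u) presheaf_arr" where "is_coproduct Sheaves I (\<lambda>i. Rep (x i)) Q j"
proof -
  define P where "P z = {(i, y). i \<in> I \<and> y \<in> hom A z (x i)}" for z
  define r where "r f = (\<lambda>(i :: 'm, y). (i, y \<cdot> f))" for f
  have P: "set_presheaf P r"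
    unfolding set_presheaf_def by (auto simp: P_def r_def hom_def)
  define Sec where "Sec = sheafified P r"
  define unit where "unit z p = germs_of P r z p" for z p
  have "set_sheaf Sec restrict_germs" unfolding Sec_def by (rule sheafified_set_sheaf[OF P])
  \<comment> \<open>A germ consists of an arrow, an index and a further arrow.\<close>
  define B where "B = Arr A \<times> (Arr A \<times> Arr A)"
  have "Pow B \<lesssim> (UNIV :: 'u set)"
  proof (cases "finite (Arr A)")
    case True
    then have "finite (Pow B)" by (simp add: B_def)
    then show ?thesis using infinite_values by (rule finite_lepoll_infinite[rotated])
  next
    case False
    then have 2: "Arr A \<times> Arr A \<lesssim> Arr A" by (simp add: eqpoll_imp_lepoll infinite_times_self_eqpoll)
    then have "B \<lesssim> Arr A \<times> Arr A" unfolding B_def by (intro times_lepoll_mono) auto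
    then have "B \<lesssim> Arr A" using 2 by (rule lepoll_trans)
    then show ?thesis using large_values by (blast intro: lepoll_trans Pow_lepoll_mono)
  qed
  then obtain e :: "('m \<times> 'm \<times> 'm) set \<Rightarrow> 'u" where e: "inj_on e (Pow B)" by (auto simp: lepoll_def)
  have SecB: "S \<in> Sec z \<Longrightarrow> S \<in> Pow B" for S z
    unfolding Sec_def sheafified_def using I by (auto simp: B_def P_def hom_def)
  define d where "d = inv_into (Pow B) e"
  have d[simp]: "d (e S) = S" if "S \<in> Sec z" for S z
    unfolding d_def by (rule inv_into_f_f[OF e SecB[OF that]])
  have S: "set_sheaf (\<lambda>z. e ` Sec z) (\<lambda>h w. e (restrict_germs h (d w)))"
    by (rule set_sheaf_transport[OF \<open>set_sheaf Sec restrict_germs\<close>]) simp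
  define Q where "Q = presheaf_of (\<lambda>z. e ` Sec z) (\<lambda>h w. e (restrict_germs h (d w)))"
  have Q: "is_sheaf A T Q" unfolding Q_def by (rule presheaf_of_sheaf[OF S])
  have FOQ: "FO Q z = e ` Sec z" for z by (simp add: Q_def)
  have resQ: "res Q h (e S) = e (restrict_germs h S)" if "S \<in> Sec (Cod A h)" for h S
    unfolding Q_def using that by simp
  have unitS: "unit z p \<in> Sec z" if "z \<in> Obj A" "p \<in> P z" for z p
    unfolding unit_def Sec_def by (rule germs_of_sheafified[OF P that])
  have unit_res: "restrict_germs h (unit (Cod A h) p) = unit (Dom A h) (r h p)"
    if h: "h \<in> Arr A" and p: "p \<in> P (Cod A h)" for h p
  proof -
    have rp: "r h p \<in> P (Dom A h)" using set_presheafD(1)[OF P h p] .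
    have "(h, r h p) \<in> unit (Cod A h) p" unfolding unit_def germs_of_def
      using h rp by (auto intro!: locally_all)
    then show ?thesis
      using mem_sheafified_iff[OF P unitS[unfolded Sec_def] h _ rp] h p by (simp add: unit_def)
  qed
  define j where "j i = arr_of (Rep (x i)) (\<lambda>z s. e (unit z (i, decode A s))) Q" for i
  have Psec: "(i, h) \<in> P z" if "i \<in> I" "h \<in> Arr A" "Dom A h = z" "Cod A h = x i" for i h z
    using that by (simp add: P_def hom_def)
  have j: "j i \<in> hom Sheaves (Rep (x i)) Q" if i: "i \<in> I" for i
    unfolding j_def
  proof (rule arr_of_hom[OF representable_sheaf[OF x[OF i]] Q])
    fix z s assume "z \<in> Obj A" "s \<in> FO (Rep (x i)) z"
    then show "e (unit z (i, decode A s)) \<in> FO Q z"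
      using i by (auto elim!: Rep_section simp: FOQ intro!: imageI unitS Psec)
  next
    fix f s assume f: "f \<in> Arr A" "s \<in> FO (Rep (x i)) (Cod A f)"
    then obtain h where h: "h \<in> Arr A" "Dom A h = Cod A f" "Cod A h = x i" "s = enc h"
      by (auto elim: Rep_section)
    have ih: "(i, h) \<in> P (Cod A f)" using Psec[OF i h(1-3)] .
    show "e (unit (Dom A f) (i, decode A (res (Rep (x i)) f s))) = res Q f (e (unit (Cod A f) (i, decode A s)))"
      using f h unit_res[OF f(1) ih] unitS[OF _ ih] by (simp add: resQ r_def)
  qed
  have jval: "app (j i) z (enc h) = e (unit z (i, h))"
    if "i \<in> I" "h \<in> Arr A" "Dom A h = z" "Cod A h = x i" for i h z
    unfolding j_def using that by auto
  have "\<exists>!h. h \<in> hom Sheaves Q Y \<and> (\<forall>i\<in>I. Comp Sheaves h (j i) = f i)"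
    if Y: "is_sheaf A T Y" and f: "\<And>i. i \<in> I \<Longrightarrow> f i \<in> hom Sheaves (Rep (x i)) Y" for Y f
  proof -
    define t where "t z = (\<lambda>(i, y). app (f i) z (enc y))" for z
    have t1: "t z p \<in> FO Y z" if "z \<in> Obj A" "p \<in> P z" for z p
      using that sheaf_homD(4)[OF f] by (auto simp: t_def P_def hom_def)
    have t2: "t (Dom A k) (r k p) = res Y k (t (Cod A k) p)" if k: "k \<in> Arr A" and p: "p \<in> P (Cod A k)" for k p
    proof -
      obtain i y where p: "p = (i, y)" "i \<in> I" "y \<in> Arr A" "Dom A y = Cod A k" "Cod A y = x i"
        using p by (auto simp: P_def hom_def)
      show ?thesis using sheaf_homD(5)[OF f[OF p(2)] k, of "enc y"] p k by (simp add: t_def r_def)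
    qed
    note sY = sheaf_set_sheaf[OF Y]
    have univ: "\<exists>!y. y \<in> FO Y z \<and> (\<forall>h p. (h, p) \<in> S \<longrightarrow> res Y h y = t (Dom A h) p)"
      if z: "z \<in> Obj A" and S: "S \<in> Sec z" for z S
      by (rule sheafified_universal[OF P sY _ _ z S[unfolded Sec_def]]) (fact t1 t2)+
    define v where "v z S = (THE y. y \<in> FO Y z \<and> (\<forall>h p. (h, p) \<in> S \<longrightarrow> res Y h y = t (Dom A h) p))" for z S
    have v: "v z S \<in> FO Y z" "(h, p) \<in> S \<Longrightarrow> res Y h (v z S) = t (Dom A h) p"
      if "z \<in> Obj A" "S \<in> Sec z" for z S h p
      using theI'[OF univ[OF that], folded v_def] by blast+
    have vI: "v z S = y" if "z \<in> Obj A" "S \<in> Sec z" "y \<in> FO Y z"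
      "\<And>h p. (h, p) \<in> S \<Longrightarrow> res Y h y = t (Dom A h) p" for z S y
      using univ[OF that(1,2)] v[OF that(1,2)] that(3,4) by blast
    have SecD: "h \<in> Arr A" "Cod A h = z" "p \<in> P (Dom A h)" if "S \<in> Sec z" "(h, p) \<in> S" for S z h p
      using that sheafifiedD(1-3)[of S P r z h p] by (auto simp: Sec_def)
    have vunit: "v z (unit z p) = t z p" if z: "z \<in> Obj A" and p: "p \<in> P z" for z p
    proof (rule vI[OF z unitS[OF z p] t1[OF z p]])
      fix h q assume "(h, q) \<in> unit z p"
      then have h: "h \<in> Arr A" "Cod A h = z" "q \<in> P (Dom A h)" and l: "locally (Dom A h) (\<lambda>k. r k q = r k (r h p))"
        by (auto simp: unit_def germs_of_def)
      have rp: "r h p \<in> P (Dom A h)" using set_presheafD(1)[OF P h(1)] h p by simp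
      have "t (Dom A h) q = t (Dom A h) (r h p)"
      proof (rule set_sheaf_eqI[OF sY _ _ _ l])
        fix k assume k: "k \<in> Arr A" "Cod A k = Dom A h" "r k q = r k (r h p)"
        then show "res Y k (t (Dom A h) q) = res Y k (t (Dom A h) (r h p))"
          using t2[OF k(1), of q] t2[OF k(1), of "r h p"] h rp by simp
      qed (use h rp t1 in auto)
      then show "res Y h (t z p) = t (Dom A h) q" using t2[OF h(1)] h p by simp
    qed
    define H where "H = arr_of Q (\<lambda>z w. v z (d w)) Y"
    have H: "H \<in> hom Sheaves Q Y"
      unfolding H_def
    proof (rule arr_of_hom[OF Q Y])
      fix z s assume "z \<in> Obj A" "s \<in> FO Q z"
      then show "v z (d s) \<in> FO Y z" using v by (auto simp: FOQ)
    next
      fix k s assume k: "k \<in> Arr A" and "s \<in> FO Q (Cod A k)"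
      then obtain S where s: "s = e S" and S: "S \<in> Sec (Cod A k)" by (auto simp: FOQ)
      have kS: "restrict_germs k S \<in> Sec (Dom A k)"
        using restrict_germs_sheafified[OF P k] S by (simp add: Sec_def)
      have "v (Dom A k) (restrict_germs k S) = res Y k (v (Cod A k) S)"
      proof (rule vI[OF _ kS])
        fix h p assume "(h, p) \<in> restrict_germs k S"
        then have h: "h \<in> Arr A" "Cod A h = Dom A k" "(k \<cdot> h, p) \<in> S" by (auto simp: restrict_germs_def)
        show "res Y h (res Y k (v (Cod A k) S)) = t (Dom A h) p"
          using v(2)[OF _ S h(3)] sheaf_res(3)[OF Y k h(1)] v(1)[OF _ S] h k by simp
      qed (use k v(1)[OF _ S] sheaf_res(1)[OF Y k] in auto)
      then show "v (Dom A k) (d (res Q k s)) = res Y k (v (Cod A k) (d s))"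
        using S kS by (simp add: s resQ)
    qed
    have Hval: "app H z (e S) = v z S" if "z \<in> Obj A" "S \<in> Sec z" for z S
      unfolding H_def using that by (simp add: FOQ)
    have Hj: "Comp Sheaves H (j i) = f i" if i: "i \<in> I" for i
    proof (rule sheaf_hom_eqI[OF sheaf_Comp(1)[OF j[OF i] H] f[OF i]])
      fix z s assume z: "z \<in> Obj A" "s \<in> FO (Rep (x i)) z"
      then obtain h where h: "h \<in> Arr A" "Dom A h = z" "Cod A h = x i" "s = enc h" by (auto elim: Rep_section)
      show "app (Comp Sheaves H (j i)) z s = app (f i) z s"
        using sheaf_Comp(2)[OF j[OF i] H z] jval[OF i h(1-3)] Hval[OF z(1) unitS] vunit Psec[OF i h(1-3)] z h
        by (simp add: t_def)
    qed
    show ?thesis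
    proof (rule ex1I[of _ H])
      show "H \<in> hom Sheaves Q Y \<and> (\<forall>i\<in>I. Comp Sheaves H (j i) = f i)" using H Hj by blast
      fix H' assume "H' \<in> hom Sheaves Q Y \<and> (\<forall>i\<in>I. Comp Sheaves H' (j i) = f i)"
      then have H': "H' \<in> hom Sheaves Q Y" and H'j: "\<And>i. i \<in> I \<Longrightarrow> Comp Sheaves H' (j i) = f i" by blast+
      show "H' = H"
      proof (rule sheaf_hom_eqI[OF H' H])
        fix z s assume z: "z \<in> Obj A" "s \<in> FO Q z"
        then obtain S where s: "s = e S" and S: "S \<in> Sec z" by (auto simp: FOQ)
        have "v z S = app H' z (e S)"
        proof (rule vI[OF z(1) S])
          show "app H' z (e S) \<in> FO Y z" using sheaf_homD(4)[OF H' z] s by simp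
          fix h p assume hp: "(h, p) \<in> S"
          note h = SecD[OF S hp]
          obtain i y where p: "p = (i, y)" "i \<in> I" "y \<in> Arr A" "Dom A y = Dom A h" "Cod A y = x i"
            using h(3) by (auto simp: P_def hom_def)
          have hS: "restrict_germs h S = unit (Dom A h) p"
            using mem_sheafified_iff[OF P S[unfolded Sec_def] h] hp by (simp add: unit_def)
          have "res Y h (app H' z (e S)) = app H' (Dom A h) (res Q h (e S))"
            using sheaf_homD(5)[OF H' h(1)] z h s by simp
          also have "\<dots> = app H' (Dom A h) (e (unit (Dom A h) (i, y)))" using S h hS p by (simp add: resQ)
          also have "\<dots> = app H' (Dom A h) (app (j i) (Dom A h) (enc y))" using jval[OF p(2-5)] by simp
          also have "\<dots> = app (Comp Sheaves H' (j i)) (Dom A h) (enc y)"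
            by (rule sheaf_Comp(2)[OF j[OF p(2)] H', symmetric]) (use h p in auto)
          also have "\<dots> = t (Dom A h) p" using H'j[OF p(2)] p by (simp add: t_def)
          finally show "res Y h (app H' z (e S)) = t (Dom A h) p" .
        qed
        then show "app H' z s = app H z s" using Hval[OF z(1) S] s by simp
      qed
    qed
  qed
  then have "is_coproduct Sheaves I (\<lambda>i. Rep (x i)) Q j"
    unfolding is_coproduct_def using Q j by auto
  then show thesis by (rule that)
qed

section \<open>Open immersions in terms of sections\<close>

text \<open>
  Since \<open>s \<cdot> k\<close> has to factor through a member of \<open>\<Phi>\<close> only for the arrows \<open>k\<close> of a covering, this is
  the condition for \<open>s\<close> to lie in the image of the coproduct of the objects represented by \<open>\<Phi>\<close>.
\<close>

definition locally_through :: "'m set \<Rightarrow> 'o \<Rightarrow> 'm \<Rightarrow> bool" where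
  "locally_through \<Phi> z s \<longleftrightarrow>
     locally z (\<lambda>k. \<exists>\<alpha>\<in>\<Phi>. \<exists>m\<in>Arr A. Cod A m = Dom A \<alpha> \<and> s \<cdot> k = \<alpha> \<cdot> m)"

definition open_sieve :: "('m \<Rightarrow> bool) \<Rightarrow> 'o \<Rightarrow> ('m \<Rightarrow> bool) \<Rightarrow> bool" where
  "open_sieve imm a P \<longleftrightarrow> (\<exists>\<Phi> \<subseteq> {\<alpha> \<in> Arr A. Cod A \<alpha> = a}. (\<forall>\<alpha>\<in>\<Phi>. imm \<alpha>) \<and>
     (\<forall>s\<in>Arr A. Cod A s = a \<longrightarrow> (P s \<longleftrightarrow> locally_through \<Phi> (Dom A s) s)))"

text \<open>
  Zariski open subsheaves and open immersions on an arbitrary subcanonical site; \<open>imm\<close> stands for the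
  class of spectral immersions.
\<close>

definition open_subsheaf :: "('m \<Rightarrow> bool) \<Rightarrow> 'o \<Rightarrow> ('o, 'm, 'u) presheaf \<Rightarrow> bool" where
  "open_subsheaf imm a F \<longleftrightarrow> inclusion A F (Rep a) \<in> hom Sheaves F (Rep a) \<and>
     (\<exists>\<Phi> \<subseteq> {\<alpha> \<in> Arr A. Cod A \<alpha> = a}. (\<forall>\<alpha>\<in>\<Phi>. imm \<alpha>) \<and>
        (\<exists>Q j u. is_coproduct Sheaves \<Phi> (\<lambda>\<alpha>. Rep (Dom A \<alpha>)) Q j \<and> u \<in> hom Sheaves Q (Rep a) \<and>
           (\<forall>\<alpha>\<in>\<Phi>. u \<cdot>\<^bsub>Sheaves\<^esub> j \<alpha> = representable_map A \<alpha>) \<and>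
           is_image Sheaves u (inclusion A F (Rep a))))"

definition open_immersion :: "('m \<Rightarrow> bool) \<Rightarrow> ('o, 'm, 'u) presheaf_arr \<Rightarrow> bool" where
  "open_immersion imm f \<longleftrightarrow> f \<in> Arr Sheaves \<and>
     (\<forall>a\<in>Obj A. \<forall>g \<in> hom Sheaves (Rep a) (Cod Sheaves f). \<forall>p q. is_pullback Sheaves f g p q \<longrightarrow>
        is_mono Sheaves q \<and>
        (\<exists>F. is_image Sheaves q (inclusion A F (Rep a)) \<and> open_subsheaf imm a F))"

lemma Comp_eq_Dom:
  assumes "s \<cdot> k = \<alpha> \<cdot> m" "s \<in> Arr A" "k \<in> Arr A" "Cod A k = Dom A s"
    "\<alpha> \<in> Arr A" "m \<in> Arr A" "Cod A m = Dom A \<alpha>"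
  shows "Dom A m = Dom A k"
  using assms by (metis Comp_Arr(2))

lemma open_sieve_cong:
  "(\<And>s. s \<in> Arr A \<Longrightarrow> Cod A s = a \<Longrightarrow> P s = P' s) \<Longrightarrow> open_sieve imm a P = open_sieve imm a P'"
  by (simp add: open_sieve_def)

lemma inclusion_arr_of: "inclusion A F X = arr_of F (\<lambda>z. id) X"
  by (simp add: inclusion_def arr_of_def)

lemma inclusion_injective:
  "injective_on_sections (inclusion A F X)"
  by (auto simp: injective_on_sections_def inclusion_arr_of arr_of_ends inj_on_def)

lemma app_inclusion [simp]: "z \<in> Obj A \<Longrightarrow> s \<in> FO F z \<Longrightarrow> app (inclusion A F X) z s = s"
  by (simp add: inclusion_arr_of)

lemma subsheaf:
  assumes X: "is_sheaf A T X" and YX: "\<And>z. z \<in> Obj A \<Longrightarrow> Y z \<subseteq> FO X z"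
    and res: "\<And>f s. f \<in> Arr A \<Longrightarrow> s \<in> Y (Cod A f) \<Longrightarrow> res X f s \<in> Y (Dom A f)"
    and loc: "\<And>z s. z \<in> Obj A \<Longrightarrow> s \<in> FO X z \<Longrightarrow> locally z (\<lambda>h. res X h s \<in> Y (Dom A h)) \<Longrightarrow> s \<in> Y z"
  shows "inclusion A (presheaf_of Y (res X)) X \<in> hom Sheaves (presheaf_of Y (res X)) X"
proof -
  have "set_sheaf Y (res X)"
    by (rule set_sheaf_sub[OF sheaf_set_sheaf[OF X] YX res loc])
  then have "is_sheaf A T (presheaf_of Y (res X))" by (rule presheaf_of_sheaf)
  then show ?thesis
    unfolding inclusion_arr_of by (rule arr_of_hom[OF _ X]) (use YX in auto)
qed

lemma representable_map:
  assumes \<alpha>: "\<alpha> \<in> Arr A"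
  shows "representable_map A \<alpha> \<in> hom Sheaves (Rep (Dom A \<alpha>)) (Rep (Cod A \<alpha>))"
    "m \<in> Arr A \<Longrightarrow> Cod A m = Dom A \<alpha> \<Longrightarrow> app (representable_map A \<alpha>) (Dom A m) (enc m) = enc (\<alpha> \<cdot> m)"
proof -
  have eq: "representable_map A \<alpha> = arr_of (Rep (Dom A \<alpha>)) (\<lambda>z s. enc (\<alpha> \<cdot> decode A s)) (Rep (Cod A \<alpha>))"
    by (simp add: representable_map_def arr_of_def FO_Rep)
  show "representable_map A \<alpha> \<in> hom Sheaves (Rep (Dom A \<alpha>)) (Rep (Cod A \<alpha>))"
    unfolding eq using \<alpha> by (intro arr_of_hom representable_sheaf) (auto elim!: Rep_section)
  show "m \<in> Arr A \<Longrightarrow> Cod A m = Dom A \<alpha> \<Longrightarrow> app (representable_map A \<alpha>) (Dom A m) (enc m) = enc (\<alpha> \<cdot> m)"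
    unfolding eq using \<alpha> by simp
qed

lemma image_res:
  assumes n: "n \<in> hom Sheaves N X" and f: "f \<in> Arr A" and s: "s \<in> app n (Cod A f) ` FO N (Cod A f)"
  shows "res X f s \<in> app n (Dom A f) ` FO N (Dom A f)"
proof -
  obtain t where t: "t \<in> FO N (Cod A f)" "s = app n (Cod A f) t" using s by blast
  then have "res X f s = app n (Dom A f) (res N f t)" using sheaf_homD(5)[OF n f] by simp
  then show ?thesis using sheaf_res(1)[OF sheaf_homD(1)[OF n] f] t by blast
qed

text \<open>
  The image of an injective map of sheaves is closed under restriction and under gluing.
\<close>

lemma locally_through_image:
  assumes n: "n \<in> hom Sheaves N (Rep a)" and inj: "injective_on_sections n"
    and \<Phi>: "\<Phi> \<subseteq> {\<alpha> \<in> Arr A. Cod A \<alpha> = a}"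
    and n\<Phi>: "\<And>\<alpha>. \<alpha> \<in> \<Phi> \<Longrightarrow> enc \<alpha> \<in> app n (Dom A \<alpha>) ` FO N (Dom A \<alpha>)"
    and s: "s \<in> Arr A" "Cod A s = a" and l: "locally_through \<Phi> (Dom A s) s"
  shows "enc s \<in> app n (Dom A s) ` FO N (Dom A s)"
proof (rule image_of_injective_local[OF n inj])
  have z: "Dom A s \<in> Obj A" using s by simp
  show "locally (Dom A s) (\<lambda>k. res (Rep a) k (enc s) \<in> app n (Dom A k) ` FO N (Dom A k))"
  proof (rule locally_mono[OF z l[unfolded locally_through_def]])
    show "stable (Dom A s) (\<lambda>k. res (Rep a) k (enc s) \<in> app n (Dom A k) ` FO N (Dom A k))"
    proof (rule stableI)
      fix k l assume k: "k \<in> Arr A" "Cod A k = Dom A s"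
          "res (Rep a) k (enc s) \<in> app n (Dom A k) ` FO N (Dom A k)" "l \<in> Arr A" "Cod A l = Dom A k"
      then show "res (Rep a) (k \<cdot> l) (enc s) \<in> app n (Dom A (k \<cdot> l)) ` FO N (Dom A (k \<cdot> l))"
        using image_res[OF n k(4), of "res (Rep a) k (enc s)"] s by simp
    qed
    fix k assume k: "k \<in> Arr A" "Cod A k = Dom A s"
      "\<exists>\<alpha>\<in>\<Phi>. \<exists>m\<in>Arr A. Cod A m = Dom A \<alpha> \<and> s \<cdot> k = \<alpha> \<cdot> m"
    then obtain \<alpha> m where m: "\<alpha> \<in> \<Phi>" "m \<in> Arr A" "Cod A m = Dom A \<alpha>" "s \<cdot> k = \<alpha> \<cdot> m" by blast
    have \<alpha>: "\<alpha> \<in> Arr A" "Cod A \<alpha> = a" using m \<Phi> by auto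
    have Dm: "Dom A m = Dom A k" by (rule Comp_eq_Dom[OF m(4)]) (use s k m \<alpha> in auto)
    have "res (Rep a) m (enc \<alpha>) \<in> app n (Dom A m) ` FO N (Dom A m)"
      by (rule image_res[OF n m(2)]) (use n\<Phi>[OF m(1)] m in simp)
    then show "res (Rep a) k (enc s) \<in> app n (Dom A k) ` FO N (Dom A k)"
      using s k m \<alpha> Dm by simp
  qed
qed (use s in auto)

lemma stable_through:
  assumes \<Phi>: "\<Phi> \<subseteq> {\<alpha> \<in> Arr A. Cod A \<alpha> = a}" and s: "s \<in> Arr A"
  shows "stable (Dom A s) (\<lambda>k. \<exists>\<alpha>\<in>\<Phi>. \<exists>m\<in>Arr A. Cod A m = Dom A \<alpha> \<and> s \<cdot> k = \<alpha> \<cdot> m)"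
proof (rule stableI)
  fix k l assume k: "k \<in> Arr A" "Cod A k = Dom A s" "\<exists>\<alpha>\<in>\<Phi>. \<exists>m\<in>Arr A. Cod A m = Dom A \<alpha> \<and> s \<cdot> k = \<alpha> \<cdot> m"
    and l: "l \<in> Arr A" "Cod A l = Dom A k"
  then obtain \<alpha> m where m: "\<alpha> \<in> \<Phi>" "m \<in> Arr A" "Cod A m = Dom A \<alpha>" "s \<cdot> k = \<alpha> \<cdot> m" by blast
  have \<alpha>: "\<alpha> \<in> Arr A" using m \<Phi> by auto
  have Dm: "Dom A m = Dom A k" by (rule Comp_eq_Dom[OF m(4)]) (use s k m \<alpha> in auto)
  have "s \<cdot> (k \<cdot> l) = (s \<cdot> k) \<cdot> l" using s k l by simp
  also have "\<dots> = \<alpha> \<cdot> (m \<cdot> l)" unfolding m(4) using \<alpha> m l Dm by simp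
  finally show "\<exists>\<alpha>\<in>\<Phi>. \<exists>m\<in>Arr A. Cod A m = Dom A \<alpha> \<and> s \<cdot> (k \<cdot> l) = \<alpha> \<cdot> m"
    using m l Dm by (intro bexI[of _ \<alpha>] bexI[of _ "m \<cdot> l"]) auto
qed

lemma locally_through_member:
  assumes \<Phi>: "\<Phi> \<subseteq> {\<alpha> \<in> Arr A. Cod A \<alpha> = a}" and \<alpha>: "\<alpha> \<in> \<Phi>"
  shows "locally_through \<Phi> (Dom A \<alpha>) \<alpha>"
  unfolding locally_through_def using \<Phi> \<alpha> by (intro locally_all) auto

lemma locally_through_subsheaf:
  assumes \<Phi>: "\<Phi> \<subseteq> {\<alpha> \<in> Arr A. Cod A \<alpha> = a}" and a: "a \<in> Obj A"
  obtains L where "inclusion A L (Rep a) \<in> hom Sheaves L (Rep a)"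
    "\<And>s. s \<in> Arr A \<Longrightarrow> Cod A s = a \<Longrightarrow> enc s \<in> FO L (Dom A s) \<longleftrightarrow> locally_through \<Phi> (Dom A s) s"
proof -
  let ?t = "\<lambda>s k. \<exists>\<alpha>\<in>\<Phi>. \<exists>m\<in>Arr A. Cod A m = Dom A \<alpha> \<and> s \<cdot> k = \<alpha> \<cdot> m"
  define Y where "Y z = enc ` {s \<in> hom A z a. locally_through \<Phi> z s}" for z
  have mem: "enc s \<in> Y z \<longleftrightarrow> locally_through \<Phi> z s" if "s \<in> Arr A" "Cod A s = a" "Dom A s = z" for s z
    using that by (auto simp: Y_def hom_def)
  have pull: "locally_through \<Phi> (Dom A k) (s \<cdot> k) \<longleftrightarrow> locally (Dom A k) (\<lambda>l. ?t s (k \<cdot> l))"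
    if "s \<in> Arr A" "k \<in> Arr A" "Cod A k = Dom A s" for s k
    unfolding locally_through_def by (rule locally_cong) (use that in simp)
  have "inclusion A (presheaf_of Y (res (Rep a))) (Rep a) \<in> hom Sheaves (presheaf_of Y (res (Rep a))) (Rep a)"
  proof (rule subsheaf[OF representable_sheaf[OF a]])
    show "Y z \<subseteq> FO (Rep a) z" for z by (auto simp: Y_def FO_Rep)
  next
    fix f s assume f: "f \<in> Arr A" "s \<in> Y (Cod A f)"
    then obtain h where h: "h \<in> Arr A" "Dom A h = Cod A f" "Cod A h = a" "s = enc h"
      and l: "locally_through \<Phi> (Cod A f) h" by (auto simp: Y_def hom_def)
    have "locally (Dom A f) (\<lambda>l. ?t h (f \<cdot> l))"
      using locally_pull[OF f(1), of "?t h"] l unfolding locally_through_def by simp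
    then have "locally_through \<Phi> (Dom A f) (h \<cdot> f)" using pull[OF h(1) f(1)] h by simp
    then show "res (Rep a) f s \<in> Y (Dom A f)" using f h by (simp add: mem)
  next
    fix z s assume z: "z \<in> Obj A" "s \<in> FO (Rep a) z" and l: "locally z (\<lambda>k. res (Rep a) k s \<in> Y (Dom A k))"
    then obtain h where h: "h \<in> Arr A" "Dom A h = z" "Cod A h = a" "s = enc h" by (auto elim: Rep_section)
    have "locally z (?t h)"
    proof (rule locally_trans[OF z(1) _ l])
      show "stable z (?t h)" using stable_through[OF \<Phi> h(1)] h(2) by simp
      fix k assume k: "k \<in> Arr A" "Cod A k = z" "res (Rep a) k s \<in> Y (Dom A k)"
      then have "locally_through \<Phi> (Dom A k) (h \<cdot> k)" using h by (simp add: mem)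
      then show "locally (Dom A k) (\<lambda>l. ?t h (k \<cdot> l))" using pull[OF h(1) k(1)] k h by simp
    qed
    then show "s \<in> Y z" using h by (simp add: mem locally_through_def)
  qed
  then show thesis by (rule that) (simp add: mem)
qed

text \<open>
  By the Yoneda lemma the component \<open>\<alpha>\<close> of \<open>u\<close> factors through \<open>n\<close> if and only if the section \<open>\<alpha>\<close> lies in
  the image of \<open>n\<close>, and a map out of a coproduct is determined by its components.
\<close>

lemma coproduct_factors_iff:
  assumes \<Phi>: "\<Phi> \<subseteq> {\<alpha> \<in> Arr A. Cod A \<alpha> = a}"
    and Q: "is_coproduct Sheaves \<Phi> (\<lambda>\<alpha>. Rep (Dom A \<alpha>)) Q j" and u: "u \<in> hom Sheaves Q (Rep a)"
    and uj: "\<And>\<alpha>. \<alpha> \<in> \<Phi> \<Longrightarrow> Comp Sheaves u (j \<alpha>) = representable_map A \<alpha>"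
    and n: "n \<in> hom Sheaves N (Rep a)" and inj: "injective_on_sections n"
  shows "factors_through Sheaves u n \<longleftrightarrow> (\<forall>\<alpha>\<in>\<Phi>. enc \<alpha> \<in> app n (Dom A \<alpha>) ` FO N (Dom A \<alpha>))"
proof
  have \<Phi>': "\<alpha> \<in> Arr A" "Cod A \<alpha> = a" if "\<alpha> \<in> \<Phi>" for \<alpha> using \<Phi> that by auto
  have j: "j \<alpha> \<in> hom Sheaves (Rep (Dom A \<alpha>)) Q" if "\<alpha> \<in> \<Phi>" for \<alpha>
    using Q that by (simp add: is_coproduct_def)
  have ex1: "\<exists>!h. h \<in> hom Sheaves Q y \<and> (\<forall>\<alpha>\<in>\<Phi>. Comp Sheaves h (j \<alpha>) = f \<alpha>)"
    if "is_sheaf A T y" "\<forall>\<alpha>\<in>\<Phi>. f \<alpha> \<in> hom Sheaves (Rep (Dom A \<alpha>)) y" for y f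
    using Q[unfolded is_coproduct_def, THEN conjunct2, THEN conjunct2, rule_format, of y f] that by simp
  { assume *: "factors_through Sheaves u n"
    show "\<forall>\<alpha>\<in>\<Phi>. enc \<alpha> \<in> app n (Dom A \<alpha>) ` FO N (Dom A \<alpha>)"
    proof
      fix \<alpha> assume \<alpha>: "\<alpha> \<in> \<Phi>"
      have I: "enc (Ident A (Dom A \<alpha>)) \<in> FO (Rep (Dom A \<alpha>)) (Dom A \<alpha>)" using \<Phi>'[OF \<alpha>] by simp
      have "app u (Dom A \<alpha>) (app (j \<alpha>) (Dom A \<alpha>) (enc (Ident A (Dom A \<alpha>)))) = enc \<alpha>"
        using sheaf_Comp(2)[OF j[OF \<alpha>] u _ I] uj[OF \<alpha>] \<Phi>'[OF \<alpha>]
          representable_map(2)[of \<alpha> "Ident A (Dom A \<alpha>)"] by simp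
      then show "enc \<alpha> \<in> app n (Dom A \<alpha>) ` FO N (Dom A \<alpha>)"
        using factors_through_iff[OF u n inj] * sheaf_homD(4)[OF j[OF \<alpha>] _ I] \<Phi>'[OF \<alpha>] by (metis Dom_Obj)
    qed }
  assume *: "\<forall>\<alpha>\<in>\<Phi>. enc \<alpha> \<in> app n (Dom A \<alpha>) ` FO N (Dom A \<alpha>)"
  have "\<exists>g. g \<in> hom Sheaves (Rep (Dom A \<alpha>)) N \<and> representable_map A \<alpha> = Comp Sheaves n g" if \<alpha>: "\<alpha> \<in> \<Phi>" for \<alpha>
  proof -
    note r = representable_map[OF \<Phi>'(1)[OF \<alpha>], unfolded \<Phi>'(2)[OF \<alpha>]]
    have "factors_through Sheaves (representable_map A \<alpha>) n"
      unfolding factors_through_iff[OF r(1) n inj]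
    proof (intro ballI)
      fix z s assume "z \<in> Obj A" "s \<in> FO (Rep (Dom A \<alpha>)) z"
      then obtain m where m: "m \<in> Arr A" "Dom A m = z" "Cod A m = Dom A \<alpha>" "s = enc m" by (auto elim: Rep_section)
      have "res (Rep a) m (enc \<alpha>) \<in> app n (Dom A m) ` FO N (Dom A m)"
        by (rule image_res[OF n m(1)]) (use * \<alpha> m in simp)
      then show "app (representable_map A \<alpha>) z s \<in> app n z ` FO N z"
        using r(2)[OF m(1,3)] m \<Phi>'[OF \<alpha>] by simp
    qed
    then show ?thesis
      using sheaf_hom_ends[OF r(1)] sheaf_hom_ends[OF n] by (auto simp: factors_through_def)
  qed
  then obtain g where g: "\<And>\<alpha>. \<alpha> \<in> \<Phi> \<Longrightarrow> g \<alpha> \<in> hom Sheaves (Rep (Dom A \<alpha>)) N"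
    "\<And>\<alpha>. \<alpha> \<in> \<Phi> \<Longrightarrow> representable_map A \<alpha> = Comp Sheaves n (g \<alpha>)" by metis
  obtain h where h: "h \<in> hom Sheaves Q N" "\<And>\<alpha>. \<alpha> \<in> \<Phi> \<Longrightarrow> Comp Sheaves h (j \<alpha>) = g \<alpha>"
    using ex1[OF sheaf_homD(1)[OF n], of g] g by blast
  have nh: "Comp Sheaves n h \<in> hom Sheaves Q (Rep a)" by (rule sheaf_Comp(1)[OF h(1) n])
  have "Comp Sheaves (Comp Sheaves n h) (j \<alpha>) = representable_map A \<alpha>" if \<alpha>: "\<alpha> \<in> \<Phi>" for \<alpha>
    unfolding g(2)[OF \<alpha>]
    by (rule sheaf_hom_eqI[OF sheaf_Comp(1)[OF j[OF \<alpha>] nh] sheaf_Comp(1)[OF g(1)[OF \<alpha>] n]])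
      (simp add: sheaf_Comp(2)[OF j[OF \<alpha>] nh] sheaf_Comp(2)[OF h(1) n] sheaf_Comp(2)[OF g(1)[OF \<alpha>] n]
        sheaf_homD(4)[OF j[OF \<alpha>]] sheaf_Comp(2)[OF j[OF \<alpha>] h(1), unfolded h(2)[OF \<alpha>]])
  then have "u = Comp Sheaves n h"
    using ex1[OF sheaf_homD(2)[OF u], of "representable_map A"] u uj nh \<Phi>' representable_map(1) by metis
  then show "factors_through Sheaves u n"
    using h(1) sheaf_hom_ends[OF u] sheaf_hom_ends[OF n] by (auto simp: factors_through_def)
qed

text \<open>
  A subsheaf through which \<open>u\<close> factors contains \<open>\<Phi>\<close> and, being closed under gluing, all arrows that
  factor locally through \<open>\<Phi>\<close>; conversely these arrows form a subsheaf through which \<open>u\<close> factors.  The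
  image of \<open>u\<close> is therefore this subsheaf.
\<close>

lemma open_subsheaf_iff:
  assumes a: "a \<in> Obj A"
  shows "open_subsheaf imm a F \<longleftrightarrow> inclusion A F (Rep a) \<in> hom Sheaves F (Rep a) \<and>
     open_sieve imm a (\<lambda>s. enc s \<in> FO F (Dom A s))"
    (is "?L \<longleftrightarrow> ?R")
proof (cases "inclusion A F (Rep a) \<in> hom Sheaves F (Rep a)")
  case True
  define i where "i = inclusion A F (Rep a)"
  have i: "i \<in> hom Sheaves F (Rep a)" and i_inj: "injective_on_sections i"
    and i_app: "\<And>z s. z \<in> Obj A \<Longrightarrow> s \<in> FO F z \<Longrightarrow> app i z s = s"
    using True inclusion_injective by (auto simp: i_def)
  have i_im: "app i z ` FO F z = FO F z" if "z \<in> Obj A" for z using i_app[OF that] by force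
  show ?thesis
  proof
    assume ?L
    then obtain \<Phi> Q j u where \<Phi>: "\<Phi> \<subseteq> {\<alpha> \<in> Arr A. Cod A \<alpha> = a}" "\<forall>\<alpha>\<in>\<Phi>. imm \<alpha>"
      and Q: "is_coproduct Sheaves \<Phi> (\<lambda>\<alpha>. Rep (Dom A \<alpha>)) Q j" and u: "u \<in> hom Sheaves Q (Rep a)"
      and uj: "\<And>\<alpha>. \<alpha> \<in> \<Phi> \<Longrightarrow> Comp Sheaves u (j \<alpha>) = representable_map A \<alpha>"
      and im: "is_image Sheaves u i" unfolding open_subsheaf_def i_def by blast
    note fac = coproduct_factors_iff[OF \<Phi>(1) Q u uj]
    have "factors_through Sheaves u i" using im by (simp add: is_image_def)
    then have F\<Phi>: "\<And>\<alpha>. \<alpha> \<in> \<Phi> \<Longrightarrow> enc \<alpha> \<in> app i (Dom A \<alpha>) ` FO F (Dom A \<alpha>)" using fac[OF _ i i_inj] by blast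
    have "enc s \<in> FO F (Dom A s) \<longleftrightarrow> locally_through \<Phi> (Dom A s) s" if s: "s \<in> Arr A" "Cod A s = a" for s
    proof
      assume "locally_through \<Phi> (Dom A s) s"
      then show "enc s \<in> FO F (Dom A s)"
        using locally_through_image[OF i i_inj \<Phi>(1) F\<Phi> s] i_im s by simp
    next
      assume sF: "enc s \<in> FO F (Dom A s)"
      obtain L where L: "inclusion A L (Rep a) \<in> hom Sheaves L (Rep a)"
        and LL: "\<And>s. s \<in> Arr A \<Longrightarrow> Cod A s = a \<Longrightarrow> enc s \<in> FO L (Dom A s) \<longleftrightarrow> locally_through \<Phi> (Dom A s) s"
        using locally_through_subsheaf[OF \<Phi>(1) a] by blast
      define l where "l = inclusion A L (Rep a)"
      have l: "l \<in> hom Sheaves L (Rep a)" "injective_on_sections l" using L inclusion_injective by (auto simp: l_def)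
      have l_im: "app l z ` FO L z = FO L z" if "z \<in> Obj A" for z using app_inclusion[OF that] by (force simp: l_def)
      have "factors_through Sheaves u l"
      proof (subst fac[OF _ l], assumption, intro ballI)
        fix \<alpha> assume \<alpha>: "\<alpha> \<in> \<Phi>"
        then have "enc \<alpha> \<in> FO L (Dom A \<alpha>)" using LL locally_through_member[OF \<Phi>(1) \<alpha>] \<Phi> by auto
        then show "enc \<alpha> \<in> app l (Dom A \<alpha>) ` FO L (Dom A \<alpha>)" using l_im \<alpha> \<Phi> by auto
      qed
      moreover have "is_mono Sheaves l" using mono_iff_injective_on_sections[OF l(1)] l(2) by simp
      moreover have "Cod Sheaves l = Cod Sheaves u" using sheaf_hom_ends[OF l(1)] sheaf_hom_ends[OF u] by simp
      ultimately have "factors_through Sheaves i l" using im unfolding is_image_def by blast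
      then have "app i (Dom A s) (enc s) \<in> app l (Dom A s) ` FO L (Dom A s)"
        using factors_through_iff[OF i l] s sF by simp
      then show "locally_through \<Phi> (Dom A s) s" using LL[OF s] l_im i_app sF s by simp
    qed
    then show ?R unfolding open_sieve_def using \<Phi> True by blast
  next
    assume ?R
    then obtain \<Phi> where \<Phi>: "\<Phi> \<subseteq> {\<alpha> \<in> Arr A. Cod A \<alpha> = a}" "\<forall>\<alpha>\<in>\<Phi>. imm \<alpha>"
      and sec: "\<And>s. s \<in> Arr A \<Longrightarrow> Cod A s = a \<Longrightarrow> (enc s \<in> FO F (Dom A s) \<longleftrightarrow> locally_through \<Phi> (Dom A s) s)"
      unfolding open_sieve_def by blast
    have \<Phi>': "\<alpha> \<in> Arr A" "Cod A \<alpha> = a" if "\<alpha> \<in> \<Phi>" for \<alpha> using \<Phi> that by auto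
    obtain Q j where Q: "is_coproduct Sheaves \<Phi> (\<lambda>\<alpha>. Rep (Dom A \<alpha>)) Q j"
      by (rule coproduct_of_representables_exists[of \<Phi> "Dom A"]) (use \<Phi>' in auto)
    have "\<exists>!h. h \<in> hom Sheaves Q (Rep a) \<and> (\<forall>\<alpha>\<in>\<Phi>. Comp Sheaves h (j \<alpha>) = representable_map A \<alpha>)"
      using Q[unfolded is_coproduct_def, THEN conjunct2, THEN conjunct2, rule_format, of "Rep a" "representable_map A"]
        representable_map(1)[OF \<Phi>'(1)] \<Phi>'(2) representable_sheaf[OF a] by simp
    then obtain u where u: "u \<in> hom Sheaves Q (Rep a)"
      and uj: "\<And>\<alpha>. \<alpha> \<in> \<Phi> \<Longrightarrow> Comp Sheaves u (j \<alpha>) = representable_map A \<alpha>" by blast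
    note fac = coproduct_factors_iff[OF \<Phi>(1) Q u uj]
    have "is_image Sheaves u i"
      unfolding is_image_def
    proof (intro conjI allI impI)
      show "u \<in> Arr Sheaves" "Cod Sheaves i = Cod Sheaves u"
        using sheaf_hom_ends[OF u] sheaf_hom_ends[OF i] by simp_all
      show "is_mono Sheaves i" using mono_iff_injective_on_sections[OF i] i_inj by simp
      show "factors_through Sheaves u i"
      proof (subst fac[OF _ i i_inj], assumption, intro ballI)
        fix \<alpha> assume \<alpha>: "\<alpha> \<in> \<Phi>"
        then show "enc \<alpha> \<in> app i (Dom A \<alpha>) ` FO F (Dom A \<alpha>)"
          using sec locally_through_member[OF \<Phi>(1) \<alpha>] \<Phi>'[OF \<alpha>] i_im by simp
      qed
      fix n assume n: "is_mono Sheaves n \<and> Cod Sheaves n = Cod Sheaves u \<and> factors_through Sheaves u n"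
      then have nh: "n \<in> hom Sheaves (fst n) (Rep a)"
        using sheaf_hom_ends[OF u] sheaf_hom_DomCod[of n] by (simp add: is_mono_def)
      have n_inj: "injective_on_sections n" using mono_iff_injective_on_sections[OF nh] n by simp
      have n\<Phi>: "enc \<alpha> \<in> app n (Dom A \<alpha>) ` FO (fst n) (Dom A \<alpha>)" if "\<alpha> \<in> \<Phi>" for \<alpha>
        using fac[OF _ nh n_inj] n that by blast
      show "factors_through Sheaves i n"
        unfolding factors_through_iff[OF i nh n_inj]
      proof (intro ballI)
        fix z t assume z: "z \<in> Obj A" "t \<in> FO F z"
        have "t \<in> FO (Rep a) z" using sheaf_homD(4)[OF i z] i_app[OF z] by simp
        then obtain s where s: "s \<in> Arr A" "Dom A s = z" "Cod A s = a" "t = enc s" by (auto elim: Rep_section)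
        show "app i z t \<in> app n z ` FO (fst n) z"
          using locally_through_image[OF nh n_inj \<Phi>(1) n\<Phi> s(1,3)] sec[OF s(1,3)] i_app[OF z] z s by simp
      qed
    qed
    then show ?L
      unfolding open_subsheaf_def i_def
      by (intro conjI True exI[of _ \<Phi>] \<Phi> exI[of _ Q] exI[of _ j] exI[of _ u] Q u ballI uj)
  qed
qed (simp add: open_subsheaf_def)

text \<open>
  A monomorphism is its own image, and mutual factorization of injective maps is equality of their images.
\<close>

lemma is_image_inclusion_iff:
  assumes q: "q \<in> hom Sheaves P (X :: ('o, 'm, 'u) presheaf)" and q_inj: "injective_on_sections q"
    and L: "inclusion A L X \<in> hom Sheaves L X"
  shows "is_image Sheaves q (inclusion A L X) \<longleftrightarrow> (\<forall>z\<in>Obj A. FO L z = app q z ` FO P z)"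
proof -
  define i where "i = inclusion A L X"
  have i: "i \<in> hom Sheaves L X" and i_inj: "injective_on_sections i"
    and i_app: "\<And>z s. z \<in> Obj A \<Longrightarrow> s \<in> FO L z \<Longrightarrow> app i z s = s"
    using L inclusion_injective by (auto simp: i_def)
  have i_im: "app i z ` FO L z = FO L z" if "z \<in> Obj A" for z using i_app[OF that] by force
  note ends = sheaf_hom_ends[OF q] sheaf_hom_ends[OF i]
  have mono: "is_mono Sheaves q" "is_mono Sheaves i"
    using mono_iff_injective_on_sections[OF q] mono_iff_injective_on_sections[OF i] q_inj i_inj by simp_all
  show ?thesis
    unfolding i_def[symmetric]
  proof
    assume im: "is_image Sheaves q i"
    then have "factors_through Sheaves q i" by (simp add: is_image_def)
    then have 1: "app q z w \<in> FO L z" if "z \<in> Obj A" "w \<in> FO P z" for z w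
      using factors_through_iff[OF q i i_inj] that i_im by blast
    have "factors_through Sheaves q q"
      unfolding factors_through_iff[OF q q q_inj] by blast
    then have "factors_through Sheaves i q" using im mono unfolding is_image_def by blast
    then have "app i z w \<in> app q z ` FO P z" if "z \<in> Obj A" "w \<in> FO L z" for z w
      using factors_through_iff[OF i q q_inj] that by blast
    then show "\<forall>z\<in>Obj A. FO L z = app q z ` FO P z" using 1 i_app by force
  next
    assume eq: "\<forall>z\<in>Obj A. FO L z = app q z ` FO P z"
    show "is_image Sheaves q i"
      unfolding is_image_def
    proof (intro conjI allI impI)
      show "factors_through Sheaves q i"
        unfolding factors_through_iff[OF q i i_inj] using i_im eq by simp
      fix n assume n: "is_mono Sheaves n \<and> Cod Sheaves n = Cod Sheaves q \<and> factors_through Sheaves q n"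
      then have nh: "n \<in> hom Sheaves (fst n) X"
        using ends sheaf_hom_DomCod[of n] by (simp add: is_mono_def)
      have n_inj: "injective_on_sections n" using mono_iff_injective_on_sections[OF nh] n by simp
      show "factors_through Sheaves i n"
        using n unfolding factors_through_iff[OF i nh n_inj] factors_through_iff[OF q nh n_inj]
        by (auto simp: eq i_app)
    qed (use ends mono in simp_all)
  qed
qed

text \<open>
  The last property holds since sections of \<open>F\<close> over the same \<open>t\<close> are sections of the pullback with the
  same image under \<open>q\<close>.
\<close>

lemma pullback_image:
  assumes pb: "is_pullback Sheaves f g p (q :: ('o, 'm, 'u) presheaf_arr)"
    and f: "f \<in> hom Sheaves F G" and g: "g \<in> hom Sheaves X G"
  obtains P where "q \<in> hom Sheaves P X"
    "\<And>z t. z \<in> Obj A \<Longrightarrow> t \<in> FO X z \<Longrightarrow> t \<in> app q z ` FO P z \<longleftrightarrow> app g z t \<in> app f z ` FO F z"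
    "injective_on_sections f \<Longrightarrow> injective_on_sections q"
    "\<And>z s s' t. injective_on_sections q \<Longrightarrow> z \<in> Obj A \<Longrightarrow> s \<in> FO F z \<Longrightarrow> s' \<in> FO F z \<Longrightarrow> t \<in> FO X z \<Longrightarrow>
       app f z s = app g z t \<Longrightarrow> app f z s' = app g z t \<Longrightarrow> s = s'"
proof -
  obtain P where P: "p \<in> hom Sheaves P F" "q \<in> hom Sheaves P X"
      "\<And>z w. z \<in> Obj A \<Longrightarrow> w \<in> FO P z \<Longrightarrow> app f z (app p z w) = app g z (app q z w)"
      "\<And>z s t. z \<in> Obj A \<Longrightarrow> s \<in> FO F z \<Longrightarrow> t \<in> FO X z \<Longrightarrow> app f z s = app g z t \<Longrightarrow>
       \<exists>w\<in>FO P z. app p z w = s \<and> app q z w = t"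
      "\<And>z w w'. z \<in> Obj A \<Longrightarrow> w \<in> FO P z \<Longrightarrow> w' \<in> FO P z \<Longrightarrow> app p z w = app p z w' \<Longrightarrow>
       app q z w = app q z w' \<Longrightarrow> w = w'"
    by (rule pullback_sections[OF pb f g]) blast
  show thesis
  proof (rule that[OF P(2)])
    fix z t assume z: "z \<in> Obj A" and t: "t \<in> FO X z"
    show "t \<in> app q z ` FO P z \<longleftrightarrow> app g z t \<in> app f z ` FO F z"
    proof
      assume "t \<in> app q z ` FO P z"
      then obtain w where w: "t = app q z w" "w \<in> FO P z" by (rule imageE)
      show "app g z t \<in> app f z ` FO F z"
        unfolding w(1) P(3)[OF z w(2), symmetric] using sheaf_homD(4)[OF P(1) z w(2)] by (rule imageI)
    next
      assume "app g z t \<in> app f z ` FO F z"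
      then obtain s where s: "app g z t = app f z s" "s \<in> FO F z" by (rule imageE)
      then show "t \<in> app q z ` FO P z" using P(4)[OF z s(2) t s(1)[symmetric]] by blast
    qed
  next
    assume f_inj: "injective_on_sections f"
    show "injective_on_sections q"
      unfolding injective_on_sections_def sheaf_hom_ends[OF P(2)]
    proof (intro ballI inj_onI)
      fix z w w' assume z: "z \<in> Obj A" and w: "w \<in> FO P z" "w' \<in> FO P z" and eq: "app q z w = app q z w'"
      have "app p z w = app p z w'"
        by (rule injective_on_sectionsD[OF f_inj f z sheaf_homD(4)[OF P(1) z w(1)] sheaf_homD(4)[OF P(1) z w(2)]])
          (simp add: P(3)[OF z w(1)] P(3)[OF z w(2)] eq)
      then show "w = w'" using P(5)[OF z w] eq by simp
    qed
  next
    fix z s s' t assume q_inj: "injective_on_sections q" and z: "z \<in> Obj A" and s: "s \<in> FO F z" "s' \<in> FO F z"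
      and t: "t \<in> FO X z" and eq: "app f z s = app g z t" "app f z s' = app g z t"
    obtain w where w: "w \<in> FO P z" "app p z w = s" "app q z w = t" using P(4)[OF z s(1) t eq(1)] by blast
    obtain w' where w': "w' \<in> FO P z" "app p z w' = s'" "app q z w' = t" using P(4)[OF z s(2) t eq(2)] by blast
    have "w = w'" by (rule injective_on_sectionsD[OF q_inj P(2) z w(1) w'(1)]) (simp add: w w')
    then show "s = s'" using w w' by simp
  qed
qed

text \<open>
  A map from a representable to \<open>G\<close> is a section \<open>r\<close> of \<open>G\<close>, and the image of the pullback of \<open>f\<close> along it
  consists of the arrows along which \<open>r\<close> restricts into the image of \<open>f\<close>.  Two sections of \<open>F\<close> with the
  same image \<open>r\<close> give two sections of this pullback over the identity; this is why an open immersion is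
  injective, for which the pullback along \<open>r\<close> has to exist.
\<close>

lemma open_immersion_iff:
  assumes f: "f \<in> hom Sheaves F G"
  shows "open_immersion imm f \<longleftrightarrow> injective_on_sections f \<and>
    (\<forall>a\<in>Obj A. \<forall>r\<in>FO G a. open_sieve imm a (\<lambda>s. res G s r \<in> app f (Dom A s) ` FO F (Dom A s)))"
    (is "?L \<longleftrightarrow> ?R")
proof
  note G = sheaf_homD(2)[OF f] and f_ends = sheaf_hom_ends[OF f]
  assume L: ?L
  have main: "open_sieve imm a (\<lambda>s. res G s r \<in> app f (Dom A s) ` FO F (Dom A s)) \<and>
      (\<forall>s\<in>FO F a. \<forall>s'\<in>FO F a. app f a s = r \<longrightarrow> app f a s' = r \<longrightarrow> s = s')"
    if a: "a \<in> Obj A" and r: "r \<in> FO G a" for a r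
  proof -
    note y = yoneda_arr[OF G a r]
    obtain p q where pq: "is_pullback Sheaves f (yoneda_arr G a r) p q" by (rule pullback_exists[OF f y(1)])
    have "is_mono Sheaves q \<and> (\<exists>F. is_image Sheaves q (inclusion A F (Rep a)) \<and> open_subsheaf imm a F)"
      using L[unfolded open_immersion_def, THEN conjunct2, rule_format, of a _ p q] a y(1) pq f_ends by simp
    then obtain F' where q_mono: "is_mono Sheaves q" and F': "is_image Sheaves q (inclusion A F' (Rep a))"
      and inc: "inclusion A F' (Rep a) \<in> hom Sheaves F' (Rep a)"
      and op: "open_sieve imm a (\<lambda>s. enc s \<in> FO F' (Dom A s))"
      unfolding open_subsheaf_iff[OF a] by blast
    obtain P where q: "q \<in> hom Sheaves P (Rep a)"
      and im: "\<And>z t. z \<in> Obj A \<Longrightarrow> t \<in> FO (Rep a) z \<Longrightarrow>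
        t \<in> app q z ` FO P z \<longleftrightarrow> app (yoneda_arr G a r) z t \<in> app f z ` FO F z"
      and un: "\<And>z s s' t. injective_on_sections q \<Longrightarrow> z \<in> Obj A \<Longrightarrow> s \<in> FO F z \<Longrightarrow> s' \<in> FO F z \<Longrightarrow> t \<in> FO (Rep a) z \<Longrightarrow>
        app f z s = app (yoneda_arr G a r) z t \<Longrightarrow> app f z s' = app (yoneda_arr G a r) z t \<Longrightarrow> s = s'"
      by (rule pullback_image[OF pq f y(1)]) blast
    have q_inj: "injective_on_sections q" using q_mono mono_iff_injective_on_sections[OF q] by simp
    have "FO F' z = app q z ` FO P z" if "z \<in> Obj A" for z
      using F' is_image_inclusion_iff[OF q q_inj inc] that by blast
    then have "open_sieve imm a (\<lambda>s. res G s r \<in> app f (Dom A s) ` FO F (Dom A s))"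
      using op by (subst open_sieve_cong[where P' = "\<lambda>s. enc s \<in> FO F' (Dom A s)"]) (simp_all add: im y(2))
    moreover have "s = s'" if "s \<in> FO F a" "s' \<in> FO F a" "app f a s = r" "app f a s' = r" for s s'
      by (rule un[OF q_inj a that(1,2), of "enc (Ident A a)"]) (use a that y(3) in auto)
    ultimately show ?thesis by blast
  qed
  have "injective_on_sections f"
    unfolding injective_on_sections_def f_ends
  proof (intro ballI inj_onI)
    fix a s t assume a: "a \<in> Obj A" and st: "s \<in> FO F a" "t \<in> FO F a" and eq: "app f a s = app f a t"
    show "s = t" using main[OF a sheaf_homD(4)[OF f a st(1)]] st eq by auto
  qed
  then show ?R using main by blast
next
  note f_ends = sheaf_hom_ends[OF f]
  assume R: ?R
  have f_inj: "injective_on_sections f" using R by (rule conjunct1)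
  show ?L
    unfolding open_immersion_def
  proof (intro conjI ballI allI impI)
    show "f \<in> Arr Sheaves" by (rule f_ends)
    fix a g p q assume a: "a \<in> Obj A" and "g \<in> hom Sheaves (Rep a) (Cod Sheaves f)"
      and pb: "is_pullback Sheaves f g p q"
    then have g: "g \<in> hom Sheaves (Rep a) G" using f_ends by simp
    obtain P where q: "q \<in> hom Sheaves P (Rep a)"
      and im: "\<And>z t. z \<in> Obj A \<Longrightarrow> t \<in> FO (Rep a) z \<Longrightarrow> t \<in> app q z ` FO P z \<longleftrightarrow> app g z t \<in> app f z ` FO F z"
      and q_inj: "injective_on_sections q"
      by (rule pullback_image[OF pb f g]) (use f_inj in blast)
    show "is_mono Sheaves q" using mono_iff_injective_on_sections[OF q] q_inj by simp
    define r where "r = app g a (enc (Ident A a))"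
    have r: "r \<in> FO G a" using sheaf_homD(4)[OF g a, of "enc (Ident A a)"] a by (simp add: r_def)
    define Y where "Y z = app q z ` FO P z" for z
    define L where "L = presheaf_of Y (res (Rep a))"
    have L: "inclusion A L (Rep a) \<in> hom Sheaves L (Rep a)"
      unfolding L_def
    proof (rule subsheaf[OF representable_sheaf[OF a]])
      show "\<And>z. z \<in> Obj A \<Longrightarrow> Y z \<subseteq> FO (Rep a) z" using sheaf_homD(4)[OF q] by (auto simp: Y_def)
      show "\<And>k s. k \<in> Arr A \<Longrightarrow> s \<in> Y (Cod A k) \<Longrightarrow> res (Rep a) k s \<in> Y (Dom A k)"
        unfolding Y_def by (rule image_res[OF q])
      show "\<And>z s. z \<in> Obj A \<Longrightarrow> s \<in> FO (Rep a) z \<Longrightarrow> locally z (\<lambda>h. res (Rep a) h s \<in> Y (Dom A h)) \<Longrightarrow> s \<in> Y z"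
        unfolding Y_def by (rule image_of_injective_local[OF q q_inj])
    qed
    have FOL: "FO L z = app q z ` FO P z" for z by (simp add: L_def Y_def)
    have "open_sieve imm a (\<lambda>s. res G s r \<in> app f (Dom A s) ` FO F (Dom A s))" using R a r by blast
    then have "open_sieve imm a (\<lambda>s. enc s \<in> FO L (Dom A s))"
      by (subst open_sieve_cong[where P' = "\<lambda>s. res G s r \<in> app f (Dom A s) ` FO F (Dom A s)"])
        (simp_all add: FOL im Rep_hom_app[OF g] r_def)
    then show "\<exists>F. is_image Sheaves q (inclusion A F (Rep a)) \<and> open_subsheaf imm a F"
      using L is_image_inclusion_iff[OF q q_inj L] FOL unfolding open_subsheaf_iff[OF a] by blast
  qed
qed

text \<open>
  A section \<open>r\<close> of \<open>X\<close> restricts into the image of \<open>q\<close> along exactly those arrows along which \<open>g r\<close>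
  restricts into the image of \<open>f\<close>.
\<close>

lemma open_immersion_base_change:
  assumes f: "open_immersion imm f" and pb: "is_pullback Sheaves f g p q"
  shows "open_immersion imm q"
proof -
  define F G X where "F = fst f" and "G = snd (snd f)" and "X = fst g"
  have fh: "f \<in> hom Sheaves F G" and gh: "g \<in> hom Sheaves X G"
    using pb by (auto simp: is_pullback_def hom_def F_def G_def X_def)
  note R = f[unfolded open_immersion_iff[OF fh]]
  obtain P where q: "q \<in> hom Sheaves P X"
    and im: "\<And>z t. z \<in> Obj A \<Longrightarrow> t \<in> FO X z \<Longrightarrow> t \<in> app q z ` FO P z \<longleftrightarrow> app g z t \<in> app f z ` FO F z"
    and q_inj: "injective_on_sections q"
    by (rule pullback_image[OF pb fh gh]) (use R[THEN conjunct1] in blast)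
  note X = sheaf_homD(1)[OF gh]
  have "open_sieve imm a (\<lambda>s. res X s r \<in> app q (Dom A s) ` FO P (Dom A s))"
    if a: "a \<in> Obj A" and r: "r \<in> FO X a" for a r
  proof -
    have "res X s r \<in> app q (Dom A s) ` FO P (Dom A s) \<longleftrightarrow> res G s (app g a r) \<in> app f (Dom A s) ` FO F (Dom A s)"
      if s: "s \<in> Arr A" "Cod A s = a" for s
      using im[of "Dom A s" "res X s r"] sheaf_res(1)[OF X s(1), of r] sheaf_homD(5)[OF gh s(1), of r] s r by simp
    then show ?thesis
      using R a sheaf_homD(4)[OF gh a r]
      by (subst open_sieve_cong[where P' = "\<lambda>s. res G s (app g a r) \<in> app f (Dom A s) ` FO F (Dom A s)"]) blast+
  qed
  then show ?thesis unfolding open_immersion_iff[OF q] using q_inj by blast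
qed

text \<open>
  The composites of the immersions that generate the sieve of \<open>r\<close> for \<open>g\<close> with those that generate the
  sieves of the resulting sections \<open>t \<alpha>\<close> of \<open>G\<close> for \<open>f\<close> generate the sieve of \<open>r\<close> for \<open>g \<cdot> f\<close>.
\<close>

lemma open_immersion_Comp:
  assumes f: "open_immersion imm f" and g: "open_immersion imm g" and fg: "Cod Sheaves f = Dom Sheaves g"
    and imm: "\<And>\<alpha> \<beta>. \<alpha> \<in> Arr A \<Longrightarrow> \<beta> \<in> Arr A \<Longrightarrow> Cod A \<beta> = Dom A \<alpha> \<Longrightarrow> imm \<alpha> \<Longrightarrow> imm \<beta> \<Longrightarrow> imm (\<alpha> \<cdot> \<beta>)"
  shows "open_immersion imm (g \<cdot>\<^bsub>Sheaves\<^esub> f)"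
proof -
  define F G H where "F = fst f" and "G = fst g" and "H = snd (snd g)"
  have fh: "f \<in> hom Sheaves F G" and gh: "g \<in> hom Sheaves G H"
    using f g fg by (auto simp: open_immersion_def hom_def F_def G_def H_def)
  note gf = sheaf_Comp[OF fh gh]
  note Rf = f[unfolded open_immersion_iff[OF fh]] and Rg = g[unfolded open_immersion_iff[OF gh]]
  have f_inj: "injective_on_sections f" and g_inj: "injective_on_sections g" using Rf Rg by blast+
  note G = sheaf_homD(1)[OF gh] and H = sheaf_homD(2)[OF gh]
  have gf_inj: "injective_on_sections (g \<cdot>\<^bsub>Sheaves\<^esub> f)"
    unfolding injective_on_sections_def sheaf_hom_ends[OF gf(1)]
  proof (intro ballI inj_onI)
    fix z s t assume z: "z \<in> Obj A" and st: "s \<in> FO F z" "t \<in> FO F z"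
      and eq: "app (g \<cdot>\<^bsub>Sheaves\<^esub> f) z s = app (g \<cdot>\<^bsub>Sheaves\<^esub> f) z t"
    note fs = sheaf_homD(4)[OF fh z st(1)] and ft = sheaf_homD(4)[OF fh z st(2)]
    have "app f z s = app f z t"
      by (rule injective_on_sectionsD[OF g_inj gh z fs ft]) (use gf(2)[OF z] st eq in simp)
    then show "s = t" using injective_on_sectionsD[OF f_inj fh z st] by simp
  qed
  show ?thesis
    unfolding open_immersion_iff[OF gf(1)]
  proof (intro conjI ballI gf_inj)
    fix a r assume a: "a \<in> Obj A" and r: "r \<in> FO H a"
    obtain \<Phi> where \<Phi>: "\<Phi> \<subseteq> {\<alpha> \<in> Arr A. Cod A \<alpha> = a}" "\<forall>\<alpha>\<in>\<Phi>. imm \<alpha>"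
      and sec: "\<And>s. s \<in> Arr A \<Longrightarrow> Cod A s = a \<Longrightarrow>
          (res H s r \<in> app g (Dom A s) ` FO G (Dom A s) \<longleftrightarrow> locally_through \<Phi> (Dom A s) s)"
      using Rg[THEN conjunct2, rule_format, OF a r] unfolding open_sieve_def by blast
    have \<Phi>': "\<alpha> \<in> Arr A" "Cod A \<alpha> = a" "imm \<alpha>" if "\<alpha> \<in> \<Phi>" for \<alpha> using \<Phi> that by auto
    \<comment> \<open>Each generator factors through itself, so \<open>r\<close> restricted along it comes from \<open>G\<close>.\<close>
    have "\<exists>t. t \<in> FO G (Dom A \<alpha>) \<and> app g (Dom A \<alpha>) t = res H \<alpha> r" if \<alpha>: "\<alpha> \<in> \<Phi>" for \<alpha>
      using sec[OF \<Phi>'(1,2)[OF \<alpha>]] locally_through_member[OF \<Phi>(1) \<alpha>] by (metis imageE)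
    then obtain t where t: "\<And>\<alpha>. \<alpha> \<in> \<Phi> \<Longrightarrow> t \<alpha> \<in> FO G (Dom A \<alpha>)"
      "\<And>\<alpha>. \<alpha> \<in> \<Phi> \<Longrightarrow> app g (Dom A \<alpha>) (t \<alpha>) = res H \<alpha> r" by metis
    define good where "good \<alpha> \<Psi> \<longleftrightarrow> \<Psi> \<subseteq> {\<beta> \<in> Arr A. Cod A \<beta> = Dom A \<alpha>} \<and> (\<forall>\<beta>\<in>\<Psi>. imm \<beta>) \<and>
       (\<forall>s\<in>Arr A. Cod A s = Dom A \<alpha> \<longrightarrow>
          (res G s (t \<alpha>) \<in> app f (Dom A s) ` FO F (Dom A s) \<longleftrightarrow> locally_through \<Psi> (Dom A s) s))" for \<alpha> \<Psi>
    have "\<exists>\<Psi>. good \<alpha> \<Psi>" if \<alpha>: "\<alpha> \<in> \<Phi>" for \<alpha>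
      using Rf[THEN conjunct2, rule_format, OF _ t(1)[OF \<alpha>]] \<Phi>'(1)[OF \<alpha>] by (simp add: good_def open_sieve_def)
    then obtain \<Psi> where good: "\<And>\<alpha>. \<alpha> \<in> \<Phi> \<Longrightarrow> good \<alpha> (\<Psi> \<alpha>)" by metis
    have \<Psi>: "\<Psi> \<alpha> \<subseteq> {\<beta> \<in> Arr A. Cod A \<beta> = Dom A \<alpha>}" "\<beta> \<in> \<Psi> \<alpha> \<Longrightarrow> imm \<beta>"
      and sec\<Psi>: "s \<in> Arr A \<Longrightarrow> Cod A s = Dom A \<alpha> \<Longrightarrow>
        (res G s (t \<alpha>) \<in> app f (Dom A s) ` FO F (Dom A s) \<longleftrightarrow> locally_through (\<Psi> \<alpha>) (Dom A s) s)"
      if "\<alpha> \<in> \<Phi>" for \<alpha> \<beta> s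
      using good[OF that] unfolding good_def by blast+
    have \<Psi>': "\<beta> \<in> Arr A" "Cod A \<beta> = Dom A \<alpha>" if "\<alpha> \<in> \<Phi>" "\<beta> \<in> \<Psi> \<alpha>" for \<alpha> \<beta> using \<Psi>(1)[OF that(1)] that(2) by auto
    define \<Theta> where "\<Theta> = {\<alpha> \<cdot> \<beta> | \<alpha> \<beta>. \<alpha> \<in> \<Phi> \<and> \<beta> \<in> \<Psi> \<alpha>}"
    have \<Theta>: "\<Theta> \<subseteq> {\<alpha> \<in> Arr A. Cod A \<alpha> = a}" using \<Phi>' \<Psi>' by (auto simp: \<Theta>_def)
    have "imm \<theta>" if "\<theta> \<in> \<Theta>" for \<theta> using that \<Phi>' \<Psi>' \<Psi>(2) imm by (auto simp: \<Theta>_def)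
    moreover have "res H s r \<in> app (g \<cdot>\<^bsub>Sheaves\<^esub> f) (Dom A s) ` FO F (Dom A s) \<longleftrightarrow> locally_through \<Theta> (Dom A s) s"
      if s: "s \<in> Arr A" "Cod A s = a" for s
    proof
      have z: "Dom A s \<in> Obj A" using s by simp
      let ?through = "\<lambda>\<Phi> s k. \<exists>\<alpha>\<in>\<Phi>. \<exists>m\<in>Arr A. Cod A m = Dom A \<alpha> \<and> s \<cdot> k = \<alpha> \<cdot> m"
      { assume "res H s r \<in> app (g \<cdot>\<^bsub>Sheaves\<^esub> f) (Dom A s) ` FO F (Dom A s)"
        then obtain w where gfw: "res H s r = app (g \<cdot>\<^bsub>Sheaves\<^esub> f) (Dom A s) w"
          and w1: "w \<in> FO F (Dom A s)" by (rule imageE)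
        note w = w1 gfw[unfolded gf(2)[OF z w1]]
        note fw = sheaf_homD(4)[OF fh z w(1)]
        have "locally_through \<Phi> (Dom A s) s" using sec[OF s] w fw by blast
        then have l: "locally (Dom A s) (?through \<Phi> s)" by (simp add: locally_through_def)
        show "locally_through \<Theta> (Dom A s) s"
          unfolding locally_through_def
        proof (rule locally_trans[OF z stable_through[OF \<Theta> s(1)] l])
          fix k assume k: "k \<in> Arr A" "Cod A k = Dom A s" "?through \<Phi> s k"
          then obtain \<alpha> m where m: "\<alpha> \<in> \<Phi>" "m \<in> Arr A" "Cod A m = Dom A \<alpha>" "s \<cdot> k = \<alpha> \<cdot> m" by blast
          note \<alpha> = \<Phi>'[OF m(1)]
          have Dm: "Dom A m = Dom A k" by (rule Comp_eq_Dom[OF m(4)]) (use s k m \<alpha> in auto)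
          have zk: "Dom A k \<in> Obj A" using k by simp
          \<comment> \<open>Both sides have the same image in \<open>H\<close>, and \<open>g\<close> is injective.\<close>
          have e1: "res G m (t \<alpha>) = res G k (app f (Dom A s) w)"
          proof (rule injective_on_sectionsD[OF g_inj gh zk])
            show "res G m (t \<alpha>) \<in> FO G (Dom A k)" using sheaf_res(1)[OF G m(2)] t(1)[OF m(1)] m(3) Dm by simp
            show "res G k (app f (Dom A s) w) \<in> FO G (Dom A k)" using sheaf_res(1)[OF G k(1)] fw k by simp
            have "app g (Dom A k) (res G m (t \<alpha>)) = res H m (res H \<alpha> r)"
              using sheaf_homD(5)[OF gh m(2)] t[OF m(1)] m(3) Dm by simp
            also have "\<dots> = res H (\<alpha> \<cdot> m) r" using sheaf_res(3)[OF H \<alpha>(1) m(2,3)] \<alpha> r by simp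
            also have "\<dots> = res H k (res H s r)" using sheaf_res(3)[OF H s(1) k(1,2)] m(4) s r by simp
            also have "\<dots> = app g (Dom A k) (res G k (app f (Dom A s) w))"
              using sheaf_homD(5)[OF gh k(1)] fw k w by simp
            finally show "app g (Dom A k) (res G m (t \<alpha>)) = app g (Dom A k) (res G k (app f (Dom A s) w))" .
          qed
          also have "\<dots> = app f (Dom A m) (res F k w)" using sheaf_homD(5)[OF fh k(1)] w k Dm by simp
          finally have "res G m (t \<alpha>) \<in> app f (Dom A m) ` FO F (Dom A m)"
            using sheaf_res(1)[OF sheaf_homD(1)[OF fh] k(1)] w k Dm by auto
          then have "locally (Dom A m) (?through (\<Psi> \<alpha>) m)"
            using sec\<Psi>[OF m(1-3)] by (simp add: locally_through_def)
          then show "locally (Dom A k) (\<lambda>l. ?through \<Theta> s (k \<cdot> l))"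
            unfolding Dm
          proof (rule locally_mono[OF zk])
            show "stable (Dom A k) (\<lambda>l. ?through \<Theta> s (k \<cdot> l))"
            proof (rule stableI)
              fix h l assume h: "h \<in> Arr A" "Cod A h = Dom A k" "?through \<Theta> s (k \<cdot> h)" "l \<in> Arr A" "Cod A l = Dom A h"
              show "?through \<Theta> s (k \<cdot> (h \<cdot> l))"
                using stableD[OF stable_through[OF \<Theta> s(1)], of "k \<cdot> h" l] h k by simp
            qed
            fix l assume l: "l \<in> Arr A" "Cod A l = Dom A k" "?through (\<Psi> \<alpha>) m l"
            then obtain \<beta> n where n: "\<beta> \<in> \<Psi> \<alpha>" "n \<in> Arr A" "Cod A n = Dom A \<beta>" "m \<cdot> l = \<beta> \<cdot> n" by blast
            note \<beta> = \<Psi>'[OF m(1) n(1)]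
            have "s \<cdot> (k \<cdot> l) = (s \<cdot> k) \<cdot> l" using s k l by simp
            also have "\<dots> = \<alpha> \<cdot> (m \<cdot> l)" unfolding m(4) using \<alpha> m l Dm by simp
            also have "\<dots> = (\<alpha> \<cdot> \<beta>) \<cdot> n" unfolding n(4) using \<alpha> \<beta> n by simp
            finally have "s \<cdot> (k \<cdot> l) = (\<alpha> \<cdot> \<beta>) \<cdot> n" .
            moreover have "\<alpha> \<cdot> \<beta> \<in> \<Theta>" using m n by (auto simp: \<Theta>_def)
            ultimately show "?through \<Theta> s (k \<cdot> l)"
              using \<alpha> \<beta> n by (intro bexI[of _ "\<alpha> \<cdot> \<beta>"] bexI[of _ n]) auto
          qed
        qed }
      assume "locally_through \<Theta> (Dom A s) s"
      then have l: "locally (Dom A s) (?through \<Theta> s)" by (simp add: locally_through_def)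
      show "res H s r \<in> app (g \<cdot>\<^bsub>Sheaves\<^esub> f) (Dom A s) ` FO F (Dom A s)"
      proof (rule image_of_injective_local[OF gf(1) gf_inj z])
        show rs: "res H s r \<in> FO H (Dom A s)" using sheaf_res(1)[OF H s(1)] s r by simp
        show "locally (Dom A s) (\<lambda>h. res H h (res H s r) \<in> app (g \<cdot>\<^bsub>Sheaves\<^esub> f) (Dom A h) ` FO F (Dom A h))"
        proof (rule locally_mono[OF z l])
          show "stable (Dom A s) (\<lambda>h. res H h (res H s r) \<in> app (g \<cdot>\<^bsub>Sheaves\<^esub> f) (Dom A h) ` FO F (Dom A h))"
          proof (rule stableI)
            fix h k assume h: "h \<in> Arr A" "Cod A h = Dom A s"
              "res H h (res H s r) \<in> app (g \<cdot>\<^bsub>Sheaves\<^esub> f) (Dom A h) ` FO F (Dom A h)" "k \<in> Arr A" "Cod A k = Dom A h"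
            then show "res H (h \<cdot> k) (res H s r) \<in> app (g \<cdot>\<^bsub>Sheaves\<^esub> f) (Dom A (h \<cdot> k)) ` FO F (Dom A (h \<cdot> k))"
              using image_res[OF gf(1) h(4), of "res H h (res H s r)"] sheaf_res(3)[OF H h(1,4,5)] rs by simp
          qed
          fix k assume k: "k \<in> Arr A" "Cod A k = Dom A s" "?through \<Theta> s k"
          then obtain \<theta> n where n: "\<theta> \<in> \<Theta>" "n \<in> Arr A" "Cod A n = Dom A \<theta>" "s \<cdot> k = \<theta> \<cdot> n" by blast
          then obtain \<alpha> \<beta> where \<theta>: "\<theta> = \<alpha> \<cdot> \<beta>" "\<alpha> \<in> \<Phi>" "\<beta> \<in> \<Psi> \<alpha>" by (auto simp: \<Theta>_def)
          note \<alpha> = \<Phi>'[OF \<theta>(2)] and \<beta> = \<Psi>'[OF \<theta>(2,3)]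
          have n3: "Cod A n = Dom A \<beta>" using n \<theta> \<alpha> \<beta> by simp
          have Dn: "Dom A n = Dom A k" by (rule Comp_eq_Dom[OF n(4)]) (use s k n \<theta> \<alpha> \<beta> in auto)
          have zb: "Dom A \<beta> \<in> Obj A" using \<beta> by simp
          have "res G \<beta> (t \<alpha>) \<in> app f (Dom A \<beta>) ` FO F (Dom A \<beta>)"
            using sec\<Psi>[OF \<theta>(2) \<beta>] locally_through_member[OF \<Psi>(1)[OF \<theta>(2)] \<theta>(3)] by simp
          then obtain w where w: "w \<in> FO F (Dom A \<beta>)" "res G \<beta> (t \<alpha>) = app f (Dom A \<beta>) w" by (metis imageE)
          have "app (g \<cdot>\<^bsub>Sheaves\<^esub> f) (Dom A \<beta>) w = app g (Dom A \<beta>) (res G \<beta> (t \<alpha>))" using gf(2)[OF zb w(1)] w by simp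
          also have "\<dots> = res H \<beta> (res H \<alpha> r)" using sheaf_homD(5)[OF gh \<beta>(1)] t[OF \<theta>(2)] \<beta> by simp
          also have "\<dots> = res H \<theta> r" using sheaf_res(3)[OF H \<alpha>(1) \<beta>] \<alpha> r \<theta> by simp
          finally have "res H \<theta> r \<in> app (g \<cdot>\<^bsub>Sheaves\<^esub> f) (Cod A n) ` FO F (Cod A n)" using w n3 by force
          from image_res[OF gf(1) n(2) this]
          have "res H n (res H \<theta> r) \<in> app (g \<cdot>\<^bsub>Sheaves\<^esub> f) (Dom A k) ` FO F (Dom A k)" using Dn by simp
          moreover have "res H n (res H \<theta> r) = res H (s \<cdot> k) r"
            using sheaf_res(3)[OF H _ n(2,3), of r] n \<theta> \<alpha> \<beta> r by simp
          moreover have "\<dots> = res H k (res H s r)" using sheaf_res(3)[OF H s(1) k(1,2)] s r by simp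
          ultimately show "res H k (res H s r) \<in> app (g \<cdot>\<^bsub>Sheaves\<^esub> f) (Dom A k) ` FO F (Dom A k)" by simp
        qed
      qed
    qed
    ultimately show "open_sieve imm a (\<lambda>s. res H s r \<in> app (g \<cdot>\<^bsub>Sheaves\<^esub> f) (Dom A s) ` FO F (Dom A s))"
      unfolding open_sieve_def
      using \<Theta> by blast
  qed
qed

end

section \<open>Zariski open immersions\<close>

text \<open>
  A spectral cover is an fpqc cover, so a sheaf for the fpqc topology is a sheaf for the spectral one.
\<close>

lemma subcanonical_spectral_site:
  assumes u: "infinite (UNIV :: 'u set)" "Pow (Arr (Comm C)) \<lesssim> (UNIV :: 'u set)"
    and C: "symmetric_monoidal C" and sub: "subcanonical TYPE('u) C M"
  shows "subcanonical_site TYPE('u) (Aff C) (spectral_topology S C M)"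
proof -
  have Aff: "category (Aff C)" unfolding Aff_def by (rule category_op_cat[OF category_Comm[OF C]])
  have fpqc: "spectral_topology S C M x \<subseteq> fpqc_topology C M x" for x
    unfolding spectral_topology_def fpqc_topology_def
    by (rule generated_topology_mono) (simp add: spectral_cover_def)
  have sheaf: "is_sheaf (Aff C) (spectral_topology S C M) (representable (Aff C) a :: ('a, 'b, 'u) aff_sheaf)"
    if "a \<in> Obj (Aff C)" for a
    using sub that by (intro is_sheaf_mono[OF _ fpqc]) (simp add: subcanonical_def)
  have top: "grothendieck_topology (Aff C) (spectral_topology S C M)"
    unfolding spectral_topology_def by (rule generated_topology_grothendieck[OF Aff])
  have "Pow (Arr (Aff C)) \<lesssim> (UNIV :: 'u set)" using u(2) by (simp add: Aff_def)
  with Aff top sheaf u(1) show ?thesis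
    by (intro subcanonical_site.intro site.intro site_axioms.intro subcanonical_site_axioms.intro)
qed

lemma zariski_open_immersion_iff:
  assumes "subcanonical_site TYPE('u) (Aff C) (spectral_topology S C M)"
  shows "zariski_open_immersion S C M (f :: ('o, 'm, 'u) aff_sheaf_arr) \<longleftrightarrow>
     subcanonical_site.open_immersion (Aff C) (spectral_topology S C M) (spectral_immersion S C M) f"
proof -
  interpret subcanonical_site "Aff C" "spectral_topology S C M" "TYPE('u)" by fact
  show ?thesis
    unfolding zariski_open_immersion_def zariski_open_def open_immersion_def open_subsheaf_def Sh_def Let_def ..
qed

theorem lemma4p5:
  fixes C :: "('o, 'm) smc" and M :: "('o, 'm, 'n, 'k) actegory"
  assumes "infinite (UNIV :: 's set)"
    and "infinite (UNIV :: 'u set)" and "Pow (Arr (Comm C)) \<lesssim> (UNIV :: 'u set)"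
    and "closed_symmetric_monoidal C" and "complete TYPE('s) C" and "cocomplete TYPE('s) C"
    and "left_actegory C M" and "complete TYPE('s) M" and "cocomplete TYPE('s) M"
    and "\<And>a. a \<in> Obj C \<Longrightarrow> preserves_colimits TYPE('s) M M (act_by C M a)"
    and "\<And>m. m \<in> Obj M \<Longrightarrow> preserves_colimits TYPE('s) C M (act_on M m)"
    and "subcanonical TYPE('u) C M"
  shows "(\<forall>(f :: ('o, 'm, 'u) aff_sheaf_arr) g p q.
            zariski_open_immersion TYPE('s) C M f \<and> is_pullback (Sh TYPE('s) C M) f g p q
            \<longrightarrow> zariski_open_immersion TYPE('s) C M q) \<and>
         (\<forall>(f :: ('o, 'm, 'u) aff_sheaf_arr) g.
            zariski_open_immersion TYPE('s) C M f \<and> zariski_open_immersion TYPE('s) C M g \<and>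
            Cod (Sh TYPE('s) C M :: (('o, 'm, 'u) aff_sheaf, _) cat) f =
            Dom (Sh TYPE('s) C M :: (('o, 'm, 'u) aff_sheaf, _) cat) g
            \<longrightarrow> zariski_open_immersion TYPE('s) C M (g \<cdot>\<^bsub>Sh TYPE('s) C M\<^esub> f))"
proof -
  have C: "symmetric_monoidal C" using assms(4) by (simp add: closed_symmetric_monoidal_def)
  note site = subcanonical_spectral_site[OF assms(2,3) C assms(12), of "TYPE('s)"]
  interpret subcanonical_site "Aff C" "spectral_topology TYPE('s) C M" "TYPE('u)" by (rule site)
  have Sh: "(Sh TYPE('s) C M :: (('o, 'm, 'u) aff_sheaf, ('o, 'm, 'u) aff_sheaf_arr) cat) = Sheaves"
    by (simp add: Sh_def)
  have immersion_Comp: "spectral_immersion TYPE('s) C M (Comp (Aff C) \<alpha> \<beta>)"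
    if "Cod (Aff C) \<beta> = Dom (Aff C) \<alpha>" "spectral_immersion TYPE('s) C M \<alpha>" "spectral_immersion TYPE('s) C M \<beta>"
    for \<alpha> \<beta>
    using spectral_immersion_Comp[OF C assms(7) that(2,3)] that(1) by (simp add: Aff_def)
  show ?thesis
    unfolding zariski_open_immersion_iff[OF site] Sh
  proof (intro conjI allI impI; elim conjE)
    fix f g p q
    assume "open_immersion (spectral_immersion TYPE('s) C M) f" "is_pullback Sheaves f g p q"
    then show "open_immersion (spectral_immersion TYPE('s) C M) q" by (rule open_immersion_base_change)
  next
    fix f g
    assume "open_immersion (spectral_immersion TYPE('s) C M) f" "open_immersion (spectral_immersion TYPE('s) C M) g"
      and "Cod Sheaves f = Dom Sheaves g"
    then show "open_immersion (spectral_immersion TYPE('s) C M) (g \<cdot>\<^bsub>Sheaves\<^esub> f)"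
      by (rule open_immersion_Comp) (rule immersion_Comp)
  qed
qed

end
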